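(* Let $\rho_t > 0$ satisfy the transport equation in weak form on $\Omega$ with a velocity field $\boldsymbol{u}_t$ such that $\boldsymbol{u}_t \equiv 0$ on $\partial\Omega$, and let $\hat\rho_t \in V$ be the continuous Fisher-Rao Galerkin approximation of $\rho_t$ in the finite-dimensional space $V$. Then, if $\hat\rho_t$ is positive, the Kullback-Leibler divergence $\mathbb{D}_{\mathrm{KL}}(\rho_t \,\|\, \hat\rho_t)$ satisfies $$\frac{\mathrm{d}}{\mathrm{d}t}\, \mathbb{D}_{\mathrm{KL}}(\rho_t \,\|\, \hat\rho_t) = \inf_{\hat\sigma \in V} \left( - \left\langle \dot{\hat\rho}_t + \operatorname{div}(\hat\rho_t \boldsymbol{u}_t),\ \rho_t - \hat\sigma \right\rangle_{\hat\rho_t} \right) \le \left\| \dot{\hat\rho}_t + \operatorname{div}(\hat\rho_t \boldsymbol{u}_t) \right\|_{\hat\rho_t} \left\| \rho_t - \hat{\hat\rho}_t \right\|_{\hat\rho_t},$$ where $\hat{\hat\rho}_t$ denotes the orthogonal projection of $\rho_t$ onto $V$ with respect to the Fisher-Rao inner product $\langle\cdot,\cdot\rangle_{\hat\rho_t}$.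
   Context: $\Omega \subset \mathbb{R}^d$ is a domain and $\boldsymbol{u}_t$ is a time-dependent velocity field, Lipschitz continuous on $\overline{\Omega}$. A dot denotes the time derivative and $\mathrm{D}$ the spatial derivative. Weak transport equation (when $\boldsymbol{u}_t \equiv 0$ on $\partial\Omega$ there are no boundary terms): for all smooth test functions $\psi$, $$\partial_t \int_\Omega \psi \rho_t \,\mathrm{d}\boldsymbol{x} - \int_\Omega (\mathrm{D}\psi)\, \rho_t \boldsymbol{u}_t \,\mathrm{d}\boldsymbol{x} = 0, \quad\text{equivalently}\quad \partial_t \int_\Omega \psi \rho_t \,\mathrm{d}\boldsymbol{x} + \int_\Omega \psi \operatorname{div}(\rho_t \boldsymbol{u}_t) \,\mathrm{d}\boldsymbol{x} = 0 .$$ Galerkin space: $V = \operatorname{span}\{\varphi_1,\dots,\varphi_m\}$, where the $\varphi_i$ are linearly independent Lipschitz continuous functions on $\overline\Omega$, some linear combination of which is bounded below by a positive number. Fisher-Rao inner product: for a positive density $\sigma$ on $\Omega$, $\langle p, q\rangle_{\sigma} := \int_\Omega \frac{p q}{\sigma}\,\mathrm{d}\boldsymbol{x}$ and $\|p\|_\sigma := \langle p,p\rangle_\sigma^{1/2}$. Continuous Fisher-Rao Galerkin approximation (for $\boldsymbol{u}_t \equiv 0$ on $\partial\Omega$): a curve $\hat\rho_t = \sum_{i=1}^m r_i(t)\varphi_i \in V$ with $$\int_\Omega \frac{\hat\sigma\, \dot{\hat\rho}_t}{\hat\rho_t}\,\mathrm{d}\boldsymbol{x} + \int_\Omega \frac{\hat\sigma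 \operatorname{div}(\hat\rho_t \boldsymbol{u}_t)}{\hat\rho_t}\,\mathrm{d}\boldsymbol{x} = 0 \quad \text{for all } \hat\sigma \in V .$$ (Generalized) Kullback-Leibler divergence of densities on $\Omega$: $\mathbb{D}_{\mathrm{KL}}(\rho \,\|\, \sigma) := \int_\Omega \log\!\left(\frac{\rho}{\sigma}\right)\rho \,\mathrm{d}\boldsymbol{x} - \int_\Omega \rho \,\mathrm{d}\boldsymbol{x} + \int_\Omega \sigma \,\mathrm{d}\boldsymbol{x}$. The densities are understood to be regular enough in space and time for all derivatives and integrals in the claim to be defined. *)

theory Defs
  imports "HOL-Analysis.Analysis"
begin

text \<open>
  Functions on a domain or on its closure are rendered as total functions whose values
  elsewhere are irrelevant. All integrals are Lebesgue integrals over \<open>lebesgue_on \<Omega>\<close>.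
\<close>

section \<open>Differential operators and test functions\<close>

text \<open>
  The sum of the partial derivatives. For a locally Lipschitz field these exist almost everywhere
  (Rademacher); the value of \<open>deriv\<close> on the exceptional null set is irrelevant in integrals.
\<close>
definition divergence :: "('a::euclidean_space \<Rightarrow> 'a) \<Rightarrow> 'a \<Rightarrow> real" where
  "divergence F x = (\<Sum>b\<in>Basis. deriv (\<lambda>s. F (x + s *\<^sub>R b) \<bullet> b) 0)"

primrec Ck :: "nat \<Rightarrow> ('a::euclidean_space \<Rightarrow> real) \<Rightarrow> bool" where
  "Ck 0 f \<longleftrightarrow> continuous_on UNIV f"
| "Ck (Suc k) f \<longleftrightarrow>
     f differentiable_on UNIV \<and> (\<forall>v. Ck k (\<lambda>x. frechet_derivative f (at x) v))"

text \<open>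
  Test functions are smooth on the whole space and need not vanish on the boundary of the domain.
  Compact support only serves to make the integrals over unbounded domains meaningful; on a bounded
  domain it is no restriction.
\<close>
definition test_function :: "('a::euclidean_space \<Rightarrow> real) \<Rightarrow> bool" where
  "test_function \<psi> \<longleftrightarrow> (\<forall>k. Ck k \<psi>) \<and> compact (closure {x. \<psi> x \<noteq> 0})"

section \<open>Transport equation\<close>

text \<open>Weak form without boundary terms, for velocity fields vanishing on the boundary.\<close>
definition weak_transport ::
  "real set \<Rightarrow> ('a::euclidean_space) set \<Rightarrow> (real \<Rightarrow> 'a \<Rightarrow> 'a) \<Rightarrow> (real \<Rightarrow> 'a \<Rightarrow> real) \<Rightarrow> bool"
where
  "weak_transport T \<Omega> u \<rho> \<longleftrightarrow>
     (\<forall>\<psi>. test_function \<psi> \<longrightarrow> (\<forall>t\<in>T.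
        ((\<lambda>s. LINT x|lebesgue_on \<Omega>. \<psi> x * \<rho> s x) has_real_derivative
         (LINT x|lebesgue_on \<Omega>. frechet_derivative \<psi> (at x) (u t x) * \<rho> t x)) (at t)))"

text \<open>
  Regularity in time under which \<open>\<integral> f\<^sub>t\<close> can be differentiated under the integral sign: each
  \<open>f\<^sub>t\<close> is integrable, \<open>f\<close> is differentiable in time at almost every point, and its difference
  quotients at each time are locally dominated by an integrable function.
\<close>
definition time_regular ::
  "real set \<Rightarrow> ('a::euclidean_space) set \<Rightarrow> (real \<Rightarrow> 'a \<Rightarrow> real) \<Rightarrow> bool"
where
  "time_regular T \<Omega> f \<longleftrightarrow> (\<forall>t\<in>T.
     integrable (lebesgue_on \<Omega>) (f t) \<and>
     (AE x in lebesgue_on \<Omega>. (\<lambda>s. f s x) differentiable at t) \<and>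
     (\<exists>\<epsilon>>0. \<exists>g. integrable (lebesgue_on \<Omega>) g \<and>
        (\<forall>s\<in>T \<inter> ball t \<epsilon>. AE x in lebesgue_on \<Omega>. \<bar>f s x - f t x\<bar> \<le> g x * \<bar>s - t\<bar>)))"

section \<open>Fisher-Rao geometry and Kullback-Leibler divergence\<close>

definition fr_inner ::
  "('a::euclidean_space) set \<Rightarrow> ('a \<Rightarrow> real) \<Rightarrow> ('a \<Rightarrow> real) \<Rightarrow> ('a \<Rightarrow> real) \<Rightarrow> real"
where
  "fr_inner \<Omega> \<sigma> p q = (LINT x|lebesgue_on \<Omega>. p x * q x / \<sigma> x)"

definition fr_norm ::
  "('a::euclidean_space) set \<Rightarrow> ('a \<Rightarrow> real) \<Rightarrow> ('a \<Rightarrow> real) \<Rightarrow> real"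
where
  "fr_norm \<Omega> \<sigma> p = sqrt (fr_inner \<Omega> \<sigma> p p)"

text \<open>The functions of finite Fisher-Rao norm; between these the inner product is defined.\<close>
definition fr_L2 ::
  "('a::euclidean_space) set \<Rightarrow> ('a \<Rightarrow> real) \<Rightarrow> ('a \<Rightarrow> real) set"
where
  "fr_L2 \<Omega> \<sigma> = {p. p \<in> borel_measurable (lebesgue_on \<Omega>) \<and>
                    integrable (lebesgue_on \<Omega>) (\<lambda>x. p x * p x / \<sigma> x)}"

definition KL_div ::
  "('a::euclidean_space) set \<Rightarrow> ('a \<Rightarrow> real) \<Rightarrow> ('a \<Rightarrow> real) \<Rightarrow> real"
where
  "KL_div \<Omega> \<rho> \<sigma> = (LINT x|lebesgue_on \<Omega>. ln (\<rho> x / \<sigma> x) * \<rho> x)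
                    - (LINT x|lebesgue_on \<Omega>. \<rho> x) + (LINT x|lebesgue_on \<Omega>. \<sigma> x)"

section \<open>Galerkin approximation\<close>

definition galerkin_space :: "nat \<Rightarrow> (nat \<Rightarrow> 'a \<Rightarrow> real) \<Rightarrow> ('a \<Rightarrow> real) set" where
  "galerkin_space m \<phi> = {\<sigma>. \<exists>c. \<sigma> = (\<lambda>x. \<Sum>i=1..m. c i * \<phi> i x)}"

definition galerkin_basis ::
  "('a::euclidean_space) set \<Rightarrow> nat \<Rightarrow> (nat \<Rightarrow> 'a \<Rightarrow> real) \<Rightarrow> bool"
where
  "galerkin_basis \<Omega> m \<phi> \<longleftrightarrow>
     (\<forall>i\<in>{1..m}. \<exists>L. L-lipschitz_on (closure \<Omega>) (\<phi> i)) \<and>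
     (\<forall>c. (\<forall>x\<in>closure \<Omega>. (\<Sum>i=1..m. c i * \<phi> i x) = 0) \<longrightarrow> (\<forall>i\<in>{1..m}. c i = 0)) \<and>
     (\<exists>\<sigma>\<in>galerkin_space m \<phi>. \<exists>\<delta>>0. \<forall>x\<in>closure \<Omega>. \<delta> \<le> \<sigma> x)"

abbreviation time_deriv :: "(real \<Rightarrow> 'a \<Rightarrow> real) \<Rightarrow> real \<Rightarrow> 'a \<Rightarrow> real" where
  "time_deriv f t x \<equiv> deriv (\<lambda>s. f s x) t"

definition fisher_rao_galerkin ::
  "real set \<Rightarrow> ('a::euclidean_space) set \<Rightarrow> nat \<Rightarrow> (nat \<Rightarrow> 'a \<Rightarrow> real) \<Rightarrow>
   (real \<Rightarrow> 'a \<Rightarrow> 'a) \<Rightarrow> (real \<Rightarrow> 'a \<Rightarrow> real) \<Rightarrow> bool"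
where
  "fisher_rao_galerkin T \<Omega> m \<phi> u \<rho>h \<longleftrightarrow>
     (\<exists>r. (\<forall>i\<in>{1..m}. r i differentiable_on T) \<and>
          (\<forall>t\<in>T. \<forall>x\<in>closure \<Omega>. \<rho>h t x = (\<Sum>i=1..m. r i t * \<phi> i x))) \<and>
     (\<forall>t\<in>T. \<forall>\<sigma>\<in>galerkin_space m \<phi>.
        (LINT x|lebesgue_on \<Omega>. \<sigma> x * time_deriv \<rho>h t x / \<rho>h t x)
        + (LINT x|lebesgue_on \<Omega>. \<sigma> x * divergence (\<lambda>y. \<rho>h t y *\<^sub>R u t y) x / \<rho>h t x) = 0)"

text \<open>
  The orthogonal projection of \<open>p\<close> onto \<open>V\<close> with respect to the Fisher-Rao inner product. When \<open>V\<close> is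
  spanned by functions that are continuous and linearly independent on \<open>closure \<Omega>\<close>, and \<open>p\<close> and \<open>V\<close>
  have finite Fisher-Rao norm for a positive \<open>\<sigma>\<close>, there is exactly one such element of \<open>V\<close>.
\<close>
definition fr_projection ::
  "('a::euclidean_space) set \<Rightarrow> ('a \<Rightarrow> real) \<Rightarrow> ('a \<Rightarrow> real) set \<Rightarrow> ('a \<Rightarrow> real) \<Rightarrow> 'a \<Rightarrow> real"
where
  "fr_projection \<Omega> \<sigma> V p =
     (THE q. q \<in> V \<and> (\<forall>v\<in>V. fr_inner \<Omega> \<sigma> (\<lambda>x. p x - q x) v = 0))"

end

(*
  The derivative of the divergence is the integral of the time derivative of its integrand
  f = rho ln (rho/rhoh) - rho + rhoh. By the transport equation, which holds pointwise almost everywhere,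
  this time derivative equals  res - (rho/rhoh) res - div (f u)  with the residual
  res = d/dt rhoh + div (rhoh u). The field f u vanishes on the boundary, so its divergence integrates to 0,
  and the Galerkin equations make res orthogonal to V, in particular to rhoh, so that the integral of res
  is 0. What remains is - <res, rho> = - <res, rho - sigma> for every sigma in V: the infimum is over a
  constant, and the bound is the Cauchy-Schwarz inequality at the orthogonal projection.

  The densities are only Lipschitz in space. One-dimensional Lipschitz functions are differentiable
  almost everywhere by Vitali's covering theorem, Fubini's theorem carries this over to partial
  derivatives, and integration by parts reduces to the translation invariance of the integral.
*)
theory Submission
  imports Defs "HOL-Real_Asymp.Real_Asymp"
begin

section \<open>Almost everywhere differentiability along lines\<close>

text \<open>The natural test function \<open>ln (\<rho> / \<rho>h)\<close> is neither smooth nor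
  compactly supported, so the weak equation cannot be tested with it. This forces the detour through
  a pointwise equation, which a fundamental lemma with explicit bumps extracts. The second obstacle
  is that the field \<open>f u\<close> is not controlled near the boundary or at infinity:
  \<open>f\<close> is merely locally Lipschitz and integrable. Integrability of its divergence is
  read off the pointwise identity, whose other terms are integrable by time regularity and the
  finite Fisher-Rao norms. Cutting off \<open>f u\<close> is then harmless, because a Lipschitz
  field that vanishes on the boundary is bounded by a multiple of the distance to it. The identity
  leaves no term with derivatives of \<open>u\<close> because \<open>f\<close> is homogeneous of
  degree one in the pair of densities.\<close>

lemma Vitali_cover_in_open:
  fixes E U :: "'a::euclidean_space set"
  assumes "open U" "E \<subseteq> U"
    and fine: "\<And>x d. x \<in> E \<Longrightarrow> 0 < d \<Longrightarrow> \<exists>c r. 0 < r \<and> r < d \<and> x \<in> cball c r \<and> P c r"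
  obtains C where "countable C"
    "\<And>c r. (c, r) \<in> C \<Longrightarrow> 0 < r \<and> cball c r \<subseteq> U \<and> P c r"
    "disjoint_family_on (\<lambda>(c, r). cball c r) C"
    "negligible (E - (\<Union>(c, r)\<in>C. ball c r))"
proof -
  define K where "K = {i. 0 < snd i \<and> cball (fst i) (snd i) \<subseteq> U \<and> P (fst i) (snd i)}"
  have pos: "\<And>i. i \<in> K \<Longrightarrow> 0 < snd i" by (auto simp: K_def)
  have "\<exists>i. i \<in> K \<and> x \<in> cball (fst i) (snd i) \<and> snd i < d" if x: "x \<in> E" and d: "0 < d" for x d
  proof -
    obtain e where e: "e > 0" "ball x e \<subseteq> U" using x assms(1,2) open_contains_ball by blast
    then obtain c r where cr: "0 < r" "r < min d (e/2)" "x \<in> cball c r" "P c r"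
      using fine[OF x, of "min d (e/2)"] d by auto
    have "cball c r \<subseteq> ball x e"
    proof
      fix y assume y: "y \<in> cball c r"
      have "dist x y \<le> dist c x + dist c y" by (metis dist_commute dist_triangle)
      then show "y \<in> ball x e" using y cr by auto
    qed
    then show ?thesis using cr e by (intro exI[of _ "(c, r)"]) (auto simp: K_def)
  qed
  then obtain C where C: "countable C" "C \<subseteq> K"
     "pairwise (\<lambda>i j. disjnt (cball (fst i) (snd i)) (cball (fst j) (snd j))) C"
     "negligible(E - (\<Union>i \<in> C. cball (fst i) (snd i)))"
    using pos by (rule_tac Vitali_covering_theorem_cballs[of K snd E fst]) auto
  \<comment> \<open>The spheres are dropped as a null set so that the open balls cover as well:
    their union is open, and a second cover can be sought inside it.\<close>
  have "E - (\<Union>(c, r)\<in>C. ball c r) \<subseteq>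
      (E - (\<Union>i \<in> C. cball (fst i) (snd i))) \<union> (\<Union>i\<in>C. sphere (fst i) (snd i))"
    by (force simp: sphere_def)
  moreover have "negligible (\<Union>i\<in>C. sphere (fst i) (snd i))"
    using C(1) by (intro negligible_countable_Union) (auto simp: negligible_sphere)
  ultimately have "negligible (E - (\<Union>(c, r)\<in>C. ball c r))"
    using C(4) negligible_Un negligible_subset by blast
  moreover have "disjoint_family_on (\<lambda>(c, r). cball c r) C"
    using C(3) by (simp add: disjoint_family_on_def pairwise_def disjnt_def case_prod_beta)
  ultimately show thesis using that C(1,2) by (force simp: K_def)
qed

text \<open>In terms of the lower derivate of \<open>F\<close> in direction \<open>b\<close> (the
  lower limit of the quotients), this set lies between the set where it is below \<open>p\<close>
  and the set where it is at most \<open>p\<close>. The form with frequent steps avoids limits in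
  the extended reals.\<close>

definition quotient_below :: "('a::real_normed_vector \<Rightarrow> real) \<Rightarrow> 'a \<Rightarrow> real \<Rightarrow> 'a set" where
  "quotient_below F b p = {x. \<exists>\<^sub>F h in at 0. (F (x + h *\<^sub>R b) - F x) / h < p}"

text \<open>Negating \<open>F\<close> expresses quotients frequently above \<open>q\<close> by the
  same operator. Where the quotients are bounded, missing differentiability means lying in such a
  gap for some rationals \<open>p < q\<close>.\<close>

definition quotient_gap :: "('a::real_normed_vector \<Rightarrow> real) \<Rightarrow> 'a \<Rightarrow> real \<Rightarrow> real \<Rightarrow> 'a set" where
  "quotient_gap F b p q = quotient_below F b p \<inter> quotient_below (\<lambda>x. - F x) b (- q)"

lemma quotient_belowE:
  assumes "x \<in> quotient_below F b p" "0 < d"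
  obtains h where "h \<noteq> 0" "\<bar>h\<bar> < d" "(F (x + h *\<^sub>R b) - F x) / h < p"
  using assms by (force simp: quotient_below_def frequently_at)

text \<open>For a fixed step \<open>h\<close> the condition is open in \<open>x\<close>, so the
  uncountable union over \<open>h\<close> is harmless and the set is a countable intersection of
  open sets.\<close>

lemma borel_quotient_below:
  fixes F :: "'a::euclidean_space \<Rightarrow> real"
  assumes "continuous_on UNIV F"
  shows "quotient_below F b p \<in> sets borel"
proof -
  have "quotient_below F b p =
      (\<Inter>n::nat. \<Union>h\<in>{h. h \<noteq> 0 \<and> \<bar>h\<bar> < 1 / Suc n}. {x. (F (x + h *\<^sub>R b) - F x) / h < p})"
    (is "?L = ?R")
  proof
    show "?L \<subseteq> ?R"
    proof
      fix x assume "x \<in> ?L"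
      then have "\<exists>h. h \<noteq> 0 \<and> \<bar>h\<bar> < 1 / Suc n \<and> (F (x + h *\<^sub>R b) - F x) / h < p" for n
        by (elim quotient_belowE[of x F b p "1 / Suc n"]) auto
      then show "x \<in> ?R" by auto
    qed
    show "?R \<subseteq> ?L"
    proof
      fix x assume x: "x \<in> ?R"
      have "\<exists>h. h \<noteq> 0 \<and> \<bar>h\<bar> < d \<and> (F (x + h *\<^sub>R b) - F x) / h < p" if d: "d > 0" for d
      proof -
        obtain n where n: "1 / Suc n < d" using d nat_approx_posE by blast
        from x obtain h where "h \<noteq> 0" "\<bar>h\<bar> < 1 / Suc n" "(F (x + h *\<^sub>R b) - F x) / h < p" by blast
        then show ?thesis using n by (intro exI[of _ h]) linarith
      qed
      then show "x \<in> ?L"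
        by (fastforce simp: quotient_below_def frequently_at dist_real_def)
    qed
  qed
  moreover have "open {x. (F (x + h *\<^sub>R b) - F x) / h < p}" if "h \<noteq> 0" for h
    using that by (intro open_Collect_less continuous_intros continuous_on_compose2[OF assms]) auto
  then have "(\<Inter>n::nat. \<Union>h\<in>{h. h \<noteq> 0 \<and> \<bar>h\<bar> < 1 / Suc n}. {x. (F (x + h *\<^sub>R b) - F x) / h < p}) \<in> sets borel"
    by (intro sets.countable_INT'' borel_open open_UN) auto
  ultimately show ?thesis by simp

qed

lemma borel_quotient_gap:
  fixes F :: "'a::euclidean_space \<Rightarrow> real"
  assumes "continuous_on UNIV F"
  shows "quotient_gap F b p q \<in> sets borel"
  unfolding quotient_gap_def using assms by (intro sets.Int borel_quotient_below continuous_intros)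

text \<open>Steps of either sign become balls: the segment between \<open>x\<close> and
  \<open>x + h\<close> is centred at its midpoint and has \<open>x\<close> as an end point.\<close>

lemma quotient_interval:
  fixes f :: "real \<Rightarrow> real"
  assumes "h \<noteq> 0"
  shows "x \<in> cball (x + h/2) (\<bar>h\<bar>/2)"
    "(f (x + h/2 + \<bar>h\<bar>/2) - f (x + h/2 - \<bar>h\<bar>/2)) = (f (x + h) - f x) / h * \<bar>h\<bar>"
proof -
  have "x + h/2 + \<bar>h\<bar>/2 = (if 0 < h then x + h else x)" "x + h/2 - \<bar>h\<bar>/2 = (if 0 < h then x else x + h)"
    by auto
  then show "(f (x + h/2 + \<bar>h\<bar>/2) - f (x + h/2 - \<bar>h\<bar>/2)) = (f (x + h) - f x) / h * \<bar>h\<bar>"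
    using assms by (auto simp: abs_if)
qed (auto simp: dist_real_def)

text \<open>
  Cover the gap set by intervals of slope less than \<open>p\<close> and, inside them, by intervals of slope
  greater than \<open>q\<close>: the increments of \<open>f\<close> over the two covers are incompatible.
\<close>
lemma monotone_quotient_gap_null:
  fixes f :: "real \<Rightarrow> real"
  assumes mono: "\<And>x y. x \<le> y \<Longrightarrow> f x \<le> f y" and cont: "continuous_on UNIV f"
    and pq: "0 < p" "p < q"
  shows "quotient_gap f 1 p q \<in> null_sets lborel"
proof -
  let ?G = "quotient_gap f 1 p q"
  \<comment> \<open>The Stieltjes measure of \<open>f\<close>: by continuity it gives closed
    intervals the increment of \<open>f\<close>, so increments over a disjoint cover add up.\<close>
  define M where "M = interval_measure f"
  have [simp, measurable_cong]: "sets M = sets borel" by (simp add: M_def)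
  have M_cball: "emeasure M (cball c r) = ennreal (f (c + r) - f (c - r))" if "0 < r" for c r
    unfolding M_def cball_eq_atLeastAtMost
    using that by (intro emeasure_interval_measure_Icc mono cont) auto
  have L_cball: "emeasure lborel (cball c r) = ennreal (2 * r)" if "0 < r" for c r :: real
    using that by (simp add: cball_eq_atLeastAtMost)
  have part: "emeasure lborel (?G \<inter> {- real N..real N}) = 0" for N
  proof -
    \<comment> \<open>Cutting down to a bounded interval makes the measure finite, as the final
      comparison of real numbers requires.\<close>
    define E where "E = ?G \<inter> {- real N..real N}"
    have E: "E \<in> sets borel" using borel_quotient_gap[OF cont] by (auto simp: E_def)
    have "emeasure lborel E \<le> emeasure lborel {- real N..real N}"
      by (intro emeasure_mono) (auto simp: E_def)
    then have fin: "emeasure lborel E < \<infinity>"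
      by (simp add: ennreal_less_top order_le_less_trans)
    define m where "m = measure lborel E"
    have m: "emeasure lborel E = ennreal m" "m \<ge> 0"
      using fin by (auto simp: m_def emeasure_eq_ennreal_measure)
    \<comment> \<open>The chain is: \<open>q * m\<close> \<le> the \<open>M\<close>-measure of the
      steep cover \<open>W'\<close> \<le> that of the flat cover \<open>W\<close> \<le>
      \<open>p\<close> times the length of \<open>U\<close>, and \<open>U\<close> exceeds
      \<open>E\<close> by at most \<open>e\<close>.\<close>
    have step: "q * m \<le> p * (m + e)" if e: "e > 0" for e :: real
    proof -
      have "E \<in> sets lebesgue" using sets_completionI_sets[of E lborel] E unfolding sets_lborel by blast
      from sets_lebesgue_outer_open[OF this e]
      obtain U where U: "open U" "E \<subseteq> U" "emeasure lebesgue (U - E) < ennreal e" by blast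
      have "\<exists>c r. 0 < r \<and> r < d \<and> x \<in> cball c r \<and> f (c + r) - f (c - r) \<le> p * (2 * r)"
        if x: "x \<in> E" and d: "0 < d" for x d
      proof -
        obtain h where h: "h \<noteq> 0" "\<bar>h\<bar> < d" "(f (x + h) - f x) / h < p"
          using x d by (auto simp: E_def quotient_gap_def elim: quotient_belowE[of x f 1 p d])
        have "(f (x + h) - f x) / h * \<bar>h\<bar> \<le> p * \<bar>h\<bar>" using h by (intro mult_right_mono) auto
        then show ?thesis using h quotient_interval(1)[OF h(1), of x] quotient_interval(2)[OF h(1), where f = f and x = x]
          by (intro exI[of _ "x + h/2"] exI[of _ "\<bar>h\<bar>/2"]) auto
      qed
      from Vitali_cover_in_open[of U E "\<lambda>c r. f (c + r) - f (c - r) \<le> p * (2 * r)", OF U(1,2) this]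
      obtain C where C: "countable C"
        "\<And>c r. (c, r) \<in> C \<Longrightarrow> 0 < r \<and> cball c r \<subseteq> U \<and> f (c + r) - f (c - r) \<le> p * (2 * r)"
        "disjoint_family_on (\<lambda>(c, r). cball c r) C"
        "negligible (E - (\<Union>(c, r)\<in>C. ball c r))" by metis
      define U' where "U' = (\<Union>(c, r)\<in>C. ball c r)"
      have U': "open U'" by (auto simp: U'_def)
      \<comment> \<open>The steep intervals are placed inside the open balls of the first cover,
        which miss only a null part of \<open>E\<close>; this nests \<open>W'\<close> in
        \<open>W\<close>.\<close>
      have "\<exists>c r. 0 < r \<and> r < d \<and> x \<in> cball c r \<and> q * (2 * r) \<le> f (c + r) - f (c - r)"
        if x: "x \<in> E \<inter> U'" and d: "0 < d" for x d
      proof -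
        obtain h where h: "h \<noteq> 0" "\<bar>h\<bar> < d" "(- f (x + h) - - f x) / h < - q"
          using x d by (auto simp: E_def quotient_gap_def elim: quotient_belowE[of x "\<lambda>x. - f x" 1 "-q" d])
        have "q \<le> (f (x + h) - f x) / h" using h(3) by (simp add: diff_divide_distrib)
        then have "q * \<bar>h\<bar> \<le> (f (x + h) - f x) / h * \<bar>h\<bar>" using h by (intro mult_right_mono) auto
        then show ?thesis using h quotient_interval(1)[OF h(1), of x] quotient_interval(2)[OF h(1), where f = f and x = x]
          by (intro exI[of _ "x + h/2"] exI[of _ "\<bar>h\<bar>/2"]) auto
      qed
      from Vitali_cover_in_open[of U' "E \<inter> U'" "\<lambda>c r. q * (2 * r) \<le> f (c + r) - f (c - r)", OF U' _ this]
      obtain C' where C': "countable C'"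
        "\<And>c r. (c, r) \<in> C' \<Longrightarrow> 0 < r \<and> cball c r \<subseteq> U' \<and> q * (2 * r) \<le> f (c + r) - f (c - r)"
        "disjoint_family_on (\<lambda>(c, r). cball c r) C'"
        "negligible (E \<inter> U' - (\<Union>(c, r)\<in>C'. ball c r))" by (metis inf_le2)
      define W where "W = (\<Union>(c, r)\<in>C. cball c r)"
      define W' where "W' = (\<Union>(c, r)\<in>C'. cball c r)"
      have count: "emeasure N (\<Union>(c, r)\<in>D. cball c r) = (\<integral>\<^sup>+i. emeasure N (case i of (c, r) \<Rightarrow> cball c r) \<partial>count_space D)"
        if "countable D" "disjoint_family_on (\<lambda>(c, r). cball c r) D" "sets N = sets borel"
        for D :: "(real \<times> real) set" and N
        using that by (intro emeasure_UN_countable) (auto split: prod.splits)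
      have [measurable]: "W \<in> sets borel" "W' \<in> sets borel"
        using C(1) C'(1) by (auto simp: W_def W'_def intro!: sets.countable_UN'')
      have "E - W' \<subseteq> (E - U') \<union> (E \<inter> U' - (\<Union>(c, r)\<in>C'. ball c r))"
        using ball_subset_cball by (fastforce simp: W'_def)
      then have "negligible (E - W')" using C(4) C'(4) unfolding U'_def[symmetric]
        using negligible_Un negligible_subset by blast
      then have "emeasure lebesgue (E - W') = 0"
        by (simp add: negligible_iff_null_sets null_setsD1)
      then have EW': "emeasure lborel (E - W') = 0" using E by simp
      have "emeasure lborel E \<le> emeasure lborel (W' \<union> (E - W'))"
        using E by (intro emeasure_mono) auto
      also have "\<dots> \<le> emeasure lborel W' + emeasure lborel (E - W')"
        using E by (intro emeasure_subadditive) auto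
      finally have "emeasure lborel E \<le> emeasure lborel W'" using EW' by simp
      then have "ennreal q * emeasure lborel E \<le> ennreal q * emeasure lborel W'"
        by (intro mult_left_mono) auto
      also have "\<dots> = (\<integral>\<^sup>+i. ennreal q * emeasure lborel (case i of (c, r) \<Rightarrow> cball c r) \<partial>count_space C')"
        unfolding W'_def by (subst count[OF C'(1,3)]) (auto simp: nn_integral_cmult)
      also have "\<dots> \<le> (\<integral>\<^sup>+i. emeasure M (case i of (c, r) \<Rightarrow> cball c r) \<partial>count_space C')"
      proof (intro nn_integral_mono, clarsimp)
        fix c r assume "(c, r) \<in> C'"
        from C'(2)[OF this] show "ennreal q * emeasure lborel (cball c r) \<le> emeasure M (cball c r)"
          using pq by (simp add: M_cball L_cball ennreal_mult[symmetric] ennreal_leI)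
      qed
      also have "\<dots> = emeasure M W'" unfolding W'_def by (subst count[OF C'(1,3)]) auto
      also have "\<dots> \<le> emeasure M W"
      proof (intro emeasure_mono)
        have "W' \<subseteq> U'" using C'(2) by (fastforce simp: W'_def)
        moreover have "U' \<subseteq> W" unfolding U'_def W_def by (intro UN_mono) auto
        ultimately show "W' \<subseteq> W" by simp
      qed auto
      also have "\<dots> = (\<integral>\<^sup>+i. emeasure M (case i of (c, r) \<Rightarrow> cball c r) \<partial>count_space C)"
        unfolding W_def by (subst count[OF C(1,3)]) auto
      also have "\<dots> \<le> (\<integral>\<^sup>+i. ennreal p * emeasure lborel (case i of (c, r) \<Rightarrow> cball c r) \<partial>count_space C)"
      proof (intro nn_integral_mono, clarsimp)
        fix c r assume "(c, r) \<in> C"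
        from C(2)[OF this] show "emeasure M (cball c r) \<le> ennreal p * emeasure lborel (cball c r)"
          using pq by (simp add: M_cball L_cball ennreal_mult[symmetric] ennreal_leI)
      qed
      also have "\<dots> = ennreal p * emeasure lborel W"
        unfolding W_def by (subst count[OF C(1,3)]) (auto simp: nn_integral_cmult)
      also have "emeasure lborel W \<le> emeasure lborel U"
        using C(2) U by (intro emeasure_mono) (fastforce simp: W_def)+
      also have "emeasure lborel U \<le> emeasure lborel (E \<union> (U - E))"
        using E U by (intro emeasure_mono) auto
      also have "emeasure lborel (E \<union> (U - E)) \<le> emeasure lborel E + emeasure lborel (U - E)"
        using E U by (intro emeasure_subadditive) auto
      also have "emeasure lborel (U - E) \<le> ennreal e" using U(1,3) E by simp
      finally have "ennreal q * ennreal m \<le> ennreal p * (ennreal m + ennreal e)"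
        by (simp add: m mult_left_mono)
      then show ?thesis using m pq e
        by (simp add: ennreal_mult[symmetric] ennreal_plus[symmetric] del: ennreal_plus)
    qed
    have "m = 0"
    proof (rule ccontr)
      assume "m \<noteq> 0"
      \<comment> \<open>With this choice of \<open>e\<close>, the product \<open>p * e\<close> is
        half of \<open>(q - p) * m\<close>, which is too small for \<open>step\<close>.\<close>
      then have "0 < (q - p) * m / (2 * p)" using m pq by simp
      moreover have "p * (m + (q - p) * m / (2 * p)) = p * m + (q - p) * m / 2"
        using pq by (simp add: distrib_left)
      ultimately have "q * m \<le> p * m + (q - p) * m / 2" using step by metis
      then have "(q - p) * m \<le> 0" by (simp add: field_simps)
      with \<open>m \<noteq> 0\<close> m pq show False by (simp add: mult_le_0_iff)
    qed
    then show ?thesis using m by (simp add: E_def)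
  qed
  have "?G = (\<Union>N::nat. ?G \<inter> {- real N..real N})"
  proof -
    have "\<exists>N. x \<in> {- real N..real N}" for x
      using real_arch_simple[of "\<bar>x\<bar>"] by (auto simp: abs_le_iff) (metis minus_le_iff)
    then show ?thesis by auto
  qed
  also have "\<dots> \<in> null_sets lborel"
    using part borel_quotient_gap[OF cont] by (intro null_sets_UN) auto
  finally show ?thesis .
qed

text \<open>Adding \<open>(L + 1) * x\<close> makes every quotient at least 1, so the function
  becomes increasing and the thresholds shift by \<open>L + 1\<close>. The monotone case demands a
  positive lower threshold; if the shifted one is not positive, no quotient is below it and the
  shifted gap set is empty.\<close>

lemma quotient_gap_null_real:
  fixes f :: "real \<Rightarrow> real"
  assumes lip: "L-lipschitz_on UNIV f" and "p < q"
  shows "quotient_gap f 1 p q \<in> null_sets lborel"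
proof -
  define g where "g x = f x + (L + 1) * x" for x
  have L: "L \<ge> 0" using lip lipschitz_on_nonneg by blast
  have lip': "\<bar>f x - f y\<bar> \<le> L * \<bar>x - y\<bar>" for x y
    using lipschitz_onD[OF lip, of x y] by (simp add: dist_real_def)
  have cont: "continuous_on UNIV f" using lip lipschitz_on_continuous_on by blast
  have gq: "(g (x + h) - g x) / h = (f (x + h) - f x) / h + (L + 1)" if "h \<noteq> 0" for x h
    using that by (simp add: g_def field_simps)
  have ge1: "1 \<le> (g (x + h) - g x) / h" if "h \<noteq> 0" for x h
  proof -
    have "\<bar>(f (x + h) - f x) / h\<bar> \<le> L" using lip'[of "x + h" x] that by (simp add: field_simps abs_divide)
    then show ?thesis using gq[OF that, of x] by linarith
  qed
  have mono: "g x \<le> g y" if "x \<le> y" for x y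
    using ge1[of "y - x" x] that by (cases "x = y") (auto simp: le_divide_eq)
  have cg: "continuous_on UNIV g" unfolding g_def by (intro continuous_intros cont)
  have sub: "quotient_gap f 1 p q \<subseteq> quotient_gap g 1 (p + (L + 1)) (q + (L + 1))"
  proof -
    have gq': "(- g (x + h) - - g x) / h = (- f (x + h) - - f x) / h - (L + 1)" if "h \<noteq> 0" for x h
      using that by (simp add: g_def field_simps)
    have *: "\<exists>\<^sub>F h in at 0. A h \<Longrightarrow> (\<And>h. h \<noteq> 0 \<Longrightarrow> A h \<Longrightarrow> B h) \<Longrightarrow> \<exists>\<^sub>F h in at 0. B h" for A B :: "real \<Rightarrow> bool"
      by (auto simp: frequently_at)
    show ?thesis
      unfolding quotient_gap_def quotient_below_def
    proof safe
      fix x assume "\<exists>\<^sub>F h in at 0. (f (x + h *\<^sub>R 1) - f x) / h < p"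
      then show "\<exists>\<^sub>F h in at 0. (g (x + h *\<^sub>R 1) - g x) / h < p + (L + 1)"
        by (rule *) (simp add: gq)
    next
      fix x assume "\<exists>\<^sub>F h in at 0. (- f (x + h *\<^sub>R 1) - - f x) / h < - q"
      then show "\<exists>\<^sub>F h in at 0. (- g (x + h *\<^sub>R 1) - - g x) / h < - (q + (L + 1))"
        by (rule *) (use gq' in simp)
    qed
  qed
  show ?thesis
  proof (cases "0 < p + (L + 1)")
    case True
    then show ?thesis
      using monotone_quotient_gap_null[OF mono cg True, of "q + (L + 1)"] \<open>p < q\<close> sub
        borel_quotient_gap[OF cont] by (auto intro: null_sets_subset)
  next
    case False
    have "quotient_gap g 1 (p + (L + 1)) (q + (L + 1)) = {}"
    proof -
      { fix x assume "x \<in> quotient_gap g 1 (p + (L + 1)) (q + (L + 1))"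
        then obtain h where "h \<noteq> 0" "(g (x + h) - g x) / h < p + (L + 1)"
          unfolding quotient_gap_def by (auto elim: quotient_belowE[of x g 1 "p + (L + 1)" 1])
        with ge1[of h x] False have False by linarith }
      then show ?thesis by blast
    qed
    with sub show ?thesis by (metis null_sets.empty_sets subset_empty)
  qed
qed

text \<open>Averaging over the translations by \<open>s *\<^sub>R b\<close>, \<open>0 \<le> s \<le> 1\<close>, and Fubini's theorem.\<close>
lemma null_sets_if_null_on_lines:
  fixes G :: "'a::euclidean_space set"
  assumes [measurable]: "G \<in> sets borel"
    and lines: "\<And>x. {s. x + s *\<^sub>R b \<in> G} \<in> null_sets lborel"
  shows "G \<in> null_sets lborel"
proof -
  let ?g = "\<lambda>x s. indicator G (x + s *\<^sub>R b) * indicator {0..1::real} s :: ennreal"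
  have meas: "(\<lambda>(x, s). ?g x s) \<in> borel_measurable (lborel \<Otimes>\<^sub>M lborel)" by measurable
  have "(\<integral>\<^sup>+x. indicator G (x + s *\<^sub>R b) \<partial>lborel) = emeasure lborel G" for s
  proof -
    have "emeasure lborel G = emeasure (distr lborel borel ((+) (s *\<^sub>R b))) G"
      by (simp add: lborel_distr_plus)
    also have "\<dots> = (\<integral>\<^sup>+x. indicator G x \<partial>distr lborel borel ((+) (s *\<^sub>R b)))" by simp
    also have "\<dots> = (\<integral>\<^sup>+x. indicator G (s *\<^sub>R b + x) \<partial>lborel)"
      by (subst nn_integral_distr) auto
    finally show ?thesis by (simp add: add.commute)
  qed
  then have "emeasure lborel G = (\<integral>\<^sup>+s. emeasure lborel G * indicator {0..1::real} s \<partial>lborel)"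
    by (simp add: nn_integral_cmult)
  also have "\<dots> = (\<integral>\<^sup>+s. (\<integral>\<^sup>+x. ?g x s \<partial>lborel) \<partial>lborel)"
    using \<open>\<And>s. (\<integral>\<^sup>+x. indicator G (x + s *\<^sub>R b) \<partial>lborel) = emeasure lborel G\<close>
    by (subst nn_integral_multc) auto
  also have "\<dots> = (\<integral>\<^sup>+x. (\<integral>\<^sup>+s. ?g x s \<partial>lborel) \<partial>lborel)"
    by (rule lborel_pair.Fubini') (use meas in auto)
  also have "\<dots> = 0"
  proof -
    have "(\<integral>\<^sup>+s. ?g x s \<partial>lborel) = 0" for x
    proof -
      have "AE s in lborel. ?g x s = 0"
        by (rule AE_I'[OF lines[of x]]) (auto simp: indicator_def)
      then show ?thesis by (subst nn_integral_0_iff_AE) auto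
    qed
    then show ?thesis by simp
  qed
  finally show ?thesis by (auto simp: null_sets_def)
qed

text \<open>On each line in direction \<open>b\<close> the gap set is that of a one-dimensional
  function with Lipschitz constant \<open>L * norm b\<close>.\<close>

lemma quotient_gap_null:
  fixes F :: "'a::euclidean_space \<Rightarrow> real"
  assumes lip: "L-lipschitz_on UNIV F" and "p < q"
  shows "quotient_gap F b p q \<in> null_sets lborel"
proof (rule null_sets_if_null_on_lines)
  show "quotient_gap F b p q \<in> sets borel"
    using lip lipschitz_on_continuous_on by (intro borel_quotient_gap) blast
  fix x
  have "(L * norm b)-lipschitz_on UNIV (\<lambda>s::real. F (x + s *\<^sub>R b))"
  proof (rule lipschitz_onI)
    fix s r :: real
    have "dist (x + s *\<^sub>R b) (x + r *\<^sub>R b) = \<bar>s - r\<bar> * norm b"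
      by (simp add: dist_norm scaleR_diff_left[symmetric])
    then show "dist (F (x + s *\<^sub>R b)) (F (x + r *\<^sub>R b)) \<le> L * norm b * dist s r"
      using lipschitz_onD[OF lip, of "x + s *\<^sub>R b" "x + r *\<^sub>R b"] by (simp add: dist_real_def mult_ac)
  qed (use lipschitz_on_nonneg[OF lip] in simp)
  from quotient_gap_null_real[OF this \<open>p < q\<close>]
  show "{s. x + s *\<^sub>R b \<in> quotient_gap F b p q} \<in> null_sets lborel"
    by (simp add: quotient_gap_def quotient_below_def scaleR_add_left add.assoc Collect_conj_eq)
qed

text \<open>The limit is the upper limit \<open>D\<close>, finite by boundedness. If quotients
  recurred at or below some \<open>a < D\<close>, two rationals between \<open>a\<close> and
  \<open>D\<close> would witness a gap. Rational ends keep the number of gaps to be excluded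
  countable.\<close>

lemma convergent_at_if_no_gap:
  fixes Q :: "real \<Rightarrow> real"
  assumes bdd: "\<forall>\<^sub>F h in at 0. \<bar>Q h\<bar> \<le> L"
    and gap: "\<And>p q. p \<in> \<rat> \<Longrightarrow> q \<in> \<rat> \<Longrightarrow> p < q \<Longrightarrow> (\<exists>\<^sub>F h in at 0. Q h < p) \<Longrightarrow> (\<exists>\<^sub>F h in at 0. q < Q h) \<Longrightarrow> False"
  shows "\<exists>D. (Q \<longlongrightarrow> D) (at 0)"
proof -
  define D where "D = Inf {r. \<forall>\<^sub>F h in at 0. Q h \<le> r}"
  let ?S = "{r. \<forall>\<^sub>F h in at 0. Q h \<le> r}"
  have bb: "bdd_below ?S"
  proof (rule bdd_belowI[of _ "- L"])
    fix r assume "r \<in> ?S"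
    then have "\<forall>\<^sub>F h in at 0. Q h \<le> r \<and> \<bar>Q h\<bar> \<le> L" using bdd by (auto intro: eventually_conj)
    from eventually_happens[OF this] show "- L \<le> r" by auto
  qed
  have ne: "?S \<noteq> {}" using bdd by (auto intro!: exI[of _ L] elim: eventually_mono)
  have up: "\<forall>\<^sub>F h in at 0. Q h < a" if a: "D < a" for a
  proof -
    obtain r where "r \<in> ?S" "r < a" using cInf_lessD[OF ne, of a] a unfolding D_def by blast
    then show ?thesis by (auto elim: eventually_mono)
  qed
  have freq: "\<exists>\<^sub>F h in at 0. a < Q h" if "a < D" for a
  proof (rule ccontr)
    assume "\<not> ?thesis"
    then have "a \<in> ?S" by (simp add: not_frequently not_less)
    then show False using that bb cInf_lower unfolding D_def by (meson not_le)
  qed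
  have down: "\<forall>\<^sub>F h in at 0. a < Q h" if "a < D" for a
  proof (rule ccontr)
    assume *: "\<not> ?thesis"
    from Rats_dense_in_real[OF that] obtain p where p: "p \<in> \<rat>" "a < p" "p < D" by blast
    from Rats_dense_in_real[OF p(3)] obtain q where q: "q \<in> \<rat>" "p < q" "q < D" by blast
    have "\<exists>\<^sub>F h in at 0. Q h < p"
      using * p by (auto simp: not_eventually not_less elim!: frequently_elim1)
    then show False using gap[OF p(1) q(1) q(2)] freq[OF q(3)] by blast
  qed
  show ?thesis using up down by (intro exI[of _ D] order_tendstoI)
qed

definition line_differentiable :: "('a::real_normed_vector \<Rightarrow> real) \<Rightarrow> 'a \<Rightarrow> 'a \<Rightarrow> bool" where
  "line_differentiable F b x \<longleftrightarrow> (\<lambda>s. F (x + s *\<^sub>R b)) differentiable at 0"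

definition line_deriv :: "('a::real_normed_vector \<Rightarrow> real) \<Rightarrow> 'a \<Rightarrow> 'a \<Rightarrow> real" where
  "line_deriv F b x = deriv (\<lambda>s. F (x + s *\<^sub>R b)) 0"

text \<open>The gap sets with rational ends are countably many null sets; outside them the
  quotients, bounded by \<open>L * norm b\<close>, converge.\<close>

lemma AE_line_differentiable_lipschitz:
  fixes F :: "'a::euclidean_space \<Rightarrow> real"
  assumes lip: "L-lipschitz_on UNIV F"
  shows "AE x in lborel. line_differentiable F b x"
proof -
  have "AE x in lborel. \<forall>p\<in>\<rat>. \<forall>q\<in>\<rat>. p < q \<longrightarrow> x \<notin> quotient_gap F b p q"
    unfolding AE_ball_countable[OF countable_rat]
    by (intro ballI AE_impI AE_not_in quotient_gap_null[OF lip])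
  then show ?thesis
  proof (rule AE_mp, intro AE_I2 impI)
    fix x assume *: "\<forall>p\<in>\<rat>. \<forall>q\<in>\<rat>. p < q \<longrightarrow> x \<notin> quotient_gap F b p q"
    let ?Q = "\<lambda>h. (F (x + h *\<^sub>R b) - F x) / h"
    have "\<exists>D. (?Q \<longlongrightarrow> D) (at 0)"
    proof (rule convergent_at_if_no_gap)
      have "\<bar>?Q h\<bar> \<le> L * norm b" if "h \<noteq> 0" for h
        using lipschitz_onD[OF lip, of "x + h *\<^sub>R b" x] that
        by (simp add: dist_norm abs_divide field_simps)
      then show "\<forall>\<^sub>F h in at 0. \<bar>?Q h\<bar> \<le> L * norm b" by (auto simp: eventually_at_filter)
    next
      fix p q :: real assume "p \<in> \<rat>" "q \<in> \<rat>" "p < q" and f: "\<exists>\<^sub>F h in at 0. ?Q h < p" "\<exists>\<^sub>F h in at 0. q < ?Q h"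
      then have "x \<notin> quotient_gap F b p q" using * by blast
      moreover have "(- F (x + h *\<^sub>R b) - - F x) / h = - ?Q h" for h by (simp add: diff_divide_distrib)
      ultimately show False using f by (simp add: quotient_gap_def quotient_below_def)
    qed
    then obtain D where "(?Q \<longlongrightarrow> D) (at 0)" by blast
    then have "((\<lambda>s. F (x + s *\<^sub>R b)) has_field_derivative D) (at 0)"
      by (simp add: DERIV_def)
    then show "line_differentiable F b x"
      unfolding line_differentiable_def real_differentiable_def by blast
  qed
qed


section \<open>Locally Lipschitz functions on open sets\<close>

definition locally_lipschitz :: "'a::metric_space set \<Rightarrow> ('a \<Rightarrow> 'b::metric_space) \<Rightarrow> bool" where
  "locally_lipschitz \<Omega> g \<longleftrightarrow> (\<forall>x\<in>\<Omega>. \<exists>r>0. \<exists>L. cball x r \<subseteq> \<Omega> \<and> L-lipschitz_on (cball x r) g)"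

lemma locally_lipschitzE:
  assumes "locally_lipschitz \<Omega> g" "x \<in> \<Omega>"
  obtains r L where "0 < r" "cball x r \<subseteq> \<Omega>" "L-lipschitz_on (cball x r) g"
  using assms unfolding locally_lipschitz_def by blast

lemma locally_lipschitz_pairE:
  assumes "locally_lipschitz \<Omega> f" "locally_lipschitz \<Omega> g" "x \<in> \<Omega>"
  obtains r L M where "0 < r" "cball x r \<subseteq> \<Omega>" "L-lipschitz_on (cball x r) f" "M-lipschitz_on (cball x r) g"
proof -
  obtain r L where 1: "0 < r" "cball x r \<subseteq> \<Omega>" "L-lipschitz_on (cball x r) f"
    using locally_lipschitzE[OF assms(1,3)] .
  obtain s M where 2: "0 < s" "cball x s \<subseteq> \<Omega>" "M-lipschitz_on (cball x s) g"
    using locally_lipschitzE[OF assms(2,3)] .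
  show thesis
  proof
    show "0 < min r s" "cball x (min r s) \<subseteq> \<Omega>" using 1 2 by auto
    show "L-lipschitz_on (cball x (min r s)) f" by (rule lipschitz_on_subset[OF 1(3)]) auto
    show "M-lipschitz_on (cball x (min r s)) g" by (rule lipschitz_on_subset[OF 2(3)]) auto
  qed
qed

lemma locally_lipschitz_subset:
  assumes "locally_lipschitz \<Omega> g" "open U" "U \<subseteq> \<Omega>"
  shows "locally_lipschitz U g"
  unfolding locally_lipschitz_def
proof
  fix x assume x: "x \<in> U"
  obtain r L where 1: "0 < r" "cball x r \<subseteq> \<Omega>" "L-lipschitz_on (cball x r) g"
    using locally_lipschitzE[OF assms(1)] x assms(3) by blast
  obtain e where e: "0 < e" "cball x e \<subseteq> U" using assms(2) x open_contains_cball by blast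
  have "L-lipschitz_on (cball x (min r e)) g" by (rule lipschitz_on_subset[OF 1(3)]) auto
  then show "\<exists>r>0. \<exists>L. cball x r \<subseteq> U \<and> L-lipschitz_on (cball x r) g"
    using 1 e by (intro exI[of _ "min r e"]) auto
qed

lemma lipschitz_on_imp_locally_lipschitz:
  assumes "L-lipschitz_on X g" "open \<Omega>" "\<Omega> \<subseteq> X"
  shows "locally_lipschitz \<Omega> g"
  unfolding locally_lipschitz_def
proof
  fix x assume "x \<in> \<Omega>"
  then obtain e where e: "0 < e" "cball x e \<subseteq> \<Omega>" using assms(2) open_contains_cball by blast
  have "L-lipschitz_on (cball x e) g" by (rule lipschitz_on_subset[OF assms(1)]) (use e assms(3) in auto)
  then show "\<exists>r>0. \<exists>L. cball x r \<subseteq> \<Omega> \<and> L-lipschitz_on (cball x r) g" using e by blast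
qed

lemma locally_lipschitz_continuous_on:
  assumes "locally_lipschitz \<Omega> g"
  shows "continuous_on \<Omega> g"
proof (rule continuous_at_imp_continuous_on, rule ballI)
  fix x assume "x \<in> \<Omega>"
  then obtain r L where 1: "0 < r" "L-lipschitz_on (cball x r) g"
    using locally_lipschitzE[OF assms] by metis
  then have "continuous_on (ball x r) g"
    using lipschitz_on_continuous_on continuous_on_subset ball_subset_cball by blast
  then show "isCont g x" using 1 by (simp add: continuous_on_eq_continuous_at)
qed

lemma locally_lipschitz_cong:
  assumes "locally_lipschitz \<Omega> f" "\<And>x. x \<in> \<Omega> \<Longrightarrow> f x = g x"
  shows "locally_lipschitz \<Omega> g"
  unfolding locally_lipschitz_def
proof
  fix x assume "x \<in> \<Omega>"
  then obtain r L where 1: "0 < r" "cball x r \<subseteq> \<Omega>" "L-lipschitz_on (cball x r) f"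
    using locally_lipschitzE[OF assms(1)] by metis
  have "L-lipschitz_on (cball x r) g"
    by (rule lipschitz_on_transform[OF 1(3)]) (use 1(2) assms(2) in auto)
  then show "\<exists>r>0. \<exists>L. cball x r \<subseteq> \<Omega> \<and> L-lipschitz_on (cball x r) g" using 1 by blast
qed

lemma locally_lipschitz_const: "open \<Omega> \<Longrightarrow> locally_lipschitz \<Omega> (\<lambda>x. c)"
  using lipschitz_on_imp_locally_lipschitz[OF lipschitz_on_constant[of UNIV c]] by auto

lemma locally_lipschitz_add:
  fixes f g :: "'a::metric_space \<Rightarrow> 'b::real_normed_vector"
  assumes "locally_lipschitz \<Omega> f" "locally_lipschitz \<Omega> g"
  shows "locally_lipschitz \<Omega> (\<lambda>x. f x + g x)"
  unfolding locally_lipschitz_def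
proof
  fix x assume "x \<in> \<Omega>"
  then obtain r L M where "0 < r" "cball x r \<subseteq> \<Omega>" "L-lipschitz_on (cball x r) f" "M-lipschitz_on (cball x r) g"
    using locally_lipschitz_pairE[OF assms] by metis
  then show "\<exists>r>0. \<exists>L. cball x r \<subseteq> \<Omega> \<and> L-lipschitz_on (cball x r) (\<lambda>x. f x + g x)"
    using lipschitz_on_add by blast
qed

lemma locally_lipschitz_mult:
  fixes f g :: "'a::metric_space \<Rightarrow> real"
  assumes "locally_lipschitz \<Omega> f" "locally_lipschitz \<Omega> g"
  shows "locally_lipschitz \<Omega> (\<lambda>x. f x * g x)"
  unfolding locally_lipschitz_def
proof
  fix x assume "x \<in> \<Omega>"
  then obtain r L M where 1: "0 < r" "cball x r \<subseteq> \<Omega>" "L-lipschitz_on (cball x r) f" "M-lipschitz_on (cball x r) g"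
    using locally_lipschitz_pairE[OF assms] by metis
  have L: "L \<ge> 0" "M \<ge> 0" using 1 lipschitz_on_nonneg by auto
  \<comment> \<open>The value at the centre plus the largest possible change over the radius bounds
    each factor; the product rule multiplies these bounds with the Lipschitz constants.\<close>
  define A where "A = \<bar>f x\<bar> + L * r"
  define B where "B = \<bar>g x\<bar> + M * r"
  have A: "\<bar>f y\<bar> \<le> A" if "y \<in> cball x r" for y
  proof -
    have "\<bar>f y - f x\<bar> \<le> L * dist y x" using lipschitz_onD[OF 1(3) that, of x] 1(1) by (simp add: dist_real_def)
    also have "\<dots> \<le> L * r" using that L by (intro mult_left_mono) (auto simp: dist_commute)
    finally show ?thesis unfolding A_def by linarith
  qed
  have B: "\<bar>g y\<bar> \<le> B" if "y \<in> cball x r" for y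
  proof -
    have "\<bar>g y - g x\<bar> \<le> M * dist y x" using lipschitz_onD[OF 1(4) that, of x] 1(1) by (simp add: dist_real_def)
    also have "\<dots> \<le> M * r" using that L by (intro mult_left_mono) (auto simp: dist_commute)
    finally show ?thesis unfolding B_def by linarith
  qed
  have nn: "A \<ge> 0" "B \<ge> 0" using L 1(1) by (auto simp: A_def B_def)
  have "(A * M + L * B)-lipschitz_on (cball x r) (\<lambda>x. f x * g x)"
  proof (rule lipschitz_onI)
    fix y z assume yz: "y \<in> cball x r" "z \<in> cball x r"
    have "f y * g y - f z * g z = f y * (g y - g z) + (f y - f z) * g z" by (simp add: algebra_simps)
    then have "\<bar>f y * g y - f z * g z\<bar> \<le> \<bar>f y\<bar> * \<bar>g y - g z\<bar> + \<bar>f y - f z\<bar> * \<bar>g z\<bar>"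
      by (metis abs_mult abs_triangle_ineq)
    also have "\<dots> \<le> A * (M * dist y z) + (L * dist y z) * B"
      using lipschitz_onD[OF 1(3) yz] lipschitz_onD[OF 1(4) yz] A[OF yz(1)] B[OF yz(2)] L nn
      by (intro add_mono mult_mono) (auto simp: dist_real_def)
    finally show "dist (f y * g y) (f z * g z) \<le> (A * M + L * B) * dist y z"
      by (simp add: dist_real_def algebra_simps)
  qed (use L nn in auto)
  then show "\<exists>r>0. \<exists>L. cball x r \<subseteq> \<Omega> \<and> L-lipschitz_on (cball x r) (\<lambda>x. f x * g x)" using 1 by blast
qed

lemma locally_lipschitz_diff:
  fixes f g :: "'a::metric_space \<Rightarrow> real"
  assumes "open \<Omega>" "locally_lipschitz \<Omega> f" "locally_lipschitz \<Omega> g"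
  shows "locally_lipschitz \<Omega> (\<lambda>x. f x - g x)"
  using locally_lipschitz_add[OF assms(2) locally_lipschitz_mult[OF locally_lipschitz_const[OF assms(1), of "-1"] assms(3)]]
  by simp

lemma locally_lipschitz_ln:
  fixes f :: "'a::metric_space \<Rightarrow> real"
  assumes f: "locally_lipschitz \<Omega> f" and pos: "\<And>x. x \<in> \<Omega> \<Longrightarrow> 0 < f x"
  shows "locally_lipschitz \<Omega> (\<lambda>x. ln (f x))"
  unfolding locally_lipschitz_def
proof
  fix x assume x: "x \<in> \<Omega>"
  then obtain r L where 1: "0 < r" "cball x r \<subseteq> \<Omega>" "L-lipschitz_on (cball x r) f"
    using locally_lipschitzE[OF f] by metis
  have L: "L \<ge> 0" using 1 lipschitz_on_nonneg by auto
  \<comment> \<open>Within this radius \<open>f\<close> stays above half of \<open>f x\<close>, and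
    on that range \<open>ln\<close> has Lipschitz constant \<open>2 / f x\<close>. The denominator
    uses \<open>L + 1\<close> because \<open>L\<close> may be 0.\<close>
  define s where "s = min r (f x / (2 * (L + 1)))"
  have s: "0 < s" "s \<le> r" using 1 L pos[OF x] by (auto simp: s_def)
  have lb: "f x / 2 \<le> f y" if "y \<in> cball x s" for y
  proof -
    have "\<bar>f x - f y\<bar> \<le> L * dist x y" using lipschitz_onD[OF 1(3), of x y] that s 1(1) by (simp add: dist_real_def)
    also have "\<dots> \<le> L * (f x / (2 * (L + 1)))" using that L by (intro mult_left_mono) (auto simp: s_def)
    also have "\<dots> \<le> f x / 2" using L pos[OF x] by (simp add: field_simps)
    finally show ?thesis by linarith
  qed
  have half: "ln b - ln a \<le> 2 / f x * \<bar>b - a\<bar>" if "f x / 2 \<le> a" "f x / 2 \<le> b" for a b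
  proof -
    have ab: "0 < a" "0 < b" using that pos[OF x] by auto
    have "ln b - ln a = ln (b / a)" using ab by (simp add: ln_div)
    also have "\<dots> \<le> b / a - 1" using ab by (intro ln_le_minus_one) auto
    also have "\<dots> = (b - a) / a" using ab by (simp add: field_simps)
    also have "\<dots> \<le> \<bar>b - a\<bar> / (f x / 2)" using ab that pos[OF x] by (intro frac_le) auto
    finally show ?thesis by (simp add: mult.commute)
  qed
  have "(2 / f x * L)-lipschitz_on (cball x s) (\<lambda>x. ln (f x))"
  proof (rule lipschitz_onI)
    fix y z assume yz: "y \<in> cball x s" "z \<in> cball x s"
    have "dist (ln (f y)) (ln (f z)) \<le> 2 / f x * \<bar>f y - f z\<bar>"
      using half[OF lb[OF yz(1)] lb[OF yz(2)]] half[OF lb[OF yz(2)] lb[OF yz(1)]]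
      by (simp add: dist_real_def abs_le_iff abs_minus_commute[of "f z"])
    also have "\<dots> \<le> 2 / f x * (L * dist y z)"
      using lipschitz_onD[OF 1(3), of y z] yz s pos[OF x] by (intro mult_left_mono) (auto simp: dist_real_def)
    finally show "dist (ln (f y)) (ln (f z)) \<le> 2 / f x * L * dist y z" by simp
  qed (use L pos[OF x] in auto)
  then show "\<exists>r>0. \<exists>L. cball x r \<subseteq> \<Omega> \<and> L-lipschitz_on (cball x r) (\<lambda>x. ln (f x))"
    using s 1 by (intro exI[of _ s]) (auto intro: order_trans)
qed

lemma eventually_on_line:
  fixes x b :: "'a::real_normed_vector"
  assumes "open U" "x \<in> U"
  shows "\<forall>\<^sub>F s in nhds (0::real). x + s *\<^sub>R b \<in> U"
proof -
  have "((\<lambda>s. x + s *\<^sub>R b) \<longlongrightarrow> x + 0 *\<^sub>R b) (nhds (0::real))"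
    by (intro tendsto_intros filterlim_ident)
  then show ?thesis using assms by (auto dest: topological_tendstoD)
qed

lemma line_deriv_cong:
  fixes f g :: "'a::real_normed_vector \<Rightarrow> real"
  assumes "open U" "x \<in> U" "\<And>y. y \<in> U \<Longrightarrow> f y = g y"
  shows "line_deriv f b x = line_deriv g b x" "line_differentiable f b x \<longleftrightarrow> line_differentiable g b x"
proof -
  have ev: "\<forall>\<^sub>F s in nhds (0::real). f (x + s *\<^sub>R b) = g (x + s *\<^sub>R b)"
    using eventually_on_line[OF assms(1,2)] by (rule eventually_mono) (rule assms(3))
  then show "line_deriv f b x = line_deriv g b x"
    unfolding line_deriv_def by (rule deriv_cong_ev) simp
  show "line_differentiable f b x \<longleftrightarrow> line_differentiable g b x"
    unfolding line_differentiable_def real_differentiable_def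
    using DERIV_cong_ev[OF refl ev refl] by blast
qed

text \<open>On a small ball \<open>F\<close> agrees with its composition with the nearest-point
  projection onto the ball. The projection is 1-Lipschitz, so the composition is a global function
  with the same constant. Lindelof's theorem reduces the local statements to countably many.\<close>

lemma AE_line_differentiable:
  fixes F :: "'a::euclidean_space \<Rightarrow> real"
  assumes F: "locally_lipschitz \<Omega> F"
  shows "AE x in lebesgue. x \<in> \<Omega> \<longrightarrow> (\<forall>b\<in>Basis. line_differentiable F b x)"
proof -
  let ?B = "{B. open B \<and> B \<subseteq> \<Omega> \<and> (AE x in lebesgue. x \<in> B \<longrightarrow> (\<forall>b\<in>Basis. line_differentiable F b x))}"
  have "\<exists>B\<in>?B. x \<in> B" if x: "x \<in> \<Omega>" for x
  proof -
    obtain r L where 1: "0 < r" "cball x r \<subseteq> \<Omega>" "L-lipschitz_on (cball x r) F"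
      using locally_lipschitzE[OF F x] .
    let ?p = "closest_point (cball x r)"
    have ne: "cball x r \<noteq> {}" using 1(1) by auto
    have "L-lipschitz_on UNIV (\<lambda>y. F (?p y))"
    proof (rule lipschitz_onI)
      fix y z
      have "dist (F (?p y)) (F (?p z)) \<le> L * dist (?p y) (?p z)"
        by (intro lipschitz_onD[OF 1(3)] closest_point_in_set ne) auto
      also have "\<dots> \<le> L * dist y z"
        using lipschitz_on_nonneg[OF 1(3)] ne by (intro mult_left_mono closest_point_lipschitz) auto
      finally show "dist (F (?p y)) (F (?p z)) \<le> L * dist y z" .
    qed (use lipschitz_on_nonneg[OF 1(3)] in auto)
    then have "AE x in lborel. \<forall>b\<in>Basis. line_differentiable (\<lambda>y. F (?p y)) b x"
      by (subst AE_ball_countable) (auto intro: countable_finite AE_line_differentiable_lipschitz)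
    then have "AE x in lebesgue. \<forall>b\<in>Basis. line_differentiable (\<lambda>y. F (?p y)) b x"
      by (rule AE_completion)
    moreover have "line_differentiable (\<lambda>y. F (?p y)) b y \<longleftrightarrow> line_differentiable F b y"
      if "y \<in> ball x r" for y b
      by (rule line_deriv_cong(2)[OF open_ball that]) (simp add: closest_point_self)
    ultimately have "AE y in lebesgue. y \<in> ball x r \<longrightarrow> (\<forall>b\<in>Basis. line_differentiable F b y)"
      by (auto elim!: eventually_mono)
    then show ?thesis using 1 by (intro bexI[of _ "ball x r"]) auto
  qed
  then have U: "\<Union>?B = \<Omega>" by blast
  obtain C where C: "C \<subseteq> ?B" "countable C" "\<Union>C = \<Union>?B"
    using Lindelof[of ?B] by auto
  have "AE x in lebesgue. \<forall>B\<in>C. x \<in> B \<longrightarrow> (\<forall>b\<in>Basis. line_differentiable F b x)"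
    using C by (subst AE_ball_countable) auto
  then show ?thesis using C(3) U by (auto elim!: eventually_mono)
qed

section \<open>Integrals of derivatives along lines\<close>

lemma line_differentiable_has_deriv:
  "line_differentiable F b x \<Longrightarrow> ((\<lambda>s. F (x + s *\<^sub>R b)) has_real_derivative line_deriv F b x) (at 0)"
  unfolding line_differentiable_def line_deriv_def
  using DERIV_deriv_iff_real_differentiable by blast

lemma line_derivI:
  "((\<lambda>s. F (x + s *\<^sub>R b)) has_real_derivative D) (at 0) \<Longrightarrow> line_deriv F b x = D"
  unfolding line_deriv_def by (rule DERIV_imp_deriv)

text \<open>A sequence of steps replaces the limit at 0, as both measurability of the derivative and
  dominated convergence require.\<close>

lemma line_quotient_tendsto:
  assumes "line_differentiable F b x"
  shows "(\<lambda>n. real (Suc n) * (F (x + (1 / real (Suc n)) *\<^sub>R b) - F x)) \<longlonglongrightarrow> line_deriv F b x"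
proof -
  have "((\<lambda>h. (F (x + h *\<^sub>R b) - F x) / h) \<longlongrightarrow> line_deriv F b x) (at 0)"
    using line_differentiable_has_deriv[OF assms] by (simp add: DERIV_def)
  moreover have "filterlim (\<lambda>n. 1 / real (Suc n)) (at 0) sequentially"
    unfolding filterlim_at using lim_inverse_n' LIMSEQ_Suc[OF lim_1_over_n] by (auto intro!: always_eventually)
  ultimately have "(\<lambda>n. (F (x + (1 / real (Suc n)) *\<^sub>R b) - F x) / (1 / real (Suc n))) \<longlonglongrightarrow> line_deriv F b x"
    by (rule filterlim_compose)
  then show ?thesis by (simp add: mult.commute)
qed

lemma borel_measurable_lebesgue_AE_limit:
  fixes g :: "'a::euclidean_space \<Rightarrow> real"
  assumes f: "\<And>n. f n \<in> borel_measurable lebesgue"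
    and lim: "AE x in lebesgue. (\<lambda>n. f n x) \<longlonglongrightarrow> g x"
  shows "g \<in> borel_measurable lebesgue"
proof (rule borel_measurable_AE)
  show "(\<lambda>x. lim (\<lambda>n. f n x)) \<in> borel_measurable lebesgue"
    by (intro borel_measurable_lim_metric f)
  show "AE x in lebesgue. lim (\<lambda>n. f n x) = g x"
    using lim by (auto elim!: eventually_mono intro: limI)
qed

text \<open>Each difference quotient integrates to 0 by translation invariance. A single Lipschitz
  constant on a ball around the support dominates the quotients, so the limit may be taken under the
  integral.\<close>

lemma integral_line_deriv_compact_support:
  fixes G :: "'a::euclidean_space \<Rightarrow> real"
  assumes G: "locally_lipschitz UNIV G" and K: "compact K" "\<And>x. x \<notin> K \<Longrightarrow> G x = 0"
    and b: "b \<in> Basis"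
  shows "integrable lebesgue (line_deriv G b)" "(LINT x|lebesgue. line_deriv G b x) = 0"
proof -
  obtain R where R: "\<And>x. x \<in> K \<Longrightarrow> norm x \<le> R" using compact_imp_bounded[OF K(1)] by (auto simp: bounded_iff)
  \<comment> \<open>Steps have length at most 1: outside radius \<open>R + 1\<close> both values in
    a quotient vanish, and inside it both arguments lie in the ball of radius \<open>R + 2\<close>,
    where the constant \<open>L\<close> applies.\<close>
  define X where "X = cball (0::'a) (R + 2)"
  have "local_lipschitz {0::real} X (\<lambda>_. G)"
  proof (rule local_lipschitzI)
    fix x assume "x \<in> X"
    obtain r L where "0 < r" "L-lipschitz_on (cball x r) G" using locally_lipschitzE[OF G] by auto
    then show "\<exists>u>0. \<exists>L. \<forall>t\<in>cball t u \<inter> {0}. L-lipschitz_on (cball x u \<inter> X) G" for t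
      using lipschitz_on_subset[of L "cball x r" G "cball x r \<inter> X"] by auto
  qed
  then obtain L where L: "L-lipschitz_on X G"
    by (rule local_lipschitz_compact_implies_lipschitz) (auto simp: X_def)
  have cont: "continuous_on UNIV G" by (rule locally_lipschitz_continuous_on[OF G])
  have [measurable]: "G \<in> borel_measurable borel" by (rule borel_measurable_continuous_onI[OF cont])
  define q where "q n x = real (Suc n) * (G (x + (1 / real (Suc n)) *\<^sub>R b) - G x)" for n x
  have nb: "norm b = 1" using b by simp
  have bound: "\<bar>q n x\<bar> \<le> L * indicator (cball 0 (R + 1)) x" for n x
  proof -
    let ?y = "x + (1 / real (Suc n)) *\<^sub>R b"
    have d: "dist ?y x = 1 / real (Suc n)" using nb by (simp add: dist_norm)
    have d1: "1 / real (Suc n) \<le> 1" by simp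
    show ?thesis
    proof (cases "norm x \<le> R + 1")
      case True
      have "norm ?y \<le> norm x + 1 / real (Suc n)" using nb by (metis norm_triangle_ineq norm_scaleR mult.right_neutral abs_of_nonneg zero_le_divide_1_iff of_nat_0_le_iff)
      then have "?y \<in> X" "x \<in> X" using True d1 unfolding X_def mem_cball_0 by linarith+
      from lipschitz_onD[OF L this] have "\<bar>G ?y - G x\<bar> \<le> L * (1 / real (Suc n))"
        unfolding d dist_real_def .
      then have "real (Suc n) * \<bar>G ?y - G x\<bar> \<le> L" by (simp add: field_simps)
      then show ?thesis using True unfolding q_def abs_mult by simp
    next
      case False
      have "norm x \<le> norm ?y + 1 / real (Suc n)" using d by (metis dist_commute dist_norm norm_triangle_sub add.commute diff_le_eq norm_triangle_ineq2)
      then have "norm ?y > R" using False d1 by linarith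
      then have "G ?y = 0" "G x = 0" using K(2) R False by (metis not_le, force)
      then show ?thesis using False by (simp add: q_def)
    qed
  qed
  have intG: "integrable lborel G"
  proof -
    have "integrable lborel (\<lambda>x. indicator K x *\<^sub>R G x)"
      using borel_integrable_compact[OF K(1)] cont continuous_on_subset by blast
    moreover have "(\<lambda>x. indicator K x *\<^sub>R G x) = G" using K(2) by (auto simp: fun_eq_iff indicator_def)
    ultimately show ?thesis by simp
  qed
  have shift: "integrable lborel (\<lambda>x. G (x + c)) \<and> (LINT x|lborel. G (x + c)) = (LINT x|lborel. G x)" for c
  proof -
    have "integrable (distr lborel borel ((+) c)) G" using intG by (simp add: lborel_distr_plus)
    then have 1: "integrable lborel (\<lambda>x. G (c + x))" by (subst (asm) integrable_distr_eq) auto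
    have "(LINT x|lborel. G x) = (LINT x|distr lborel borel ((+) c). G x)" by (simp add: lborel_distr_plus)
    also have "\<dots> = (LINT x|lborel. G (c + x))" by (subst integral_distr) auto
    finally show ?thesis using 1 by (simp add: add.commute)
  qed
  have q0: "(LINT x|lebesgue. q n x) = 0" for n
  proof -
    have "(LINT x|lebesgue. q n x) = (LINT x|lborel. q n x)"
      by (intro integral_completion) (simp add: q_def)
    also have "\<dots> = 0" unfolding q_def using shift[of "(1 / real (Suc n)) *\<^sub>R b"] intG by simp
    finally show ?thesis .
  qed
  have qm: "q n \<in> borel_measurable lebesgue" for n
    by (intro measurable_completion) (simp add: q_def[abs_def])
  have lim: "AE x in lebesgue. (\<lambda>n. q n x) \<longlonglongrightarrow> line_deriv G b x"
    using AE_line_differentiable[OF G]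
  proof (rule eventually_mono)
    fix x assume "x \<in> UNIV \<longrightarrow> (\<forall>b\<in>Basis. line_differentiable G b x)"
    then have "line_differentiable G b x" using b by blast
    then show "(\<lambda>n. q n x) \<longlonglongrightarrow> line_deriv G b x" unfolding q_def by (rule line_quotient_tendsto)
  qed
  have w: "integrable lebesgue (\<lambda>x. L * indicator (cball (0::'a) (R + 1)) x)"
    using emeasure_bounded_finite[OF bounded_cball[of "0::'a" "R + 1"]]
    by (intro integrable_mult_right integrable_real_indicator) auto
  have m: "line_deriv G b \<in> borel_measurable lebesgue"
    by (rule borel_measurable_lebesgue_AE_limit[OF qm lim])
  note dc = integral_dominated_convergence[OF m qm w lim] integrable_dominated_convergence[OF m qm w lim]
  show "integrable lebesgue (line_deriv G b)"
    by (rule dc(2)) (use bound in auto)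
  have "(\<lambda>n. LINT x|lebesgue. q n x) \<longlonglongrightarrow> (LINT x|lebesgue. line_deriv G b x)"
    by (rule dc(1)) (use bound in auto)
  then show "(LINT x|lebesgue. line_deriv G b x) = 0" using q0 LIMSEQ_unique[of "\<lambda>_. 0::real"] by auto
qed

text \<open>Off the closed set \<open>K\<close> the function vanishes on a neighbourhood, and
  \<open>\<Omega>\<close> and \<open>- K\<close> together cover the space.\<close>

lemma locally_lipschitz_extend_zero:
  fixes g :: "'a::metric_space \<Rightarrow> real"
  assumes g: "locally_lipschitz \<Omega> g" and K: "closed K" "K \<subseteq> \<Omega>" "\<And>x. x \<notin> K \<Longrightarrow> g x = 0"
  shows "locally_lipschitz UNIV g"
  unfolding locally_lipschitz_def
proof
  fix x
  show "\<exists>r>0. \<exists>L. cball x r \<subseteq> UNIV \<and> L-lipschitz_on (cball x r) g"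
  proof (cases "x \<in> K")
    case True
    then show ?thesis using locally_lipschitzE[OF g, of x] K(2) by (metis subsetD top_greatest)
  next
    case False
    then have "x \<in> - K" "open (- K)" using K(1) by auto
    then obtain e where e: "0 < e" "cball x e \<subseteq> - K" using open_contains_cball by blast
    have "0-lipschitz_on (cball x e) g" using e K(3) by (auto intro!: lipschitz_onI simp: subset_eq)
    then show ?thesis using e by blast
  qed
qed


section \<open>Smooth bump functions and the fundamental lemma\<close>

text \<open>\<open>flat 0\<close> is the classical smooth function that vanishes to infinite order
  at 0; the powers of \<open>s\<close> in the denominator are carried along because differentiation
  produces them.\<close>

definition flat :: "nat \<Rightarrow> real \<Rightarrow> real" where
  "flat n s = (if s \<le> 0 then 0 else exp (- 1 / s) / s ^ n)"

lemma DERIV_flat: "(flat n has_real_derivative (flat (n + 2) s - real n * flat (n + 1) s)) (at s)"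
proof -
  consider "s < 0" | "s = 0" | "s > 0" by linarith
  then show ?thesis
  proof cases
    case 1
    have "\<forall>\<^sub>F x in nhds s. flat n x = 0"
      using 1 eventually_nhds_in_open[of "{..<0}" s] by (auto elim!: eventually_mono simp: flat_def)
    then have "(flat n has_real_derivative 0) (at s)"
      by (subst DERIV_cong_ev[OF refl _ refl, of _ "\<lambda>_. 0"]) auto
    then show ?thesis using 1 by (simp add: flat_def)
  next
    case 2
    have "((\<lambda>h. (flat n (0 + h) - flat n 0) / h) \<longlongrightarrow> 0) (at 0)"
    proof (rule filterlim_split_at)
      have "\<forall>\<^sub>F h in at_left 0. (flat n (0 + h) - flat n 0) / h = 0"
        by (auto simp: eventually_at_filter flat_def)
      then show "((\<lambda>h. (flat n (0 + h) - flat n 0) / h) \<longlongrightarrow> 0) (at_left 0)"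
        by (rule tendsto_eventually)
      \<comment> \<open>With \<open>y = 1 / h\<close> the quotient from the right is
        \<open>y ^ (n + 1) / exp y\<close>, and the exponential wins.\<close>
      have "((\<lambda>h. inverse h ^ (n + 1) / exp (inverse h)) \<longlongrightarrow> (0::real)) (at_right 0)"
        by (rule filterlim_compose[OF tendsto_power_div_exp_0 filterlim_inverse_at_top_right])
      moreover have "\<forall>\<^sub>F h in at_right 0. inverse h ^ (n + 1) / exp (inverse h) = (flat n (0 + h) - flat n 0) / h"
        by (auto simp: eventually_at_filter flat_def field_simps exp_minus)
      ultimately show "((\<lambda>h. (flat n (0 + h) - flat n 0) / h) \<longlongrightarrow> 0) (at_right 0)"
        by (rule Lim_transform_eventually)
    qed
    then show ?thesis using 2 by (simp add: DERIV_def flat_def)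
  next
    case 3
    have ev: "\<forall>\<^sub>F x in nhds s. flat n x = exp (- 1 / x) * inverse (x ^ n)"
      using 3 eventually_nhds_in_open[of "{0<..}" s]
      by (auto elim!: eventually_mono simp: flat_def divide_inverse)
    have "((\<lambda>x. exp (- 1 / x) * inverse (x ^ n)) has_real_derivative
        exp (- 1 / s) * (1 / s^2) * inverse (s ^ n) + exp (- 1 / s) * (- (real n * s ^ (n - 1)) * inverse (s ^ n) ^ 2)) (at s)"
      using 3 by (auto intro!: derivative_eq_intros simp: power2_eq_square field_simps)
    also have "exp (- 1 / s) * (1 / s^2) * inverse (s ^ n) + exp (- 1 / s) * (- (real n * s ^ (n - 1)) * inverse (s ^ n) ^ 2)
        = flat (n + 2) s - real n * flat (n + 1) s"
      using 3 by (cases n) (simp_all add: flat_def field_simps power2_eq_square power_add)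
    finally show ?thesis by (subst DERIV_cong_ev[OF refl ev refl])
  qed
qed

text \<open>A class of functions that contains the bumps below and is closed under differentiation.\<close>
inductive flat_poly :: "('a::euclidean_space \<Rightarrow> real) \<Rightarrow> bool" where
  const: "flat_poly (\<lambda>x. c)"
| flat: "flat_poly (\<lambda>x. flat n (x \<bullet> a + c))"
| add: "flat_poly f \<Longrightarrow> flat_poly g \<Longrightarrow> flat_poly (\<lambda>x. f x + g x)"
| mult: "flat_poly f \<Longrightarrow> flat_poly g \<Longrightarrow> flat_poly (\<lambda>x. f x * g x)"

lemma flat_poly_derivative:
  assumes "flat_poly f"
  shows "\<exists>f'. (\<forall>x. (f has_derivative f' x) (at x)) \<and> (\<forall>v. flat_poly (\<lambda>x. f' x v))"
  using assms
proof induction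
  case (const c)
  then show ?case by (intro exI[of _ "\<lambda>_ _. 0"]) (auto intro: flat_poly.const)
next
  case (flat n a c)
  define f' where "f' x v = (flat (n + 2) (x \<bullet> a + c) + (- real n) * flat (n + 1) (x \<bullet> a + c)) * (v \<bullet> a)" for x v
  have "((\<lambda>x. flat n (x \<bullet> a + c)) has_derivative f' x) (at x)" for x
  proof -
    have "((\<lambda>x. x \<bullet> a + c) has_derivative (\<lambda>v. v \<bullet> a)) (at x)" by (auto intro!: derivative_eq_intros)
    from DERIV_compose_FDERIV[OF DERIV_flat this] show ?thesis by (simp add: f'_def[abs_def] mult.commute)
  qed
  moreover have "flat_poly (\<lambda>x. f' x v)" for v
    unfolding f'_def by (intro flat_poly.intros)
  ultimately show ?case by blast
next
  case (add f g)
  then obtain f' g' where "\<forall>x. (f has_derivative f' x) (at x)" "\<forall>v. flat_poly (\<lambda>x. f' x v)"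
    "\<forall>x. (g has_derivative g' x) (at x)" "\<forall>v. flat_poly (\<lambda>x. g' x v)" by blast
  then show ?case
    by (intro exI[of _ "\<lambda>x v. f' x v + g' x v"]) (auto intro!: flat_poly.intros has_derivative_add)
next
  case (mult f g)
  then obtain f' g' where "\<forall>x. (f has_derivative f' x) (at x)" "\<forall>v. flat_poly (\<lambda>x. f' x v)"
    "\<forall>x. (g has_derivative g' x) (at x)" "\<forall>v. flat_poly (\<lambda>x. g' x v)" by blast
  with mult show ?case
    by (intro exI[of _ "\<lambda>x v. f x * g' x v + f' x v * g x"]) (auto intro!: flat_poly.intros has_derivative_mult)
qed

lemma flat_poly_Ck: "flat_poly f \<Longrightarrow> Ck k f"
proof (induction k arbitrary: f)
  case 0
  obtain f' where "\<forall>x. (f has_derivative f' x) (at x)" using flat_poly_derivative[OF 0] by blast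
  then show ?case
    by (auto intro!: continuous_at_imp_continuous_on has_derivative_continuous)
next
  case (Suc k)
  obtain f' where f': "\<forall>x. (f has_derivative f' x) (at x)" "\<forall>v. flat_poly (\<lambda>x. f' x v)"
    using flat_poly_derivative[OF Suc.prems] by blast
  then have "frechet_derivative f (at x) = f' x" for x using frechet_derivative_at by metis
  then show ?case using f' Suc.IH by (auto simp: differentiable_on_def differentiable_def)
qed

lemma flat_poly_prod:
  "finite I \<Longrightarrow> (\<And>i. i \<in> I \<Longrightarrow> flat_poly (f i)) \<Longrightarrow> flat_poly (\<lambda>x. \<Prod>i\<in>I. f i x)"
  by (induction I rule: finite_induct) (auto intro: flat_poly.intros)

text \<open>For \<open>n > 0\<close> the product is positive exactly on the open box, and each
  factor there has the form \<open>exp (- 1 / (n * s))\<close>, which tends to 1. Thus the bumps are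
  smooth approximations of the indicator of the box.\<close>

definition bump :: "'a \<Rightarrow> 'a \<Rightarrow> nat \<Rightarrow> 'a::euclidean_space \<Rightarrow> real" where
  "bump l r n x = (\<Prod>b\<in>Basis. flat 0 (real n * (x \<bullet> b - l \<bullet> b)) * flat 0 (real n * (r \<bullet> b - x \<bullet> b)))"

lemma bump_eq_0: "x \<notin> box l r \<Longrightarrow> bump l r n x = 0"
  by (auto simp: bump_def box_def flat_def mult_le_0_iff not_less intro!: prod_zero)

lemma bump_bounds: "0 \<le> bump l r n x" "bump l r n x \<le> 1"
proof -
  have flat0: "0 \<le> flat 0 s" "flat 0 s \<le> 1" for s by (auto simp: flat_def)
  show "0 \<le> bump l r n x" unfolding bump_def by (intro prod_nonneg mult_nonneg_nonneg flat0 ballI)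
  show "bump l r n x \<le> 1" unfolding bump_def
    by (intro prod_le_1) (auto intro!: mult_nonneg_nonneg mult_le_one flat0)
qed

lemma bump_tendsto: "(\<lambda>n. bump l r n x) \<longlonglongrightarrow> indicator (box l r) x"
proof (cases "x \<in> box l r")
  case True
  have flat0: "(\<lambda>n. flat 0 (real n * s)) \<longlonglongrightarrow> 1" if "s > 0" for s
  proof -
    have "(\<lambda>n. exp (- 1 / (real n * s))) \<longlonglongrightarrow> 1" using that by real_asymp
    moreover have "\<forall>\<^sub>F n in sequentially. exp (- 1 / (real n * s)) = flat 0 (real n * s)"
      using eventually_gt_at_top[of 0] that by (auto elim!: eventually_mono simp: flat_def mult_le_0_iff)
    ultimately show ?thesis by (rule Lim_transform_eventually)
  qed
  have "(\<lambda>n. bump l r n x) \<longlonglongrightarrow> (\<Prod>b\<in>(Basis::'a set). 1 * 1)"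
    unfolding bump_def using True by (intro tendsto_intros flat0) (auto simp: box_def)
  then show ?thesis using True by simp
qed (simp add: bump_eq_0)

lemma flat_poly_bump: "flat_poly (bump l r n)"
proof -
  have "flat_poly (\<lambda>x. \<Prod>b\<in>Basis. flat 0 (x \<bullet> (real n *\<^sub>R b) + - (real n * (l \<bullet> b)))
      * flat 0 (x \<bullet> (- real n *\<^sub>R b) + real n * (r \<bullet> b)))"
    by (intro flat_poly_prod flat_poly.mult flat_poly.flat) auto
  then show ?thesis by (simp add: bump_def[abs_def] algebra_simps)
qed

text \<open>A Dynkin-system argument on a Borel version \<open>g\<close> of \<open>f\<close>: open
  boxes are stable under intersection and generate the Borel sets. Complements require the integral
  over the whole space to vanish; the bounded support supplies this, since one large box carries the
  whole integral.\<close>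

lemma AE_zero_if_box_integrals_zero:
  fixes f :: "'a::euclidean_space \<Rightarrow> real"
  assumes f: "integrable lebesgue f" and supp: "\<And>x. x \<notin> cbox p q \<Longrightarrow> f x = 0"
    and zero: "\<And>l r. (LINT x:box l r|lebesgue. f x) = 0"
  shows "AE x in lebesgue. f x = 0"
proof -
  obtain g where g: "g \<in> borel_measurable lborel" "AE x in lborel. f x = g x"
    using completion_ex_borel_measurable_real[of f lborel] f by auto
  have AE: "AE x in lebesgue. f x = g x" using g(2) by (rule AE_completion)
  have gm [measurable]: "g \<in> borel_measurable borel" using g(1) by simp
  have fm: "f \<in> borel_measurable lebesgue" using f by auto
  have gm': "g \<in> borel_measurable lebesgue" using g(1) by (rule measurable_completion)
  have "integrable lebesgue g" using integrable_cong_AE[OF fm gm' AE] f by blast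
  then have ig: "integrable lborel g" using integrable_completion[OF g(1)] by blast
  have eq: "(LINT x:A|lborel. g x) = (LINT x:A|lebesgue. f x)" if [measurable]: "A \<in> sets borel" for A
  proof -
    have "(LINT x:A|lborel. g x) = (LINT x|lebesgue. indicator A x *\<^sub>R g x)"
      unfolding set_lebesgue_integral_def by (subst integral_completion) auto
    also have "\<dots> = (LINT x|lebesgue. indicator A x *\<^sub>R f x)"
      using AE that sets_completionI_sets[of A lborel]
      by (intro integral_cong_AE borel_measurable_scaleR borel_measurable_indicator fm gm') auto
    finally show ?thesis by (simp add: set_lebesgue_integral_def)
  qed
  have UNIV: "(LINT x|lborel. g x) = 0"
  proof -
    obtain l r where lr: "cbox p q \<subseteq> box l r" using bounded_subset_box_symmetric[OF bounded_cbox] by metis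
    have "(LINT x:UNIV|lborel. g x) = (LINT x:UNIV|lebesgue. f x)" by (rule eq) simp
    also have "\<dots> = (LINT x:box l r|lebesgue. f x)" unfolding set_lebesgue_integral_def
      using lr supp by (intro Bochner_Integration.integral_cong) (auto simp: indicator_def)
    finally show ?thesis using zero by (simp add: set_lebesgue_integral_def)
  qed
  have all: "(LINT x:A|lborel. g x) = 0" if A: "A \<in> sets borel" for A
  proof -
    have "Int_stable (range (\<lambda>(a, b). box a b :: 'a set))" by (auto simp: Int_stable_def box_Int_box)
    moreover have "(range (\<lambda>(a, b). box a b)) \<subseteq> Pow (UNIV::'a set)" by auto
    moreover have "A \<in> sigma_sets UNIV (range (\<lambda>(a, b). box a b))" using A unfolding borel_eq_box by simp
    ultimately show ?thesis
    proof (induction rule: sigma_sets_induct_disjoint)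
      case (basic A)
      then show ?case using eq zero by auto
    next
      case empty
      show ?case by (simp add: set_lebesgue_integral_def)
    next
      case (compl A)
      then have [measurable]: "A \<in> sets borel" unfolding borel_eq_box by simp
      have "(LINT x:UNIV - A|lborel. g x) = (LINT x|lborel. g x - indicator A x *\<^sub>R g x)"
        unfolding set_lebesgue_integral_def by (intro Bochner_Integration.integral_cong) (auto simp: indicator_def)
      also have "\<dots> = (LINT x|lborel. g x) - (LINT x:A|lborel. g x)"
        unfolding set_lebesgue_integral_def using ig
        by (intro Bochner_Integration.integral_diff integrable_mult_indicator) auto
      finally show ?case using UNIV compl by simp
    next
      case (union A)
      then have [measurable]: "\<And>i. A i \<in> sets borel" unfolding borel_eq_box by (auto simp: subset_eq)
      have "(LINT x:(\<Union>i. A i)|lborel. g x) = (\<Sum>i. LINT x:(A i)|lborel. g x)"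
      proof (rule lebesgue_integral_countable_add)
        show "set_integrable lborel (\<Union>i. A i) g"
          unfolding set_integrable_def using ig by (intro integrable_mult_indicator) auto
      qed (use union(1) in \<open>auto simp: disjoint_family_on_def\<close>)
      then show ?case using union by simp
    qed
  qed
  have "AE x in lborel. g x = 0" using sigma_finite_measure.density_zero[OF sigma_finite_lborel ig] all by simp
  then have "AE x in lebesgue. g x = 0" by (rule AE_completion)
  with AE show ?thesis by eventually_elim simp
qed

text \<open>The bumps lie between 0 and 1 and converge to the indicator of the box, so the absolute
  value of \<open>f\<close> dominates and the integrals over boxes vanish too.\<close>

lemma AE_zero_if_bump_integrals_zero:
  fixes f :: "'a::euclidean_space \<Rightarrow> real"
  assumes f: "integrable lebesgue f" and supp: "\<And>x. x \<notin> cbox p q \<Longrightarrow> f x = 0"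
    and zero: "\<And>l r n. (LINT x|lebesgue. bump l r n x * f x) = 0"
  shows "AE x in lebesgue. f x = 0"
proof (rule AE_zero_if_box_integrals_zero[OF f supp])
  fix l r :: 'a
  have fm: "f \<in> borel_measurable lebesgue" using f by auto
  have bm: "bump l r n \<in> borel_measurable lebesgue" for n
  proof -
    have "continuous_on UNIV (bump l r n)" using flat_poly_Ck[OF flat_poly_bump, of 0 l r n] by simp
    then have "bump l r n \<in> borel_measurable lborel" using borel_measurable_continuous_onI by simp
    then show ?thesis by (rule measurable_completion)
  qed
  have "(\<lambda>n. LINT x|lebesgue. bump l r n x * f x) \<longlonglongrightarrow> (LINT x|lebesgue. indicator (box l r) x * f x)"
  proof (rule integral_dominated_convergence[where w = "\<lambda>x. \<bar>f x\<bar>"])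
    show "AE x in lebesgue. (\<lambda>n. bump l r n x * f x) \<longlonglongrightarrow> indicator (box l r) x * f x"
      by (intro AE_I2 tendsto_intros bump_tendsto)
    show "AE x in lebesgue. norm (bump l r n x * f x) \<le> \<bar>f x\<bar>" for n
      using bump_bounds[of l r n] by (intro AE_I2) (auto simp: abs_mult intro: mult_left_le_one_le)
    show "(\<lambda>x. indicator (box l r) x * f x) \<in> borel_measurable lebesgue"
      using fm by (intro borel_measurable_times borel_measurable_indicator) (auto intro: sets_completionI_sets)
  qed (use f fm bm in auto)
  then have "(LINT x|lebesgue. indicator (box l r) x * f x) = 0"
    using zero LIMSEQ_unique[of "\<lambda>_. 0::real"] by fastforce
  then show "(LINT x:box l r|lebesgue. f x) = 0" by (simp add: set_lebesgue_integral_def)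
qed


section \<open>Derivatives of integrals and integration by parts\<close>

lemma AE_lebesgue_on_iff:
  fixes S :: "'a::euclidean_space set"
  assumes "S \<in> sets lebesgue"
  shows "(AE x in lebesgue_on S. P x) \<longleftrightarrow> (AE x in lebesgue. x \<in> S \<longrightarrow> P x)"
  using assms by (intro AE_restrict_space_iff) auto

lemma open_sets_lebesgue: "open S \<Longrightarrow> S \<in> sets lebesgue"
  for S :: "'a::euclidean_space set"
  using sets_completionI_sets[of S lborel] by simp

lemma borel_measurable_lebesgue_on_AE_limit:
  fixes g :: "'a::euclidean_space \<Rightarrow> real"
  assumes S: "S \<in> sets lebesgue" and f: "\<And>n. f n \<in> borel_measurable (lebesgue_on S)"
    and lim: "AE x in lebesgue_on S. (\<lambda>n. f n x) \<longlonglongrightarrow> g x"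
  shows "g \<in> borel_measurable (lebesgue_on S)"
proof -
  have S': "S \<inter> space lebesgue \<in> sets lebesgue" using S by simp
  have "(\<lambda>x. indicator S x *\<^sub>R g x) \<in> borel_measurable lebesgue"
  proof (rule borel_measurable_lebesgue_AE_limit)
    show "(\<lambda>x. indicator S x *\<^sub>R f n x) \<in> borel_measurable lebesgue" for n
      using f[of n] borel_measurable_restrict_space_iff[OF S'] by blast
    show "AE x in lebesgue. (\<lambda>n. indicator S x *\<^sub>R f n x) \<longlonglongrightarrow> indicator S x *\<^sub>R g x"
      using lim unfolding AE_lebesgue_on_iff[OF S]
      by eventually_elim (auto simp: indicator_def)
  qed
  then show ?thesis using borel_measurable_restrict_space_iff[OF S'] by blast
qed

text \<open>Measurability of \<open>g\<close> is a conclusion: by completeness of the Lebesgue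
  measure, \<open>g\<close> is measurable as an almost everywhere limit of the constant sequence
  \<open>f\<close>. This suits functions defined through \<open>deriv\<close>, whose measurability
  is not evident.\<close>

lemma integral_cong_AE_lebesgue_on:
  fixes f g :: "'a::euclidean_space \<Rightarrow> real"
  assumes S: "S \<in> sets lebesgue" and f: "integrable (lebesgue_on S) f"
    and eq: "AE x in lebesgue_on S. f x = g x"
  shows "integrable (lebesgue_on S) g" "(LINT x|lebesgue_on S. g x) = (LINT x|lebesgue_on S. f x)"
proof -
  have "AE x in lebesgue_on S. (\<lambda>n::nat. f x) \<longlonglongrightarrow> g x" using eq by eventually_elim simp
  from borel_measurable_lebesgue_on_AE_limit[OF S _ this]
  have g: "g \<in> borel_measurable (lebesgue_on S)" using f by blast
  have fm: "f \<in> borel_measurable (lebesgue_on S)" using f by blast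
  show "integrable (lebesgue_on S) g" using integrable_cong_AE[OF fm g eq] f by blast
  show "(LINT x|lebesgue_on S. g x) = (LINT x|lebesgue_on S. f x)"
    using integral_cong_AE[OF fm g eq] by simp
qed

text \<open>Dominated convergence for the difference quotients. Sequences of times are the right
  form, because the domination in \<open>time_regular\<close> holds almost everywhere for each
  \<open>s\<close> separately and only countably many exceptional sets may be joined.\<close>

lemma time_regular_has_derivative_integral:
  fixes \<Omega> :: "'a::euclidean_space set"
  assumes \<Omega>: "open \<Omega>" and T: "open T" "t \<in> T" and f: "time_regular T \<Omega> f"
  shows "integrable (lebesgue_on \<Omega>) (time_deriv f t)"
    "((\<lambda>s. LINT x|lebesgue_on \<Omega>. f s x) has_real_derivative (LINT x|lebesgue_on \<Omega>. time_deriv f t x)) (at t)"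
proof -
  let ?M = "lebesgue_on \<Omega>"
  have int: "integrable ?M (f s)" if "s \<in> T" for s using f that unfolding time_regular_def by blast
  have diff: "AE x in ?M. (\<lambda>s. f s x) differentiable at t" using f T(2) unfolding time_regular_def by blast
  obtain e g where e: "e > 0" and g: "integrable ?M g"
    and bd: "\<And>s. s \<in> T \<inter> ball t e \<Longrightarrow> AE x in ?M. \<bar>f s x - f t x\<bar> \<le> g x * \<bar>s - t\<bar>"
    using f T(2) unfolding time_regular_def by blast
  obtain e' where e': "e' > 0" "ball t e' \<subseteq> T" using T open_contains_ball by blast
  define d where "d = min e e'"
  have d: "d > 0" "ball t d \<subseteq> T" "ball t d \<subseteq> ball t e" using e e' by (auto simp: d_def)
  have key: "integrable ?M (time_deriv f t) \<and>
      (\<lambda>i. ((LINT x|?M. f (X i) x) - (LINT x|?M. f t x)) / (X i - t)) \<longlonglongrightarrow> (LINT x|?M. time_deriv f t x)"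
    if X: "X \<longlonglongrightarrow> t" "\<And>i. X i \<noteq> t" "\<And>i. X i \<in> ball t d" for X :: "nat \<Rightarrow> real"
  proof -
    define Q where "Q i x = (f (X i) x - f t x) / (X i - t)" for i x
    have Qi: "integrable ?M (Q i)" for i
      unfolding Q_def[abs_def] using X(3)[of i] d(2) T(2) by (intro integrable_divide Bochner_Integration.integrable_diff int) auto
    have lim: "AE x in ?M. (\<lambda>i. Q i x) \<longlonglongrightarrow> time_deriv f t x"
      using diff
    proof (rule eventually_mono)
      fix x assume "(\<lambda>s. f s x) differentiable at t"
      then have "((\<lambda>s. f s x) has_real_derivative time_deriv f t x) (at t)"
        using DERIV_deriv_iff_real_differentiable by blast
      then have "((\<lambda>s. (f s x - f t x) / (s - t)) \<longlongrightarrow> time_deriv f t x) (at t)"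
        by (simp add: has_field_derivative_iff)
      moreover have "filterlim X (at t) sequentially" using X by (simp add: filterlim_at)
      ultimately show "(\<lambda>i. Q i x) \<longlonglongrightarrow> time_deriv f t x" unfolding Q_def by (rule filterlim_compose)
    qed
    have bound: "AE x in ?M. norm (Q i x) \<le> g x" for i
    proof -
      have "AE x in ?M. \<bar>f (X i) x - f t x\<bar> \<le> g x * \<bar>X i - t\<bar>"
        using bd[of "X i"] X(3)[of i] d by blast
      then show ?thesis by eventually_elim (use X(2)[of i] in \<open>simp add: Q_def abs_divide field_simps\<close>)
    qed
    have Qm: "Q i \<in> borel_measurable ?M" for i using Qi by blast
    have m: "time_deriv f t \<in> borel_measurable ?M"
      using borel_measurable_lebesgue_on_AE_limit[OF open_sets_lebesgue[OF \<Omega>] Qm lim] .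
    have "(\<lambda>i. LINT x|?M. Q i x) \<longlonglongrightarrow> (LINT x|?M. time_deriv f t x)"
      by (rule integral_dominated_convergence[OF m Qm g lim bound])
    moreover have "(LINT x|?M. Q i x) = ((LINT x|?M. f (X i) x) - (LINT x|?M. f t x)) / (X i - t)" for i
      unfolding Q_def using int[of "X i"] int[OF T(2)] X(3)[of i] d(2) by (simp add: subset_eq)
    ultimately show ?thesis using integrable_dominated_convergence[OF m Qm g lim bound] by simp
  qed
  \<comment> \<open>One concrete sequence in the ball, which serves to extract integrability from
    \<open>key\<close>.\<close>
  have "(\<lambda>i. t + (d/2) * inverse (real (Suc i))) \<longlonglongrightarrow> t + (d/2) * 0"
    by (intro tendsto_intros LIMSEQ_inverse_real_of_nat)
  moreover have "t + (d/2) * inverse (real (Suc i)) \<in> ball t d" for i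
  proof -
    have "(d/2) * inverse (real (Suc i)) \<le> d/2 * 1" using d(1) by (intro mult_left_mono) (auto simp: field_simps)
    then show ?thesis using d(1) by (simp add: dist_real_def)
  qed
  ultimately show "integrable ?M (time_deriv f t)"
    using key[of "\<lambda>i. t + (d/2) * inverse (real (Suc i))"] d(1) by simp
  show "((\<lambda>s. LINT x|?M. f s x) has_real_derivative (LINT x|?M. time_deriv f t x)) (at t)"
    unfolding has_field_derivative_iff tendsto_at_iff_sequentially
  proof (intro allI impI)
    fix X assume X: "\<forall>i. X i \<in> UNIV - {t}" "X \<longlonglongrightarrow> t"
    have "\<forall>\<^sub>F i in sequentially. X i \<in> ball t d"
      using X(2) d(1) by (auto dest: tendstoD simp: dist_commute)
    then obtain N where N: "\<And>i. i \<ge> N \<Longrightarrow> X i \<in> ball t d" by (auto simp: eventually_sequentially)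
    have "(\<lambda>i. ((LINT x|?M. f (X (i + N)) x) - (LINT x|?M. f t x)) / (X (i + N) - t)) \<longlonglongrightarrow> (LINT x|?M. time_deriv f t x)"
      using key[of "\<lambda>i. X (i + N)"] X N LIMSEQ_ignore_initial_segment[OF X(2), of N] by auto
    then show "((\<lambda>s. ((LINT x|?M. f s x) - (LINT x|?M. f t x)) / (s - t)) \<circ> X) \<longlonglongrightarrow> (LINT x|?M. time_deriv f t x)"
      unfolding o_def by (rule LIMSEQ_offset)
  qed
qed

lemma time_regular_bounded_mult:
  assumes f: "time_regular T \<Omega> f" and m: "\<psi> \<in> borel_measurable (lebesgue_on \<Omega>)"
    and bd: "\<And>x. \<bar>\<psi> x\<bar> \<le> B"
  shows "time_regular T \<Omega> (\<lambda>t x. \<psi> x * f t x)"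
  unfolding time_regular_def
proof (intro ballI conjI)
  fix t assume t: "t \<in> T"
  have B: "B \<ge> 0" using bd[of undefined] by linarith
  have int: "integrable (lebesgue_on \<Omega>) (f t)"
    and diff: "AE x in lebesgue_on \<Omega>. (\<lambda>s. f s x) differentiable at t"
    using f t unfolding time_regular_def by blast+
  show "integrable (lebesgue_on \<Omega>) (\<lambda>x. \<psi> x * f t x)"
  proof (rule Bochner_Integration.integrable_bound[OF integrable_mult_right[OF int, of B]])
    show "(\<lambda>x. \<psi> x * f t x) \<in> borel_measurable (lebesgue_on \<Omega>)" using m int by (intro borel_measurable_times) auto
    show "AE x in lebesgue_on \<Omega>. norm (\<psi> x * f t x) \<le> norm (B * f t x)"
      using bd B by (intro AE_I2) (auto simp: abs_mult intro: mult_right_mono)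
  qed
  show "AE x in lebesgue_on \<Omega>. (\<lambda>s. \<psi> x * f s x) differentiable at t"
    using diff by eventually_elim auto
  obtain e g where e: "e > 0" and g: "integrable (lebesgue_on \<Omega>) g"
    and dom: "\<And>s. s \<in> T \<inter> ball t e \<Longrightarrow> AE x in lebesgue_on \<Omega>. \<bar>f s x - f t x\<bar> \<le> g x * \<bar>s - t\<bar>"
    using f t unfolding time_regular_def by blast
  have "AE x in lebesgue_on \<Omega>. \<bar>\<psi> x * f s x - \<psi> x * f t x\<bar> \<le> (B * g x) * \<bar>s - t\<bar>"
    if "s \<in> T \<inter> ball t e" for s
    using dom[OF that]
  proof (rule eventually_mono)
    fix x assume *: "\<bar>f s x - f t x\<bar> \<le> g x * \<bar>s - t\<bar>"
    have "\<bar>\<psi> x * f s x - \<psi> x * f t x\<bar> = \<bar>\<psi> x\<bar> * \<bar>f s x - f t x\<bar>"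
      by (simp add: abs_mult[symmetric] algebra_simps)
    also have "\<dots> \<le> B * (g x * \<bar>s - t\<bar>)" using * bd B by (intro mult_mono) auto
    finally show "\<bar>\<psi> x * f s x - \<psi> x * f t x\<bar> \<le> (B * g x) * \<bar>s - t\<bar>" by (simp add: mult_ac)
  qed
  then show "\<exists>\<epsilon>>0. \<exists>g. integrable (lebesgue_on \<Omega>) g \<and> (\<forall>s\<in>T \<inter> ball t \<epsilon>.
      AE x in lebesgue_on \<Omega>. \<bar>\<psi> x * f s x - \<psi> x * f t x\<bar> \<le> g x * \<bar>s - t\<bar>)"
    using e integrable_mult_right[OF g, of B] by (intro exI[of _ e] conjI exI[of _ "\<lambda>x. B * g x"]) auto
qed

lemma divergence_scaleR:
  "divergence (\<lambda>y. g y *\<^sub>R v y) x = (\<Sum>b\<in>Basis. line_deriv (\<lambda>y. g y * (v y \<bullet> b)) b x)"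
  by (simp add: divergence_def line_deriv_def)

lemma has_line_deriv_mult:
  assumes "line_differentiable f b x" "line_differentiable g b x"
  shows "((\<lambda>s. f (x + s *\<^sub>R b) * g (x + s *\<^sub>R b)) has_real_derivative
      line_deriv f b x * g x + f x * line_deriv g b x) (at 0)"
  using DERIV_mult[OF line_differentiable_has_deriv[OF assms(1)] line_differentiable_has_deriv[OF assms(2)]]
  by (simp add: algebra_simps)

lemma line_deriv_mult:
  assumes "line_differentiable f b x" "line_differentiable g b x"
  shows "line_deriv (\<lambda>y. f y * g y) b x = line_deriv f b x * g x + f x * line_deriv g b x"
  by (rule line_derivI) (rule has_line_deriv_mult[OF assms])

text \<open>By the product rule \<open>F\<close> is almost everywhere the divergence of
  \<open>\<eta> h v\<close>, a locally Lipschitz field of compact support on the whole space. Only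
  the sum is shown integrable; each application splits it by the integrability of one
  summand.\<close>

lemma integral_divergence_cutoff:
  fixes \<Omega> :: "'a::euclidean_space set" and v :: "'a \<Rightarrow> 'a"
  assumes \<Omega>: "open \<Omega>" and h: "locally_lipschitz \<Omega> h"
    and v: "\<And>b. b \<in> Basis \<Longrightarrow> locally_lipschitz \<Omega> (\<lambda>y. v y \<bullet> b)"
    and \<eta>: "locally_lipschitz \<Omega> \<eta>" "compact K" "K \<subseteq> \<Omega>" "\<And>x. x \<notin> K \<Longrightarrow> \<eta> x = 0"
  defines "F \<equiv> \<lambda>x. \<eta> x * divergence (\<lambda>y. h y *\<^sub>R v y) x + (\<Sum>b\<in>Basis. line_deriv \<eta> b x * (v x \<bullet> b)) * h x"
  shows "integrable (lebesgue_on \<Omega>) F" "(LINT x|lebesgue_on \<Omega>. F x) = 0"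
proof -
  have S: "\<Omega> \<in> sets lebesgue" by (rule open_sets_lebesgue[OF \<Omega>])
  have hv: "locally_lipschitz \<Omega> (\<lambda>y. h y * (v y \<bullet> b))" if "b \<in> Basis" for b
    by (intro locally_lipschitz_mult h v that)
  define G where "G b y = \<eta> y * (h y * (v y \<bullet> b))" for b y
  have G0: "G b x = 0" if "x \<notin> K" for b x using \<eta>(4)[OF that] by (simp add: G_def)
  have G: "locally_lipschitz UNIV (G b)" if "b \<in> Basis" for b
    using locally_lipschitz_mult[OF \<eta>(1) hv[OF that]] compact_imp_closed[OF \<eta>(2)] \<eta>(3) G0
    unfolding G_def[abs_def] by (intro locally_lipschitz_extend_zero) auto
  define H where "H x = (\<Sum>b\<in>Basis. line_deriv (G b) b x)" for x
  have int: "integrable lebesgue H" "(LINT x|lebesgue. H x) = 0"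
    using integral_line_deriv_compact_support[OF G \<eta>(2) G0]
    by (auto simp: H_def[abs_def] Bochner_Integration.integral_sum)
  have H0: "H x = 0" if "x \<notin> \<Omega>" for x
  proof -
    have "x \<in> - K" "open (- K)" using that \<eta>(3) compact_imp_closed[OF \<eta>(2)] by auto
    then have "line_deriv (G b) b x = line_deriv (\<lambda>_. 0) b x" for b
      using G0 by (intro line_deriv_cong) auto
    then show ?thesis by (simp add: H_def line_deriv_def)
  qed
  have "(\<lambda>x. indicator \<Omega> x *\<^sub>R H x) = H" using H0 by (auto simp: indicator_def fun_eq_iff)
  then have intO: "integrable (lebesgue_on \<Omega>) H" "(LINT x|lebesgue_on \<Omega>. H x) = 0"
    using int S by (auto simp: integrable_restrict_space integral_restrict_space)
  have "AE x in lebesgue. x \<in> \<Omega> \<longrightarrow> (\<forall>c\<in>Basis. \<forall>b\<in>Basis. line_differentiable (\<lambda>y. h y * (v y \<bullet> c)) b x)"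
  proof -
    have "AE x in lebesgue. \<forall>c\<in>Basis. x \<in> \<Omega> \<longrightarrow> (\<forall>b\<in>Basis. line_differentiable (\<lambda>y. h y * (v y \<bullet> c)) b x)"
      by (subst AE_ball_countable) (auto intro: countable_finite AE_line_differentiable hv)
    then show ?thesis by eventually_elim auto
  qed
  with AE_line_differentiable[OF \<eta>(1)] have "AE x in lebesgue. x \<in> \<Omega> \<longrightarrow> H x = F x"
  proof eventually_elim
    case (elim x)
    show ?case
    proof
      assume "x \<in> \<Omega>"
      then have "line_deriv (G b) b x = line_deriv \<eta> b x * (h x * (v x \<bullet> b)) + \<eta> x * line_deriv (\<lambda>y. h y * (v y \<bullet> b)) b x"
        if "b \<in> Basis" for b
        using elim that unfolding G_def[abs_def] by (intro line_deriv_mult) auto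
      then show "H x = F x"
        by (simp add: H_def F_def divergence_scaleR sum.distrib sum_distrib_left sum_distrib_right mult_ac)
    qed
  qed
  then have "AE x in lebesgue_on \<Omega>. H x = F x" by (simp add: AE_lebesgue_on_iff[OF S])
  from integral_cong_AE_lebesgue_on[OF S intO(1) this] intO(2)
  show "integrable (lebesgue_on \<Omega>) F" "(LINT x|lebesgue_on \<Omega>. F x) = 0" by auto
qed

text \<open>On a compact ball the finitely many partial derivatives are bounded, hence so is the
  operator norm of the derivative; the ball is convex, so the mean value inequality applies.\<close>

lemma C1_imp_locally_lipschitz:
  fixes f :: "'a::euclidean_space \<Rightarrow> real"
  assumes deriv: "\<And>x. (f has_derivative f' x) (at x)" and cont: "\<And>v. continuous_on UNIV (\<lambda>x. f' x v)"
    and \<Omega>: "open \<Omega>"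
  shows "locally_lipschitz \<Omega> f"
  unfolding locally_lipschitz_def
proof
  fix y assume "y \<in> \<Omega>"
  then obtain e where e: "0 < e" "cball y e \<subseteq> \<Omega>" using \<Omega> open_contains_cball by blast
  have "\<forall>b\<in>Basis. \<exists>B. \<forall>x\<in>cball y e. \<bar>f' x b\<bar> \<le> B"
  proof
    fix b :: 'a
    have "bounded ((\<lambda>x. f' x b) ` cball y e)"
      using cont[of b] by (intro compact_imp_bounded compact_continuous_image) (auto intro: continuous_on_subset)
    then show "\<exists>B. \<forall>x\<in>cball y e. \<bar>f' x b\<bar> \<le> B" by (auto simp: bounded_iff)
  qed
  then obtain B where B: "\<And>b x. b \<in> Basis \<Longrightarrow> x \<in> cball y e \<Longrightarrow> \<bar>f' x b\<bar> \<le> B b" by metis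
  define C where "C = (\<Sum>b\<in>Basis. B b)"
  have C: "0 \<le> C" unfolding C_def using B[of _ y] e(1) by (intro sum_nonneg) (auto intro: order_trans[OF abs_ge_zero])
  have "onorm (f' x) \<le> C" if "x \<in> cball y e" for x
  proof (rule onorm_le)
    fix v
    have lin: "linear (f' x)" using deriv by (rule has_derivative_linear)
    have "f' x v = f' x (\<Sum>b\<in>Basis. (v \<bullet> b) *\<^sub>R b)" by (simp add: euclidean_representation)
    also have "\<dots> = (\<Sum>b\<in>Basis. (v \<bullet> b) *\<^sub>R f' x b)" using lin by (simp add: linear_sum linear_scale)
    finally have "\<bar>f' x v\<bar> \<le> (\<Sum>b\<in>Basis. \<bar>(v \<bullet> b) * f' x b\<bar>)" by simp
    also have "\<dots> \<le> (\<Sum>b\<in>(Basis::'a set). norm v * B b)"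
      unfolding abs_mult using B that Basis_le_norm by (intro sum_mono mult_mono) auto
    finally show "norm (f' x v) \<le> C * norm v" by (simp add: C_def sum_distrib_left mult.commute)
  qed
  moreover have "(f has_derivative f' x) (at x within cball y e)" for x
    using deriv by (rule has_derivative_at_withinI)
  ultimately have "C-lipschitz_on (cball y e) f"
    using C by (intro bounded_derivative_imp_lipschitz[where f' = f']) auto
  then show "\<exists>r>0. \<exists>L. cball y r \<subseteq> \<Omega> \<and> L-lipschitz_on (cball y r) f" using e by blast
qed

lemma locally_lipschitz_inner_Basis:
  fixes v :: "'a::metric_space \<Rightarrow> 'b::euclidean_space"
  assumes \<Omega>: "open \<Omega>" and lip: "L-lipschitz_on (closure \<Omega>) v" and b: "b \<in> Basis"
  shows "locally_lipschitz \<Omega> (\<lambda>y. v y \<bullet> b)"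
proof (rule lipschitz_on_imp_locally_lipschitz[OF _ \<Omega> closure_subset])
  show "L-lipschitz_on (closure \<Omega>) (\<lambda>y. v y \<bullet> b)"
  proof (rule lipschitz_onI)
    fix y z assume yz: "y \<in> closure \<Omega>" "z \<in> closure \<Omega>"
    have "dist (v y \<bullet> b) (v z \<bullet> b) = \<bar>(v y - v z) \<bullet> b\<bar>" by (simp add: dist_real_def inner_diff_left)
    also have "\<dots> \<le> norm (v y - v z)" using b by (rule Basis_le_norm)
    finally show "dist (v y \<bullet> b) (v z \<bullet> b) \<le> L * dist y z"
      using lipschitz_onD[OF lip yz] by (simp add: dist_norm)
  qed (rule lipschitz_on_nonneg[OF lip])
qed

text \<open>
  The test functions are products of two bumps: the first makes the residual of the transport equation
  integrable with support in a box, the second enters the fundamental lemma.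
\<close>
lemma weak_transport_AE:
  fixes \<Omega> :: "'a::euclidean_space set"
  assumes \<Omega>: "open \<Omega>" and T: "open T" "t \<in> T"
    and \<rho>: "locally_lipschitz \<Omega> (\<rho> t)" "time_regular T \<Omega> \<rho>"
    and u: "\<And>b. b \<in> Basis \<Longrightarrow> locally_lipschitz \<Omega> (\<lambda>y. u t y \<bullet> b)"
    and transport: "weak_transport T \<Omega> u \<rho>"
  shows "AE x in lebesgue. x \<in> \<Omega> \<longrightarrow> time_deriv \<rho> t x + divergence (\<lambda>y. \<rho> t y *\<^sub>R u t y) x = 0"
proof -
  let ?M = "lebesgue_on \<Omega>"
  define W where "W x = time_deriv \<rho> t x + divergence (\<lambda>y. \<rho> t y *\<^sub>R u t y) x" for x
  have S: "\<Omega> \<in> sets lebesgue" by (rule open_sets_lebesgue[OF \<Omega>])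
  have test: "integrable lebesgue (\<lambda>x. \<psi> x * W x) \<and> (LINT x|lebesgue. \<psi> x * W x) = 0"
    if \<psi>: "flat_poly \<psi>" and supp: "\<And>x. x \<notin> cbox l r \<Longrightarrow> \<psi> x = 0" and lr: "cbox l r \<subseteq> \<Omega>"
    for \<psi> :: "'a \<Rightarrow> real" and l r
  proof -
    obtain \<psi>' where d: "\<And>x. (\<psi> has_derivative \<psi>' x) (at x)" "\<And>v. flat_poly (\<lambda>x. \<psi>' x v)"
      using flat_poly_derivative[OF \<psi>] by blast
    have cont: "continuous_on UNIV \<psi>" "\<And>v. continuous_on UNIV (\<lambda>x. \<psi>' x v)"
      using flat_poly_Ck[OF \<psi>, of 0] flat_poly_Ck[OF d(2), of 0] by auto
    have fr: "frechet_derivative \<psi> (at x) = \<psi>' x" for x using frechet_derivative_at[OF d(1)] by simp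
    have ld: "line_deriv \<psi> b x = \<psi>' x b" for b x
    proof (rule line_derivI)
      have "((\<lambda>s. x + s *\<^sub>R b) has_derivative (\<lambda>s. s *\<^sub>R b)) (at 0)" by (auto intro!: derivative_eq_intros)
      from has_derivative_compose[OF this, of \<psi> "\<psi>' x"] d(1)[of x]
      have "((\<lambda>s. \<psi> (x + s *\<^sub>R b)) has_derivative (\<lambda>s. \<psi>' x (s *\<^sub>R b))) (at 0)" by simp
      moreover have "(\<lambda>s. \<psi>' x (s *\<^sub>R b)) = (*) (\<psi>' x b)"
        using linear_scale[OF has_derivative_linear[OF d(1)[of x]]] by (auto simp: fun_eq_iff)
      ultimately show "((\<lambda>s. \<psi> (x + s *\<^sub>R b)) has_real_derivative \<psi>' x b) (at 0)"
        by (simp add: has_field_derivative_def)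
    qed
    have Du: "\<psi>' x (u t x) = (\<Sum>b\<in>Basis. line_deriv \<psi> b x * (u t x \<bullet> b))" for x
    proof -
      have lin: "linear (\<psi>' x)" using d(1) by (rule has_derivative_linear)
      have "\<psi>' x (u t x) = \<psi>' x (\<Sum>b\<in>Basis. (u t x \<bullet> b) *\<^sub>R b)" by (simp add: euclidean_representation)
      also have "\<dots> = (\<Sum>b\<in>Basis. (u t x \<bullet> b) *\<^sub>R \<psi>' x b)" using lin by (simp add: linear_sum linear_scale)
      finally show ?thesis by (simp add: ld mult.commute)
    qed
    have lip\<psi>: "locally_lipschitz \<Omega> \<psi>"
      by (rule C1_imp_locally_lipschitz[OF d(1) cont(2) \<Omega>])
    have "bounded (\<psi> ` cbox l r)"
      using cont(1) by (intro compact_imp_bounded compact_continuous_image) (auto intro: continuous_on_subset)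
    then obtain B0 where B0: "\<And>x. x \<in> cbox l r \<Longrightarrow> \<bar>\<psi> x\<bar> \<le> B0" by (auto simp: bounded_iff)
    have B: "\<bar>\<psi> x\<bar> \<le> \<bar>B0\<bar>" for x using B0[of x] supp[of x] by (cases "x \<in> cbox l r") auto
    have "\<psi> \<in> borel_measurable lebesgue"
      by (rule measurable_completion) (use cont(1) borel_measurable_continuous_onI in simp)
    then have m\<psi>: "\<psi> \<in> borel_measurable ?M" by (rule measurable_restrict_space1)
    have tr: "time_regular T \<Omega> (\<lambda>s x. \<psi> x * \<rho> s x)"
      by (rule time_regular_bounded_mult[OF \<rho>(2) m\<psi> B])
    note td = time_regular_has_derivative_integral[OF \<Omega> T tr]
    have td_eq: "AE x in ?M. time_deriv (\<lambda>s x. \<psi> x * \<rho> s x) t x = \<psi> x * time_deriv \<rho> t x"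
    proof -
      have "AE x in ?M. (\<lambda>s. \<rho> s x) differentiable at t" using \<rho>(2) T(2) unfolding time_regular_def by blast
      then show ?thesis
      proof (rule eventually_mono)
        fix x assume "(\<lambda>s. \<rho> s x) differentiable at t"
        then have "((\<lambda>s. \<rho> s x) has_real_derivative time_deriv \<rho> t x) (at t)"
          using DERIV_deriv_iff_real_differentiable by blast
        then show "time_deriv (\<lambda>s x. \<psi> x * \<rho> s x) t x = \<psi> x * time_deriv \<rho> t x"
          by (intro DERIV_imp_deriv DERIV_cmult)
      qed
    qed
    note t1 = integral_cong_AE_lebesgue_on[OF S td(1) td_eq]
    have test: "test_function \<psi>"
    proof -
      have "{x. \<psi> x \<noteq> 0} \<subseteq> cbox l r" using supp by blast
      then have "bounded (closure {x. \<psi> x \<noteq> 0})" using bounded_cbox bounded_subset by blast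
      then show ?thesis unfolding test_function_def compact_eq_bounded_closed
        using flat_poly_Ck[OF \<psi>] by simp
    qed
    have "((\<lambda>s. LINT x|?M. \<psi> x * \<rho> s x) has_real_derivative (LINT x|?M. \<psi>' x (u t x) * \<rho> t x)) (at t)"
      using transport test T(2) unfolding weak_transport_def fr[symmetric] by blast
    \<comment> \<open>The integral of \<open>\<psi> * \<rho>\<close> has two expressions for its
      time derivative, from the weak equation and from differentiation under the integral sign; they
      must agree.\<close>
    from DERIV_unique[OF this td(2)] t1(2)
    have e1: "(LINT x|?M. \<psi> x * time_deriv \<rho> t x) = (LINT x|?M. \<psi>' x (u t x) * \<rho> t x)" by simp
    have \<psi>'0: "\<psi>' x v = 0" if "x \<notin> cbox l r" for x v
    proof -
      have "(\<psi> has_derivative (\<lambda>_. 0)) (at x)"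
      proof (rule has_derivative_transform_within_open)
        show "((\<lambda>_. 0) has_derivative (\<lambda>_. 0)) (at x)" by simp
        show "open (- cbox l r)" "x \<in> - cbox l r" using that closed_cbox by auto
      qed (use supp in auto)
      from has_derivative_unique[OF d(1) this] show ?thesis by simp
    qed
    have i2: "integrable ?M (\<lambda>x. \<psi>' x (u t x) * \<rho> t x)"
    proof -
      have c: "continuous_on (cbox l r) (\<lambda>x. \<psi>' x (u t x) * \<rho> t x)"
        unfolding Du ld using cont(2) locally_lipschitz_continuous_on[OF u] locally_lipschitz_continuous_on[OF \<rho>(1)] lr
        by (intro continuous_on_mult continuous_on_sum) (auto intro: continuous_on_subset)
      have "integrable lborel (\<lambda>x. indicator (cbox l r) x *\<^sub>R (\<psi>' x (u t x) * \<rho> t x))"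
        by (rule borel_integrable_compact[OF compact_cbox c])
      moreover have "(\<lambda>x. indicator (cbox l r) x *\<^sub>R (\<psi>' x (u t x) * \<rho> t x)) = (\<lambda>x. indicator \<Omega> x *\<^sub>R (\<psi>' x (u t x) * \<rho> t x))"
        using \<psi>'0 lr by (auto simp: indicator_def fun_eq_iff)
      ultimately have "integrable lborel (\<lambda>x. indicator \<Omega> x *\<^sub>R (\<psi>' x (u t x) * \<rho> t x))" by simp
      then have "integrable lebesgue (\<lambda>x. indicator \<Omega> x *\<^sub>R (\<psi>' x (u t x) * \<rho> t x))"
        using integrable_completion by (metis borel_measurable_integrable)
      then show ?thesis using S by (simp add: integrable_restrict_space)
    qed
    have p: "integrable ?M (\<lambda>x. \<psi> x * divergence (\<lambda>y. \<rho> t y *\<^sub>R u t y) x + \<psi>' x (u t x) * \<rho> t x)"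
      "(LINT x|?M. \<psi> x * divergence (\<lambda>y. \<rho> t y *\<^sub>R u t y) x + \<psi>' x (u t x) * \<rho> t x) = 0"
      using integral_divergence_cutoff[OF \<Omega> \<rho>(1) u lip\<psi> compact_cbox lr supp] unfolding Du by auto
    \<comment> \<open>Subtracting the gradient term, integrable because it is continuous on the box
      and vanishes off it, isolates the divergence term.\<close>
    from Bochner_Integration.integrable_diff[OF p(1) i2]
    have i3: "integrable ?M (\<lambda>x. \<psi> x * divergence (\<lambda>y. \<rho> t y *\<^sub>R u t y) x)" by simp
    have i4: "integrable ?M (\<lambda>x. \<psi> x * W x)" "(LINT x|?M. \<psi> x * W x) = 0"
      using p(2) e1 i2 i3 t1(1) unfolding W_def distrib_left by auto
    have "(\<lambda>x. indicator \<Omega> x *\<^sub>R (\<psi> x * W x)) = (\<lambda>x. \<psi> x * W x)"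
      using supp lr by (fastforce simp: indicator_def fun_eq_iff)
    then show ?thesis using i4 S by (simp add: integrable_restrict_space integral_restrict_space)
  qed
  have box: "AE x in lebesgue. x \<in> cbox l r \<longrightarrow> W x = 0" if lr: "cbox l r \<subseteq> \<Omega>" for l r
  proof -
    let ?w = "\<lambda>x. bump l r 1 x * W x"
    have b0: "bump l r 1 x = 0" if "x \<notin> cbox l r" for x using that bump_eq_0 box_subset_cbox by blast
    have i: "integrable lebesgue ?w" using test[OF flat_poly_bump b0 lr] by blast
    have "AE x in lebesgue. ?w x = 0"
    proof (rule AE_zero_if_bump_integrals_zero[OF i, of l r])
      show "?w x = 0" if "x \<notin> cbox l r" for x using b0[OF that] by simp
      show "(LINT x|lebesgue. bump l' r' n x * ?w x) = 0" for l' r' :: 'a and n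
        using test[OF flat_poly.mult[OF flat_poly_bump[of l' r' n] flat_poly_bump[of l r 1]] _ lr] b0
        by (simp add: mult.assoc)
    qed
    \<comment> \<open>The bump is zero on the faces of the box, which are dropped as a null
      set.\<close>
    moreover have "AE x in lebesgue. x \<notin> cbox l r - box l r"
      using negligible_frontier_interval[of l r] by (intro AE_not_in) (simp add: negligible_iff_null_sets)
    ultimately show ?thesis
    proof eventually_elim
      case (elim x)
      have "bump l r 1 x \<noteq> 0" if "x \<in> box l r" using that by (auto simp: bump_def flat_def box_def)
      with elim show ?case by auto
    qed
  qed
  obtain D where D: "countable D" "D \<subseteq> Pow \<Omega>" "\<And>X. X \<in> D \<Longrightarrow> \<exists>a b. X = cbox a b" "\<Union>D = \<Omega>"
    using open_countable_Union_open_cbox[OF \<Omega>] by metis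
  have "AE x in lebesgue. \<forall>X\<in>D. x \<in> X \<longrightarrow> W x = 0"
    using D box by (subst AE_ball_countable) (auto, metis PowD subset_iff)
  then show ?thesis using D(4) unfolding W_def by (auto elim!: eventually_mono)
qed


section \<open>The divergence theorem for fields vanishing on the boundary\<close>

lemma abs_line_deriv_le:
  fixes f :: "'a::real_normed_vector \<Rightarrow> real"
  assumes "L-lipschitz_on UNIV f" "line_differentiable f b x" "norm b = 1"
  shows "\<bar>line_deriv f b x\<bar> \<le> L"
proof (rule LIMSEQ_le_const2)
  show "(\<lambda>n. \<bar>real (Suc n) * (f (x + (1 / real (Suc n)) *\<^sub>R b) - f x)\<bar>) \<longlonglongrightarrow> \<bar>line_deriv f b x\<bar>"
    by (intro tendsto_rabs line_quotient_tendsto assms(2))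
  have "\<bar>real (Suc n) * (f (x + (1 / real (Suc n)) *\<^sub>R b) - f x)\<bar> \<le> L" for n
  proof -
    have "dist (x + (1 / real (Suc n)) *\<^sub>R b) x = 1 / real (Suc n)" using assms(3) by (simp add: dist_norm)
    then have "\<bar>f (x + (1 / real (Suc n)) *\<^sub>R b) - f x\<bar> \<le> L * (1 / real (Suc n))"
      using lipschitz_onD[OF assms(1), of "x + (1 / real (Suc n)) *\<^sub>R b" x] by (simp add: dist_real_def)
    then have "real (Suc n) * \<bar>f (x + (1 / real (Suc n)) *\<^sub>R b) - f x\<bar> \<le> L" by (simp add: field_simps)
    then show ?thesis by (simp add: abs_mult)
  qed
  then show "\<exists>N. \<forall>n\<ge>N. \<bar>real (Suc n) * (f (x + (1 / real (Suc n)) *\<^sub>R b) - f x)\<bar> \<le> L" by blast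
qed

lemma line_deriv_locally_const:
  fixes f :: "'a::real_normed_vector \<Rightarrow> real"
  assumes "open U" "x \<in> U" "\<And>y. y \<in> U \<Longrightarrow> f y = c"
  shows "line_deriv f b x = 0"
  using line_deriv_cong(1)[OF assms(1,2), of f "\<lambda>_. c"] assms(3) by (simp add: line_deriv_def)

text \<open>A nearest point of the complement is a frontier point, because the open ball reaching up
  to it lies in \<open>\<Omega>\<close>. There \<open>v\<close> vanishes, and the Lipschitz bound on
  the closure compares it with \<open>v x\<close>.\<close>

lemma norm_le_infdist_if_zero_on_frontier:
  fixes v :: "'a::euclidean_space \<Rightarrow> 'b::real_normed_vector"
  assumes \<Omega>: "open \<Omega>" "\<Omega> \<noteq> UNIV" and x: "x \<in> \<Omega>"
    and lip: "L-lipschitz_on (closure \<Omega>) v" and zero: "\<And>y. y \<in> frontier \<Omega> \<Longrightarrow> v y = 0"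
  shows "norm (v x) \<le> L * infdist x (- \<Omega>)"
proof -
  have "closed (- \<Omega>)" "- \<Omega> \<noteq> {}" using \<Omega> by auto
  then obtain z where z: "z \<in> - \<Omega>" "infdist x (- \<Omega>) = dist x z" using infdist_attains_inf by blast
  have "ball x (dist x z) \<subseteq> \<Omega>"
  proof
    fix y assume y: "y \<in> ball x (dist x z)"
    show "y \<in> \<Omega>"
    proof (rule ccontr)
      assume "y \<notin> \<Omega>"
      then have "infdist x (- \<Omega>) \<le> dist x y" by (intro infdist_le) auto
      with y z show False by simp
    qed
  qed
  then have "closure (ball x (dist x z)) \<subseteq> closure \<Omega>" by (rule closure_mono)
  moreover have "x \<noteq> z" using x z by auto
  ultimately have "z \<in> closure \<Omega>" by (auto simp: closure_ball)
  moreover have "interior \<Omega> = \<Omega>" using \<Omega>(1) by (rule interior_open)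
  ultimately have "z \<in> frontier \<Omega>" using z(1) by (auto simp: frontier_def)
  then have "v z = 0" by (rule zero)
  moreover have "dist (v x) (v z) \<le> L * dist x z"
    using \<open>z \<in> closure \<Omega>\<close> x closure_subset by (intro lipschitz_onD[OF lip]) auto
  ultimately show ?thesis using z(2) by simp
qed

lemma abs_clamp_diff_le: "\<bar>max 0 (min 1 a) - max 0 (min 1 b)\<bar> \<le> \<bar>a - b\<bar>" for a b :: real
  by auto

text \<open>
  Cutoffs \<open>\<eta>\<close> approaching the boundary and infinity: \<open>\<nabla>\<eta>\<close> is of the order of the inverse distance to
  the boundary, and of the inverse norm near infinity, which the growth of \<open>v\<close> compensates.
\<close>
lemma integral_divergence_eq_0:
  fixes \<Omega> :: "'a::euclidean_space set" and v :: "'a \<Rightarrow> 'a"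
  assumes \<Omega>: "open \<Omega>" and h: "locally_lipschitz \<Omega> h" "integrable (lebesgue_on \<Omega>) h"
    and lip: "L-lipschitz_on (closure \<Omega>) v" and zero: "\<And>y. y \<in> frontier \<Omega> \<Longrightarrow> v y = 0"
    and W: "integrable (lebesgue_on \<Omega>) W"
      "AE x in lebesgue_on \<Omega>. divergence (\<lambda>y. h y *\<^sub>R v y) x = W x"
  shows "(LINT x|lebesgue_on \<Omega>. W x) = 0"
proof (cases "\<Omega> = {}")
  case True
  then show ?thesis by (simp add: integral_restrict_space)
next
  case False
  then obtain x0 where x0: "x0 \<in> \<Omega>" by blast
  let ?M = "lebesgue_on \<Omega>"
  have S: "\<Omega> \<in> sets lebesgue" by (rule open_sets_lebesgue[OF \<Omega>])
  have L: "L \<ge> 0" using lip lipschitz_on_nonneg by blast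
  \<comment> \<open>A Lipschitz field grows at most linearly; \<open>c\<close> is the constant term
    of this growth.\<close>
  define c where "c = norm (v x0) + L * norm x0"
  have c: "c \<ge> 0" using L by (simp add: c_def)
  have growth: "norm (v x) \<le> c + L * norm x" if "x \<in> \<Omega>" for x
  proof -
    have "norm (v x - v x0) \<le> L * norm (x - x0)"
      using lipschitz_on_normD[OF lip] that x0 closure_subset by blast
    also have "\<dots> \<le> L * (norm x + norm x0)" using L by (intro mult_left_mono norm_triangle_ineq4)
    finally show ?thesis using norm_triangle_ineq2[of "v x" "v x0"] by (simp add: c_def algebra_simps)
  qed
  define d where "d x = infdist x (- \<Omega>)" for x
  have dc: "continuous_on UNIV d" unfolding d_def by (intro continuous_intros)
  \<comment> \<open>\<open>\<alpha> n\<close> rises from 0 to 1 while the distance to the complement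
    goes from \<open>1 / Suc n\<close> to \<open>2 / Suc n\<close>; \<open>\<beta> n\<close> falls
    from 1 to 0 between the norms \<open>Suc n\<close> and \<open>2 * Suc n\<close>. The whole space
    is a separate case because \<open>infdist\<close> to the empty set is 0.\<close>
  define \<alpha> where "\<alpha> n x = (if \<Omega> = UNIV then 1 else max 0 (min 1 (real (Suc n) * d x - 1)))" for n x
  define \<beta> where "\<beta> n x = max 0 (min 1 (2 - norm x / real (Suc n)))" for n and x :: 'a
  define \<eta> where "\<eta> n x = \<alpha> n x * \<beta> n x" for n x
  have \<alpha>_lip: "(real (Suc n))-lipschitz_on UNIV (\<alpha> n)" for n
  proof (rule lipschitz_onI)
    fix x y
    have "\<bar>(real (Suc n) * d x - 1) - (real (Suc n) * d y - 1)\<bar> = real (Suc n) * \<bar>d x - d y\<bar>"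
    proof -
      have "(real (Suc n) * d x - 1) - (real (Suc n) * d y - 1) = real (Suc n) * (d x - d y)"
        by (simp only: right_diff_distrib)
      then show ?thesis by (simp add: abs_mult del: of_nat_Suc)
    qed
    also have "\<dots> \<le> real (Suc n) * dist x y"
      unfolding d_def by (intro mult_left_mono infdist_triangle_abs) auto
    finally show "dist (\<alpha> n x) (\<alpha> n y) \<le> real (Suc n) * dist x y"
      unfolding \<alpha>_def dist_real_def using abs_clamp_diff_le[of "real (Suc n) * d x - 1" "real (Suc n) * d y - 1"] by auto
  qed simp
  have \<beta>_lip: "(1 / real (Suc n))-lipschitz_on UNIV (\<beta> n)" for n
  proof (rule lipschitz_onI)
    fix x y :: 'a
    have "\<bar>(2 - norm x / real (Suc n)) - (2 - norm y / real (Suc n))\<bar> = \<bar>norm y - norm x\<bar> / real (Suc n)"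
      by (simp add: diff_divide_distrib[symmetric] abs_divide)
    also have "\<dots> \<le> dist x y / real (Suc n)"
      using norm_triangle_ineq3[of y x] by (intro divide_right_mono) (auto simp: dist_norm norm_minus_commute)
    finally show "dist (\<beta> n x) (\<beta> n y) \<le> 1 / real (Suc n) * dist x y"
      unfolding \<beta>_def dist_real_def using abs_clamp_diff_le[of "2 - norm x / real (Suc n)" "2 - norm y / real (Suc n)"] by auto
  qed simp
  have \<alpha>1: "0 \<le> \<alpha> n x" "\<alpha> n x \<le> 1" and \<beta>1: "0 \<le> \<beta> n x" "\<beta> n x \<le> 1" for n x
    by (auto simp: \<alpha>_def \<beta>_def)
  have \<eta>1: "0 \<le> \<eta> n x" "\<eta> n x \<le> 1" for n x
    using \<alpha>1 \<beta>1 by (auto simp: \<eta>_def intro: mult_le_one)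
  have \<alpha>L: "locally_lipschitz UNIV (\<alpha> n)" and \<beta>L: "locally_lipschitz UNIV (\<beta> n)" for n
    using lipschitz_on_imp_locally_lipschitz[OF \<alpha>_lip] lipschitz_on_imp_locally_lipschitz[OF \<beta>_lip] by auto
  have \<eta>L: "locally_lipschitz UNIV (\<eta> n)" for n
    unfolding \<eta>_def by (intro locally_lipschitz_mult \<alpha>L \<beta>L)
  define K where "K n = (if \<Omega> = UNIV then UNIV else {x. 1 / real (Suc n) \<le> d x}) \<inter> cball 0 (2 * real (Suc n))" for n
  have K: "compact (K n)" "K n \<subseteq> \<Omega>" for n
  proof -
    have "closed {x. 1 / real (Suc n) \<le> d x}" by (intro closed_Collect_le dc continuous_intros)
    then show "compact (K n)" unfolding K_def by (intro closed_Int_compact) auto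
    show "K n \<subseteq> \<Omega>"
    proof
      fix x assume x: "x \<in> K n"
      show "x \<in> \<Omega>"
      proof (rule ccontr)
        assume "x \<notin> \<Omega>"
        then have "d x = 0" "1 / real (Suc n) \<le> d x" using x by (auto simp: d_def K_def split: if_splits)
        then show False by simp
      qed
    qed
  qed
  have \<eta>0: "\<eta> n x = 0" if "x \<notin> K n" for n x
    using that by (auto simp: K_def \<eta>_def \<alpha>_def \<beta>_def field_simps split: if_splits)
  \<comment> \<open>The slope of \<open>\<alpha> n\<close> is at most \<open>Suc n\<close>, and it
    can be nonzero only where the distance to the complement is at most \<open>2 / Suc n\<close>;
    there \<open>v\<close> has norm at most \<open>2 * L / Suc n\<close>.\<close>
  have \<alpha>v: "\<bar>line_deriv (\<alpha> n) b x * (v x \<bullet> b)\<bar> \<le> 2 * L"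
    if x: "x \<in> \<Omega>" and b: "b \<in> Basis" and ld: "line_differentiable (\<alpha> n) b x" for n b x
  proof -
    consider "\<Omega> = UNIV" | "\<Omega> \<noteq> UNIV" "d x > 2 / real (Suc n)" | "\<Omega> \<noteq> UNIV" "d x \<le> 2 / real (Suc n)" by linarith
    then show ?thesis
    proof cases
      case 1
      then have "line_deriv (\<alpha> n) b x = 0" by (intro line_deriv_locally_const[of UNIV _ _ 1]) (auto simp: \<alpha>_def)
      then show ?thesis using L by simp
    next
      case 2
      have "line_deriv (\<alpha> n) b x = 0"
      proof (rule line_deriv_locally_const)
        show "open {x. 2 / real (Suc n) < d x}" by (intro open_Collect_less dc continuous_intros)
        show "\<alpha> n y = 1" if "y \<in> {x. 2 / real (Suc n) < d x}" for y
        proof -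
          have "2 < real (Suc n) * d y" using that by (simp add: divide_less_eq mult.commute)
          then show ?thesis unfolding \<alpha>_def by simp
        qed
      qed (use 2 in auto)
      then show ?thesis using L by simp
    next
      case 3
      have "\<bar>v x \<bullet> b\<bar> \<le> norm (v x)" using b by (simp add: Basis_le_norm)
      also have "\<dots> \<le> L * d x" unfolding d_def by (rule norm_le_infdist_if_zero_on_frontier[OF \<Omega> 3(1) x lip zero])
      also have "\<dots> \<le> L * (2 / real (Suc n))" using 3 L by (intro mult_left_mono) auto
      finally have "\<bar>line_deriv (\<alpha> n) b x\<bar> * \<bar>v x \<bullet> b\<bar> \<le> real (Suc n) * (L * (2 / real (Suc n)))"
        using abs_line_deriv_le[OF \<alpha>_lip ld] b by (intro mult_mono) auto
      also have "\<dots> = 2 * L" by simp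
      finally show ?thesis by (simp add: abs_mult)
    qed
  qed
  \<comment> \<open>The slope of \<open>\<beta> n\<close> is at most \<open>1 / Suc n\<close> and
    can be nonzero only up to norm \<open>2 * Suc n\<close>, where linear growth bounds
    \<open>v\<close> by \<open>(c + 2 * L) * Suc n\<close>.\<close>
  have \<beta>v: "\<bar>line_deriv (\<beta> n) b x * (v x \<bullet> b)\<bar> \<le> c + 2 * L"
    if x: "x \<in> \<Omega>" and b: "b \<in> Basis" and ld: "line_differentiable (\<beta> n) b x" for n b x
  proof (cases "norm x > 2 * real (Suc n)")
    case True
    have "line_deriv (\<beta> n) b x = 0"
    proof (rule line_deriv_locally_const)
      show "open {x::'a. 2 * real (Suc n) < norm x}" by (intro open_Collect_less continuous_intros)
      show "\<beta> n y = 0" if "y \<in> {x. 2 * real (Suc n) < norm x}" for y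
      proof -
        have "2 < norm y / real (Suc n)" using that by (simp add: less_divide_eq)
        then show ?thesis unfolding \<beta>_def by simp
      qed
    qed (use True in auto)
    then show ?thesis using c L by simp
  next
    case False
    have "\<bar>v x \<bullet> b\<bar> \<le> norm (v x)" using b by (simp add: Basis_le_norm)
    also have "\<dots> \<le> c + L * norm x" by (rule growth[OF x])
    also have "\<dots> \<le> c * real (Suc n) + L * (2 * real (Suc n))"
      using False L c by (intro add_mono mult_left_mono) (auto simp: mult_le_cancel_left1)
    finally have "\<bar>line_deriv (\<beta> n) b x\<bar> * \<bar>v x \<bullet> b\<bar> \<le> 1 / real (Suc n) * (c * real (Suc n) + L * (2 * real (Suc n)))"
      using abs_line_deriv_le[OF \<beta>_lip ld] b by (intro mult_mono) auto
    also have "\<dots> = c + 2 * L" by (simp add: field_simps)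
    finally show ?thesis by (simp add: abs_mult)
  qed
  define D where "D n x = (\<Sum>b\<in>Basis. line_deriv (\<eta> n) b x * (v x \<bullet> b))" for n x
  \<comment> \<open>\<open>2 * L\<close> from \<open>\<alpha>\<close> and \<open>c + 2 * L\<close>
    from \<open>\<beta>\<close>, once for each basis vector.\<close>
  define C where "C = real DIM('a) * (c + 4 * L)"
  have Dbound: "AE x in ?M. \<bar>D n x\<bar> \<le> C" for n
    unfolding AE_lebesgue_on_iff[OF S] using AE_line_differentiable[OF \<alpha>L[of n]] AE_line_differentiable[OF \<beta>L[of n]]
  proof eventually_elim
    case (elim x)
    show ?case
    proof
      assume x: "x \<in> \<Omega>"
      have "\<bar>line_deriv (\<eta> n) b x * (v x \<bullet> b)\<bar> \<le> c + 4 * L" if b: "b \<in> Basis" for b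
      proof -
        have ld: "line_differentiable (\<alpha> n) b x" "line_differentiable (\<beta> n) b x" using elim b by auto
        let ?A = "line_deriv (\<alpha> n) b x * (v x \<bullet> b)" and ?B = "line_deriv (\<beta> n) b x * (v x \<bullet> b)"
        have "line_deriv (\<eta> n) b x * (v x \<bullet> b) = ?A * \<beta> n x + \<alpha> n x * ?B"
          unfolding \<eta>_def[abs_def] line_deriv_mult[OF ld] by (simp add: algebra_simps)
        then have "\<bar>line_deriv (\<eta> n) b x * (v x \<bullet> b)\<bar> \<le> \<bar>?A\<bar> * \<beta> n x + \<alpha> n x * \<bar>?B\<bar>"
          using abs_triangle_ineq[of "?A * \<beta> n x" "\<alpha> n x * ?B"] \<alpha>1[of n x] \<beta>1[of n x] by (simp add: abs_mult)
        also have "\<dots> \<le> (2 * L) * 1 + 1 * (c + 2 * L)"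
          using \<alpha>v[OF x b ld(1)] \<beta>v[OF x b ld(2)] \<alpha>1[of n x] \<beta>1[of n x] L
          by (intro add_mono mult_mono) auto
        finally show ?thesis by simp
      qed
      then have "\<bar>D n x\<bar> \<le> (\<Sum>b\<in>(Basis::'a set). c + 4 * L)"
        unfolding D_def by (intro order_trans[OF sum_abs] sum_mono)
      then show "\<bar>D n x\<bar> \<le> C" by (simp add: C_def)
    qed
  qed
  \<comment> \<open>For large \<open>n\<close> the cutoff is 1 on a whole neighbourhood of
    \<open>x\<close>, so its derivatives vanish at \<open>x\<close>. With the uniform bound
    \<open>C\<close> and the integrability of \<open>h\<close>, the gradient term disappears in the
    limit.\<close>
  have ev: "\<forall>\<^sub>F n in sequentially. \<eta> n x = 1 \<and> D n x = 0" if x: "x \<in> \<Omega>" for x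
  proof -
    have dpos: "\<Omega> \<noteq> UNIV \<Longrightarrow> d x > 0" unfolding d_def
      using x \<Omega> by (intro infdist_pos_not_in_closed) auto
    have "\<forall>\<^sub>F n in sequentially. norm x < real (Suc n)"
      using filterlim_real_sequentially[THEN filterlim_compose, OF filterlim_Suc]
      by (auto simp: filterlim_at_top_dense)
    moreover have "\<forall>\<^sub>F n in sequentially. \<Omega> \<noteq> UNIV \<longrightarrow> 2 / d x < real (Suc n)"
      using filterlim_real_sequentially[THEN filterlim_compose, OF filterlim_Suc]
      by (auto simp: filterlim_at_top_dense)
    ultimately show ?thesis
    proof eventually_elim
      case (elim n)
      define U where "U = (if \<Omega> = UNIV then UNIV else {x. 2 / real (Suc n) < d x}) \<inter> {x. norm x < real (Suc n)}"
      have "open {x. 2 / real (Suc n) < d x}" "open {x::'a. norm x < real (Suc n)}"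
        by (intro open_Collect_less dc continuous_intros)+
      then have oU: "open U" unfolding U_def by (intro open_Int) auto
      have xU: "x \<in> U" using elim dpos by (auto simp: U_def field_simps)
      have one: "\<eta> n y = 1" if "y \<in> U" for y
      proof -
        have "norm y / real (Suc n) < 1" using that by (simp add: U_def divide_less_eq)
        then have "\<beta> n y = 1" unfolding \<beta>_def by simp
        moreover have "\<alpha> n y = 1"
        proof (cases "\<Omega> = UNIV")
          case False
          then have "2 < real (Suc n) * d y" using that by (simp add: U_def divide_less_eq mult.commute)
          then show ?thesis unfolding \<alpha>_def by simp
        qed (simp add: \<alpha>_def)
        ultimately show ?thesis by (simp add: \<eta>_def)
      qed
      have "D n x = 0" unfolding D_def using line_deriv_locally_const[OF oU xU one] by simp
      with one[OF xU] show ?case by simp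
    qed
  qed
  note vb = locally_lipschitz_inner_Basis[OF \<Omega> lip]
  have \<eta>m: "\<eta> n \<in> borel_measurable ?M" for n
  proof -
    have "\<eta> n \<in> borel_measurable borel"
      by (intro borel_measurable_continuous_onI locally_lipschitz_continuous_on \<eta>L)
    then have "\<eta> n \<in> borel_measurable lebesgue" by (intro measurable_completion) simp
    then show ?thesis by (rule measurable_restrict_space1)
  qed
  have Wm: "W \<in> borel_measurable ?M" using W(1) by auto
  have \<eta>Wm: "(\<lambda>x. \<eta> n x * W x) \<in> borel_measurable ?M" for n using \<eta>m Wm by (rule borel_measurable_times)
  have \<eta>W_bd: "AE x in ?M. norm (\<eta> n x * W x) \<le> \<bar>W x\<bar>" for n
    using \<eta>1[of n] by (intro AE_I2) (auto simp: abs_mult intro: mult_left_le_one_le)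
  have iW: "integrable ?M (\<lambda>x. \<bar>W x\<bar>)" using W(1) by (rule integrable_abs)
  have i1: "integrable ?M (\<lambda>x. \<eta> n x * W x)" for n
    by (rule Bochner_Integration.integrable_bound[OF W(1) \<eta>Wm]) (use \<eta>W_bd[of n] in simp)
  have i2: "integrable ?M (\<lambda>x. D n x * h x)" "(LINT x|?M. D n x * h x) = - (LINT x|?M. \<eta> n x * W x)" for n
  proof -
    have \<eta>\<Omega>: "locally_lipschitz \<Omega> (\<eta> n)" by (rule locally_lipschitz_subset[OF \<eta>L \<Omega>]) simp
    note cut = integral_divergence_cutoff[OF \<Omega> h(1) vb \<eta>\<Omega> K(1) K(2) \<eta>0]
    have "AE x in ?M. \<eta> n x * divergence (\<lambda>y. h y *\<^sub>R v y) x + (\<Sum>b\<in>Basis. line_deriv (\<eta> n) b x * (v x \<bullet> b)) * h x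
        = \<eta> n x * W x + D n x * h x"
      using W(2) by eventually_elim (simp add: D_def)
    note cg = integral_cong_AE_lebesgue_on[OF S cut(1) this]
    from Bochner_Integration.integrable_diff[OF cg(1) i1[of n]]
    show i: "integrable ?M (\<lambda>x. D n x * h x)" by simp
    have "(LINT x|?M. \<eta> n x * W x) + (LINT x|?M. D n x * h x) = 0"
      using cg(2) cut(2) Bochner_Integration.integral_add[OF i1[of n] i] by simp
    then show "(LINT x|?M. D n x * h x) = - (LINT x|?M. \<eta> n x * W x)" by simp
  qed
  have sp: "x \<in> space ?M \<Longrightarrow> x \<in> \<Omega>" for x by simp
  have "(\<lambda>n. LINT x|?M. \<eta> n x * W x) \<longlonglongrightarrow> (LINT x|?M. W x)"
  proof (rule integral_dominated_convergence[OF Wm \<eta>Wm iW _ \<eta>W_bd])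
    show "AE x in ?M. (\<lambda>n. \<eta> n x * W x) \<longlonglongrightarrow> W x"
    proof (rule AE_I2)
      fix x assume "x \<in> space ?M"
      from ev[OF sp[OF this]] have "\<forall>\<^sub>F n in sequentially. \<eta> n x * W x = W x" by eventually_elim simp
      then show "(\<lambda>n. \<eta> n x * W x) \<longlonglongrightarrow> W x" by (rule tendsto_eventually)
    qed
  qed
  moreover have "(\<lambda>n. LINT x|?M. D n x * h x) \<longlonglongrightarrow> (LINT x|?M. 0)"
  proof (rule integral_dominated_convergence[where w = "\<lambda>x. C * \<bar>h x\<bar>"])
    show "AE x in ?M. (\<lambda>n. D n x * h x) \<longlonglongrightarrow> 0"
    proof (rule AE_I2)
      fix x assume "x \<in> space ?M"
      from ev[OF sp[OF this]] have "\<forall>\<^sub>F n in sequentially. D n x * h x = 0" by eventually_elim simp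
      then show "(\<lambda>n. D n x * h x) \<longlonglongrightarrow> 0" by (rule tendsto_eventually)
    qed
    show "AE x in ?M. norm (D n x * h x) \<le> C * \<bar>h x\<bar>" for n
      using Dbound[of n] by eventually_elim (auto simp: abs_mult intro: mult_right_mono)
    show "(\<lambda>x. D n x * h x) \<in> borel_measurable ?M" for n using i2(1) by blast
    show "integrable ?M (\<lambda>x. C * \<bar>h x\<bar>)" using h(2) by (intro integrable_mult_right integrable_abs)
  qed simp
  ultimately have "(\<lambda>n. (LINT x|?M. \<eta> n x * W x) + (LINT x|?M. D n x * h x)) \<longlonglongrightarrow> (LINT x|?M. W x) + 0"
    by (intro tendsto_add) auto
  then show ?thesis using i2(2) LIMSEQ_unique[of "\<lambda>_. 0::real"] by fastforce
qed


section \<open>The Fisher-Rao inner product and orthogonal projection\<close>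

text \<open>Functions are not identified when they agree almost everywhere, so the Fisher-Rao form
  is only semidefinite on them. Axiom \<open>closed\<close> with \<open>c = -1\<close> yields
  differences, and hence the zero function.\<close>

locale semi_inner_function_space =
  fixes B :: "('a \<Rightarrow> real) \<Rightarrow> ('a \<Rightarrow> real) \<Rightarrow> real" and S :: "('a \<Rightarrow> real) set"
  assumes closed: "p \<in> S \<Longrightarrow> q \<in> S \<Longrightarrow> (\<lambda>x. p x + c * q x) \<in> S"
    and lin: "p \<in> S \<Longrightarrow> q \<in> S \<Longrightarrow> v \<in> S \<Longrightarrow> B (\<lambda>x. p x + c * q x) v = B p v + c * B q v"
    and sym: "p \<in> S \<Longrightarrow> q \<in> S \<Longrightarrow> B p q = B q p"
    and nonneg: "p \<in> S \<Longrightarrow> 0 \<le> B p p"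
begin

lemma lin_right:
  "p \<in> S \<Longrightarrow> q \<in> S \<Longrightarrow> v \<in> S \<Longrightarrow> B v (\<lambda>x. p x + c * q x) = B v p + c * B v q"
  using lin[of p q v c] sym closed by metis

lemma diff_closed: "p \<in> S \<Longrightarrow> q \<in> S \<Longrightarrow> (\<lambda>x. p x - q x) \<in> S"
  using closed[of p q "-1"] by simp

lemma diff_left:
  "p \<in> S \<Longrightarrow> q \<in> S \<Longrightarrow> v \<in> S \<Longrightarrow> B (\<lambda>x. p x - q x) v = B p v - B q v"
  using lin[of p q v "-1"] by simp

lemma diff_right:
  "p \<in> S \<Longrightarrow> q \<in> S \<Longrightarrow> v \<in> S \<Longrightarrow> B v (\<lambda>x. p x - q x) = B v p - B v q"
  using lin_right[of p q v "-1"] by simp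

lemma Cauchy_Schwarz_square:
  assumes p: "p \<in> S" and q: "q \<in> S"
  shows "(B p q)\<^sup>2 \<le> B p p * B q q"
proof -
  have quad: "0 \<le> B p p + 2 * c * B p q + c\<^sup>2 * B q q" for c
  proof -
    have "0 \<le> B (\<lambda>x. p x + c * q x) (\<lambda>x. p x + c * q x)" by (intro nonneg closed p q)
    also have "\<dots> = B p p + 2 * c * B p q + c\<^sup>2 * B q q"
      using p q closed by (simp add: lin lin_right sym[OF q p] power2_eq_square algebra_simps)
    finally show ?thesis .
  qed
  show ?thesis
  proof (cases "B q q = 0")
    case True
    have "B p q = 0"
    proof (rule ccontr)
      assume "B p q \<noteq> 0"
      \<comment> \<open>With \<open>B q q = 0\<close> the quadratic is affine in \<open>c\<close>,
        and this \<open>c\<close> gives it the value -1.\<close>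
      then show False using quad[of "- (B p p + 1) / (2 * B p q)"] True by (simp add: field_simps)
    qed
    then show ?thesis using True by simp
  next
    case False
    then have "B q q > 0" using nonneg[OF q] by simp
    \<comment> \<open>The minimiser of the quadratic in \<open>c\<close>.\<close>
    then show ?thesis using quad[of "- B p q / B q q"] by (simp add: field_simps power2_eq_square)
  qed
qed

lemma Cauchy_Schwarz:
  assumes p: "p \<in> S" and q: "q \<in> S"
  shows "\<bar>B p q\<bar> \<le> sqrt (B p p) * sqrt (B q q)"
  using real_sqrt_le_mono[OF Cauchy_Schwarz_square[OF assms]] by (simp add: real_sqrt_mult)

lemma combination_closed:
  assumes "\<And>i. i \<in> {1..m::nat} \<Longrightarrow> \<phi> i \<in> S" and "S \<noteq> {}"
  shows "(\<lambda>x. \<Sum>i=1..m. c i * \<phi> i x) \<in> S"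
  using assms
proof (induction m)
  case 0
  then obtain p where "p \<in> S" by blast
  from diff_closed[OF this this] show ?case by simp
next
  case (Suc m)
  then show ?case using closed[of "\<lambda>x. \<Sum>i=1..m. c i * \<phi> i x" "\<phi> (Suc m)" "c (Suc m)"] by simp
qed

lemma orthogonal_combination:
  assumes "\<And>i. i \<in> {1..m::nat} \<Longrightarrow> \<phi> i \<in> S" and v: "v \<in> S"
    and "\<And>i. i \<in> {1..m} \<Longrightarrow> B v (\<phi> i) = 0"
  shows "B v (\<lambda>x. \<Sum>i=1..m. c i * \<phi> i x) = 0"
  using assms(1,3)
proof (induction m)
  case 0
  show ?case using diff_right[OF v v v] by simp
next
  case (Suc m)
  have "(\<lambda>x. \<Sum>i=1..m. c i * \<phi> i x) \<in> S" using Suc.prems v by (intro combination_closed) auto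
  then show ?case
    using lin_right[of "\<lambda>x. \<Sum>i=1..m. c i * \<phi> i x" "\<phi> (Suc m)" v "c (Suc m)"] Suc v by simp
qed

text \<open>Gram-Schmidt; a null direction of the semi-definite form needs no correction.\<close>
lemma projection_exists:
  assumes "\<And>i. i \<in> {1..m::nat} \<Longrightarrow> \<phi> i \<in> S" and "p \<in> S"
  shows "\<exists>c. \<forall>j\<in>{1..m}. B (\<lambda>x. p x - (\<Sum>i=1..m. c i * \<phi> i x)) (\<phi> j) = 0"
  using assms
proof (induction m arbitrary: p)
  case 0
  then show ?case by simp
next
  case (Suc m)
  have \<phi>: "\<And>i. i \<in> {1..m} \<Longrightarrow> \<phi> i \<in> S" "\<phi> (Suc m) \<in> S" using Suc.prems by auto
  obtain c where c: "\<And>j. j \<in> {1..m} \<Longrightarrow> B (\<lambda>x. p x - (\<Sum>i=1..m. c i * \<phi> i x)) (\<phi> j) = 0"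
    using Suc.IH[OF \<phi>(1) Suc.prems(2)] by blast
  obtain d where d: "\<And>j. j \<in> {1..m} \<Longrightarrow> B (\<lambda>x. \<phi> (Suc m) x - (\<Sum>i=1..m. d i * \<phi> i x)) (\<phi> j) = 0"
    using Suc.IH[OF \<phi>(1) \<phi>(2)] by blast
  define r where "r x = p x - (\<Sum>i=1..m. c i * \<phi> i x)" for x
  define s where "s x = (\<Sum>i=1..m. d i * \<phi> i x)" for x
  define e where "e x = \<phi> (Suc m) x - s x" for x
  have s: "s \<in> S" unfolding s_def[abs_def] using \<phi> by (intro combination_closed) auto
  have e: "e \<in> S" unfolding e_def[abs_def] by (intro diff_closed \<phi> s)
  have r: "r \<in> S" unfolding r_def[abs_def] using \<phi> Suc.prems(2) by (intro diff_closed combination_closed) auto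
  \<comment> \<open>\<open>e\<close> is the new vector made orthogonal to the previous ones, and
    \<open>a\<close> is the coefficient of \<open>r\<close> along it. If \<open>B e e = 0\<close>,
    Cauchy-Schwarz already gives \<open>B r e = 0\<close>.\<close>
  define a where "a = (if B e e = 0 then 0 else B r e / B e e)"
  define r' where "r' x = r x + (- a) * e x" for x
  have r': "r' \<in> S" unfolding r'_def[abs_def] by (intro closed r e)
  have r'v: "B r' v = B r v - a * B e v" if "v \<in> S" for v
    unfolding r'_def[abs_def] using lin[OF r e that, of "-a"] by simp
  have orth: "B r' (\<phi> j) = 0" if "j \<in> {1..m}" for j
    using r'v[OF \<phi>(1)[OF that]] c[OF that] d[OF that] by (simp add: r_def[abs_def] e_def[abs_def] s_def)
  have "B r e = 0" if "B e e = 0" using Cauchy_Schwarz_square[OF r e] that by simp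
  then have "B r' e = 0" using r'v[OF e] by (simp add: a_def)
  moreover have "B r' s = 0"
    unfolding s_def[abs_def] using orth \<phi>(1) r' by (intro orthogonal_combination) auto
  \<comment> \<open>The new vector is \<open>e + s\<close>, so orthogonality to \<open>e\<close> and
    to the span of the previous vectors suffices.\<close>
  moreover have "B r' (\<phi> (Suc m)) = B r' e + 1 * B r' s"
    using lin_right[OF e s r', of 1] by (simp add: e_def)
  ultimately have "B r' (\<phi> (Suc m)) = 0" by simp
  with orth have all: "\<forall>j\<in>{1..Suc m}. B r' (\<phi> j) = 0" by (auto simp: le_Suc_eq)
  define c' where "c' i = (if i = Suc m then a else c i - a * d i)" for i
  have "r' = (\<lambda>x. p x - (\<Sum>i=1..Suc m. c' i * \<phi> i x))"
  proof
    fix x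
    have "(\<Sum>i=1..m. c' i * \<phi> i x) = (\<Sum>i=1..m. c i * \<phi> i x) - a * (\<Sum>i=1..m. d i * \<phi> i x)"
      unfolding sum_distrib_left sum_subtractf[symmetric] by (intro sum.cong) (auto simp: c'_def algebra_simps)
    then show "r' x = p x - (\<Sum>i=1..Suc m. c' i * \<phi> i x)"
      by (simp add: r'_def r_def e_def s_def c'_def algebra_simps)
  qed
  with all show ?case by blast
qed

end

section \<open>The Fisher-Rao form as a semi-inner product, and its projection onto the Galerkin
  space\<close>

lemma fr_product_integrable:
  assumes \<sigma>: "\<sigma> \<in> borel_measurable (lebesgue_on \<Omega>)" "\<forall>x\<in>\<Omega>. 0 < \<sigma> x"
    and p: "p \<in> fr_L2 \<Omega> \<sigma>" and q: "q \<in> fr_L2 \<Omega> \<sigma>"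
  shows "integrable (lebesgue_on \<Omega>) (\<lambda>x. p x * q x / \<sigma> x)"
proof (rule Bochner_Integration.integrable_bound)
  show "integrable (lebesgue_on \<Omega>) (\<lambda>x. p x * p x / \<sigma> x + q x * q x / \<sigma> x)"
    using p q by (auto simp: fr_L2_def)
  show "(\<lambda>x. p x * q x / \<sigma> x) \<in> borel_measurable (lebesgue_on \<Omega>)"
    using p q \<sigma>(1) by (auto simp: fr_L2_def)
  show "AE x in lebesgue_on \<Omega>. norm (p x * q x / \<sigma> x) \<le> norm (p x * p x / \<sigma> x + q x * q x / \<sigma> x)"
  proof (rule AE_I2)
    fix x assume "x \<in> space (lebesgue_on \<Omega>)"
    then have s: "\<sigma> x > 0" using \<sigma>(2) by simp
    have "0 \<le> (\<bar>p x\<bar> - \<bar>q x\<bar>)\<^sup>2" by simp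
    then have "2 * (\<bar>p x\<bar> * \<bar>q x\<bar>) \<le> p x * p x + q x * q x" by (simp add: power2_eq_square algebra_simps)
    moreover have "0 \<le> \<bar>p x\<bar> * \<bar>q x\<bar>" by simp
    ultimately have "\<bar>p x * q x\<bar> \<le> p x * p x + q x * q x" unfolding abs_mult by linarith
    then show "norm (p x * q x / \<sigma> x) \<le> norm (p x * p x / \<sigma> x + q x * q x / \<sigma> x)"
      using s by (simp add: add_divide_distrib[symmetric] divide_right_mono)
  qed
qed

lemma fr_semi_inner_function_space:
  assumes \<sigma>: "\<sigma> \<in> borel_measurable (lebesgue_on \<Omega>)" "\<forall>x\<in>\<Omega>. 0 < \<sigma> x"
  shows "semi_inner_function_space (fr_inner \<Omega> \<sigma>) (fr_L2 \<Omega> \<sigma>)"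
proof
  note int = fr_product_integrable[OF \<sigma>]
  fix p q v :: "'a \<Rightarrow> real" and c :: real
  assume p: "p \<in> fr_L2 \<Omega> \<sigma>"
  show "0 \<le> fr_inner \<Omega> \<sigma> p p"
    unfolding fr_inner_def
  proof (rule Bochner_Integration.integral_nonneg_AE, rule AE_I2)
    fix x assume "x \<in> space (lebesgue_on \<Omega>)"
    then show "0 \<le> p x * p x / \<sigma> x" using \<sigma>(2) by (simp add: less_imp_le)
  qed
  assume q: "q \<in> fr_L2 \<Omega> \<sigma>"
  show "fr_inner \<Omega> \<sigma> p q = fr_inner \<Omega> \<sigma> q p" by (simp add: fr_inner_def mult.commute)
  have "(\<lambda>x. (p x + c * q x) * (p x + c * q x) / \<sigma> x)
      = (\<lambda>x. p x * p x / \<sigma> x + (2 * c) * (p x * q x / \<sigma> x) + c\<^sup>2 * (q x * q x / \<sigma> x))"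
    by (auto simp: fun_eq_iff power2_eq_square add_divide_distrib algebra_simps)
  moreover have "integrable (lebesgue_on \<Omega>)
      (\<lambda>x. p x * p x / \<sigma> x + (2 * c) * (p x * q x / \<sigma> x) + c\<^sup>2 * (q x * q x / \<sigma> x))"
    by (intro Bochner_Integration.integrable_add integrable_mult_right int p q)
  ultimately show "(\<lambda>x. p x + c * q x) \<in> fr_L2 \<Omega> \<sigma>"
    using p q by (auto simp: fr_L2_def)
  assume v: "v \<in> fr_L2 \<Omega> \<sigma>"
  have "(\<lambda>x. (p x + c * q x) * v x / \<sigma> x) = (\<lambda>x. p x * v x / \<sigma> x + c * (q x * v x / \<sigma> x))"
    by (auto simp: fun_eq_iff add_divide_distrib algebra_simps)
  then show "fr_inner \<Omega> \<sigma> (\<lambda>x. p x + c * q x) v = fr_inner \<Omega> \<sigma> p v + c * fr_inner \<Omega> \<sigma> q v"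
    unfolding fr_inner_def using int[OF p v] int[OF q v] by (simp del: times_divide_eq_right)
qed

text \<open>The points of \<open>\<Omega>\<close> where \<open>q\<close> is nonzero form an open
  negligible set, which must be empty; continuity carries the value 0 to the closure.\<close>

lemma continuous_AE_zero_imp_zero:
  fixes q :: "'a::euclidean_space \<Rightarrow> real"
  assumes "open \<Omega>" "continuous_on (closure \<Omega>) q" "AE x in lebesgue_on \<Omega>. q x = 0" "x \<in> closure \<Omega>"
  shows "q x = 0"
proof (rule continuous_constant_on_closure[OF assms(2) _ assms(4)])
  fix y assume y: "y \<in> \<Omega>"
  show "q y = 0"
  proof (rule ccontr)
    assume n: "q y \<noteq> 0"
    have "open {x \<in> \<Omega>. q x \<in> - {0}}"
      using continuous_on_subset[OF assms(2) closure_subset] assms(1)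
      by (intro continuous_open_preimage[unfolded vimage_def Int_def mem_Collect_eq]) auto
    moreover have "negligible {x \<in> \<Omega>. q x \<in> - {0}}"
    proof -
      have "AE x in lebesgue. x \<notin> {x \<in> \<Omega>. q x \<in> - {0}}"
        using assms(3) unfolding AE_lebesgue_on_iff[OF open_sets_lebesgue[OF assms(1)]]
        by eventually_elim auto
      then have "{x \<in> \<Omega>. q x \<in> - {0}} \<in> null_sets lebesgue"
        using completion.null_sets_iff_AE by fastforce
      then show ?thesis by (simp add: negligible_iff_null_sets)
    qed
    ultimately have "{x \<in> \<Omega>. q x \<in> - {0}} = {}" using open_not_negligible by blast
    then show False using y n by blast
  qed
qed

lemma galerkin_spaceI: "\<sigma> = (\<lambda>x. \<Sum>i=1..m. c i * \<phi> i x) \<Longrightarrow> \<sigma> \<in> galerkin_space m \<phi>"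
  unfolding galerkin_space_def mem_Collect_eq by (rule exI[of _ c])

text \<open>Well-definedness of the \<open>THE\<close> term. Existence is Gram-Schmidt. The
  difference of two candidates has norm 0, so it vanishes almost everywhere and by continuity on the
  closure; linear independence then equates the coefficients, and the candidates agree as total
  functions, also off the closure.\<close>

lemma fr_projection:
  fixes \<Omega> :: "'a::euclidean_space set"
  assumes \<Omega>: "open \<Omega>" and basis: "galerkin_basis \<Omega> m \<phi>"
    and \<sigma>: "\<sigma> \<in> borel_measurable (lebesgue_on \<Omega>)" "\<forall>x\<in>\<Omega>. 0 < \<sigma> x"
    and V: "galerkin_space m \<phi> \<subseteq> fr_L2 \<Omega> \<sigma>" and p: "p \<in> fr_L2 \<Omega> \<sigma>"
  defines "q \<equiv> fr_projection \<Omega> \<sigma> (galerkin_space m \<phi>) p"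
  shows "q \<in> galerkin_space m \<phi>"
    "\<And>v. v \<in> galerkin_space m \<phi> \<Longrightarrow> fr_inner \<Omega> \<sigma> (\<lambda>x. p x - q x) v = 0"
proof -
  interpret semi_inner_function_space "fr_inner \<Omega> \<sigma>" "fr_L2 \<Omega> \<sigma>"
    by (rule fr_semi_inner_function_space[OF \<sigma>])
  let ?V = "galerkin_space m \<phi>"
  let ?P = "\<lambda>q. q \<in> ?V \<and> (\<forall>v\<in>?V. fr_inner \<Omega> \<sigma> (\<lambda>x. p x - q x) v = 0)"
  have \<phi>V: "\<phi> i \<in> ?V" if "i \<in> {1..m}" for i
  proof -
    have "\<phi> i = (\<lambda>x. \<Sum>j=1..m. (if j = i then 1 else 0) * \<phi> j x)"
      using that by (auto simp: fun_eq_iff if_distrib[of "\<lambda>c. c * _"] cong: if_cong)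
    then show ?thesis by (rule galerkin_spaceI)
  qed
  have ex: "\<exists>q. ?P q"
  proof -
    obtain c where c: "\<And>j. j \<in> {1..m} \<Longrightarrow> fr_inner \<Omega> \<sigma> (\<lambda>x. p x - (\<Sum>i=1..m. c i * \<phi> i x)) (\<phi> j) = 0"
      using projection_exists[of m \<phi> p] \<phi>V V p by blast
    let ?q = "\<lambda>x. \<Sum>i=1..m. c i * \<phi> i x"
    have qV: "?q \<in> ?V" by (rule galerkin_spaceI) (rule refl)
    then have r: "(\<lambda>x. p x - ?q x) \<in> fr_L2 \<Omega> \<sigma>" using V p by (intro diff_closed) auto
    have "fr_inner \<Omega> \<sigma> (\<lambda>x. p x - ?q x) v = 0" if v: "v \<in> ?V" for v
    proof -
      obtain d where "v = (\<lambda>x. \<Sum>i=1..m. d i * \<phi> i x)" using v unfolding galerkin_space_def by blast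
      then show ?thesis using orthogonal_combination[of m \<phi> "\<lambda>x. p x - ?q x" d] \<phi>V V r c by blast
    qed
    then show ?thesis using qV by blast
  qed
  have unique: "q1 = q2" if q1: "?P q1" and q2: "?P q2" for q1 q2
  proof -
    obtain c1 c2 where c1: "q1 = (\<lambda>x. \<Sum>i=1..m. c1 i * \<phi> i x)" and c2: "q2 = (\<lambda>x. \<Sum>i=1..m. c2 i * \<phi> i x)"
      using q1 q2 unfolding galerkin_space_def by blast
    define w where "w x = q1 x - q2 x" for x
    have w: "w x = (\<Sum>i=1..m. (c1 i - c2 i) * \<phi> i x)" for x
      by (simp add: w_def c1 c2 left_diff_distrib sum_subtractf)
    have "w = (\<lambda>x. \<Sum>i=1..m. (c1 i - c2 i) * \<phi> i x)" using w by (rule ext)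
    then have wV: "w \<in> ?V"
      by (rule galerkin_spaceI)
    have L2: "q1 \<in> fr_L2 \<Omega> \<sigma>" "q2 \<in> fr_L2 \<Omega> \<sigma>" "w \<in> fr_L2 \<Omega> \<sigma>" using q1 q2 wV V by auto
    have "fr_inner \<Omega> \<sigma> w w = fr_inner \<Omega> \<sigma> (\<lambda>x. p x - q2 x) w - fr_inner \<Omega> \<sigma> (\<lambda>x. p x - q1 x) w"
      using L2 p diff_left[of q1 q2 w] by (simp add: diff_left w_def[symmetric])
    also have "\<dots> = 0" using q1 q2 wV by simp
    finally have z: "(LINT x|lebesgue_on \<Omega>. w x * w x / \<sigma> x) = 0" by (simp add: fr_inner_def)
    have "AE x in lebesgue_on \<Omega>. w x * w x / \<sigma> x = 0"
    proof (rule integral_nonneg_eq_0_iff_AE[THEN iffD1, OF _ _ z])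
      show "integrable (lebesgue_on \<Omega>) (\<lambda>x. w x * w x / \<sigma> x)" using L2(3) by (simp add: fr_L2_def)
      show "AE x in lebesgue_on \<Omega>. 0 \<le> w x * w x / \<sigma> x"
      proof (rule AE_I2)
        fix x assume "x \<in> space (lebesgue_on \<Omega>)"
        then show "0 \<le> w x * w x / \<sigma> x" using \<sigma>(2) by (simp add: less_imp_le)
      qed
    qed
    moreover have "AE x in lebesgue_on \<Omega>. x \<in> \<Omega>" by (rule AE_I2) simp
    ultimately have AE: "AE x in lebesgue_on \<Omega>. w x = 0"
      by eventually_elim (use \<sigma>(2) in force)
    have "continuous_on (closure \<Omega>) w"
    proof -
      have "continuous_on (closure \<Omega>) (\<phi> i)" if "i \<in> {1..m}" for i
        using basis that lipschitz_on_continuous_on unfolding galerkin_basis_def by blast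
      then show ?thesis unfolding w[abs_def] by (intro continuous_intros) auto
    qed
    from continuous_AE_zero_imp_zero[OF \<Omega> this AE]
    have "\<forall>x\<in>closure \<Omega>. (\<Sum>i=1..m. (c1 i - c2 i) * \<phi> i x) = 0" using w by simp
    moreover have "\<forall>c. (\<forall>x\<in>closure \<Omega>. (\<Sum>i=1..m. c i * \<phi> i x) = 0) \<longrightarrow> (\<forall>i\<in>{1..m}. c i = 0)"
      using basis unfolding galerkin_basis_def by (elim conjE)
    from this[THEN spec, of "\<lambda>i. c1 i - c2 i"] calculation
    have "\<forall>i\<in>{1..m}. c1 i - c2 i = 0" by (rule mp)
    then have "c1 i = c2 i" if "i \<in> {1..m}" for i using that by force
    then show ?thesis unfolding c1 c2 by (intro ext sum.cong refl) (simp only:)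
  qed
  have "\<exists>!q. ?P q" by (rule ex_ex1I[OF ex unique])
  then have "?P q" unfolding q_def fr_projection_def by (rule theI')
  then show "q \<in> ?V" "\<And>v. v \<in> ?V \<Longrightarrow> fr_inner \<Omega> \<sigma> (\<lambda>x. p x - q x) v = 0" by auto
qed

text \<open>On the reals \<open>INF\<close> denotes a true infimum only for a nonempty set bounded
  below, hence the conjunct on \<open>bdd_below\<close>; \<open>V\<close> contains the zero
  function.\<close>

theorem theorem5p4:
  fixes \<Omega> :: "'a::euclidean_space set"
    and T :: "real set"
    and u :: "real \<Rightarrow> 'a \<Rightarrow> 'a"
    and \<rho> \<rho>h :: "real \<Rightarrow> 'a \<Rightarrow> real"
    and \<phi> :: "nat \<Rightarrow> 'a \<Rightarrow> real"
    and m :: nat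
  defines "V \<equiv> galerkin_space m \<phi>"
    and "res \<equiv> \<lambda>t x. time_deriv \<rho>h t x + divergence (\<lambda>y. \<rho>h t y *\<^sub>R u t y) x"
  assumes domain: "open \<Omega>" "connected \<Omega>" "\<Omega> \<noteq> {}"
    and time: "open T"
    and velocity: "\<And>t. t \<in> T \<Longrightarrow> \<exists>L. L-lipschitz_on (closure \<Omega>) (u t)"
    and velocity_boundary: "\<And>t x. t \<in> T \<Longrightarrow> x \<in> frontier \<Omega> \<Longrightarrow> u t x = 0"
    and basis: "galerkin_basis \<Omega> m \<phi>"
    and pos: "\<And>t x. t \<in> T \<Longrightarrow> x \<in> \<Omega> \<Longrightarrow> \<rho> t x > 0"
    and transport: "weak_transport T \<Omega> u \<rho>"
    and galerkin: "fisher_rao_galerkin T \<Omega> m \<phi> u \<rho>h"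
    and pos_galerkin: "\<And>t x. t \<in> T \<Longrightarrow> x \<in> \<Omega> \<Longrightarrow> \<rho>h t x > 0"
    and space_regular: "\<And>t. t \<in> T \<Longrightarrow> local_lipschitz {t} \<Omega> \<rho>"
    and time_regular: "time_regular T \<Omega> \<rho>"
    and KL_regular:
      "time_regular T \<Omega> (\<lambda>t x. ln (\<rho> t x / \<rho>h t x) * \<rho> t x - \<rho> t x + \<rho>h t x)"
    and square_integrable: "\<And>t. t \<in> T \<Longrightarrow> \<rho> t \<in> fr_L2 \<Omega> (\<rho>h t)"
      "\<And>t. t \<in> T \<Longrightarrow> V \<subseteq> fr_L2 \<Omega> (\<rho>h t)"
      "\<And>t. t \<in> T \<Longrightarrow> res t \<in> fr_L2 \<Omega> (\<rho>h t)"
    and t: "t \<in> T"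
  shows "((\<lambda>s. KL_div \<Omega> (\<rho> s) (\<rho>h s)) has_real_derivative
            (INF \<sigma>\<in>V. - fr_inner \<Omega> (\<rho>h t) (res t) (\<lambda>x. \<rho> t x - \<sigma> x))) (at t)
       \<and> bdd_below ((\<lambda>\<sigma>. - fr_inner \<Omega> (\<rho>h t) (res t) (\<lambda>x. \<rho> t x - \<sigma> x)) ` V)
       \<and> (INF \<sigma>\<in>V. - fr_inner \<Omega> (\<rho>h t) (res t) (\<lambda>x. \<rho> t x - \<sigma> x))
           \<le> fr_norm \<Omega> (\<rho>h t) (res t)
             * fr_norm \<Omega> (\<rho>h t) (\<lambda>x. \<rho> t x - fr_projection \<Omega> (\<rho>h t) V (\<rho> t) x)"
proof -
  let ?M = "lebesgue_on \<Omega>"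
  have S: "\<Omega> \<in> sets lebesgue" by (rule open_sets_lebesgue[OF domain(1)])
  have sub: "\<Omega> \<subseteq> closure \<Omega>" by (rule closure_subset)
  obtain r where r: "\<And>i. i \<in> {1..m} \<Longrightarrow> r i differentiable_on T"
    and \<rho>h_eq: "\<And>s x. s \<in> T \<Longrightarrow> x \<in> closure \<Omega> \<Longrightarrow> \<rho>h s x = (\<Sum>i=1..m. r i s * \<phi> i x)"
    using galerkin unfolding fisher_rao_galerkin_def by blast
  have galerkin_eq: "(LINT x|?M. \<sigma> x * time_deriv \<rho>h t x / \<rho>h t x)
      + (LINT x|?M. \<sigma> x * divergence (\<lambda>y. \<rho>h t y *\<^sub>R u t y) x / \<rho>h t x) = 0" if "\<sigma> \<in> V" for \<sigma>
    using galerkin t that unfolding fisher_rao_galerkin_def V_def by blast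
  have \<phi>_lip: "\<exists>L. L-lipschitz_on (closure \<Omega>) (\<phi> i)" if "i \<in> {1..m}" for i
    using basis that unfolding galerkin_basis_def by blast
  obtain L where L: "L-lipschitz_on (closure \<Omega>) (u t)" using velocity[OF t] by blast

  \<comment> \<open>Membership in \<open>V\<close> is equality of total functions, while
    \<open>\<rho>h t\<close> is known only on the closure; \<open>\<sigma>h\<close> is its
    representative in \<open>V\<close>.\<close>
  define \<sigma>h where "\<sigma>h x = (\<Sum>i=1..m. r i t * \<phi> i x)" for x
  have \<sigma>hV: "\<sigma>h \<in> V" unfolding V_def \<sigma>h_def[abs_def] by (rule galerkin_spaceI) (rule refl)
  have \<sigma>h: "\<rho>h t x = \<sigma>h x" if "x \<in> \<Omega>" for x using \<rho>h_eq[OF t] that sub by (auto simp: \<sigma>h_def)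

  have \<rho>_lip: "locally_lipschitz \<Omega> (\<rho> t)"
    unfolding locally_lipschitz_def
  proof
    fix x assume x: "x \<in> \<Omega>"
    obtain e K where e: "0 < e" "K-lipschitz_on (cball x e \<inter> \<Omega>) (\<rho> t)"
      using local_lipschitzE[OF space_regular[OF t] _ x, of t] by (metis IntI cball_trivial insertI1 centre_in_cball less_imp_le)
    obtain e' where e': "0 < e'" "cball x e' \<subseteq> \<Omega>" using domain(1) x open_contains_cball by blast
    have "K-lipschitz_on (cball x (min e e')) (\<rho> t)" by (rule lipschitz_on_subset[OF e(2)]) (use e' in auto)
    then show "\<exists>r>0. \<exists>L. cball x r \<subseteq> \<Omega> \<and> L-lipschitz_on (cball x r) (\<rho> t)"
      using e e' by (intro exI[of _ "min e e'"]) auto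
  qed
  have \<phi>_loc: "locally_lipschitz \<Omega> (\<phi> i)" if "i \<in> {1..m}" for i
    using \<phi>_lip[OF that] lipschitz_on_imp_locally_lipschitz[OF _ domain(1) sub] by blast
  have "locally_lipschitz \<Omega> (\<lambda>x. \<Sum>i\<in>I. r i t * \<phi> i x)" if "I \<subseteq> {1..m}" "finite I" for I
    using that(2,1)
    by (induction I) (auto intro!: locally_lipschitz_add locally_lipschitz_mult locally_lipschitz_const domain(1) \<phi>_loc)
  then have "locally_lipschitz \<Omega> \<sigma>h" unfolding \<sigma>h_def[abs_def] by blast
  then have \<rho>h_lip: "locally_lipschitz \<Omega> (\<rho>h t)" by (rule locally_lipschitz_cong) (simp add: \<sigma>h)
  note u_lip = locally_lipschitz_inner_Basis[OF domain(1) L]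

  have \<rho>h_meas: "\<rho>h t \<in> borel_measurable ?M"
    using locally_lipschitz_continuous_on[OF \<rho>h_lip] S by (rule continuous_imp_measurable_on_sets_lebesgue)
  have "\<forall>x\<in>\<Omega>. 0 < \<rho>h t x" using pos_galerkin[OF t] by blast
  note fr = \<rho>h_meas this
  interpret semi_inner_function_space "fr_inner \<Omega> (\<rho>h t)" "fr_L2 \<Omega> (\<rho>h t)"
    by (rule fr_semi_inner_function_space[OF fr])
  note fr_int = fr_product_integrable[OF fr]
  note V_L2 = subsetD[OF square_integrable(2)[OF t]]
  note \<rho>_L2 = square_integrable(1)[OF t] and res_L2 = square_integrable(3)[OF t]

  \<comment> \<open>The time derivative falls on the coefficients alone, so on the closure it agrees
    with an element of \<open>V\<close>.\<close>
  define \<rho>h' where "\<rho>h' x = (\<Sum>i=1..m. deriv (r i) t * \<phi> i x)" for x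
  have \<rho>h'V: "\<rho>h' \<in> V" unfolding V_def \<rho>h'_def[abs_def] by (rule galerkin_spaceI) (rule refl)
  have \<rho>h_deriv: "((\<lambda>s. \<rho>h s x) has_real_derivative \<rho>h' x) (at t)" if x: "x \<in> closure \<Omega>" for x
  proof -
    have ev: "\<forall>\<^sub>F s in nhds t. \<rho>h s x = (\<Sum>i=1..m. r i s * \<phi> i x)"
      using eventually_nhds_in_open[OF time t] \<rho>h_eq x by (auto elim: eventually_mono)
    have "((\<lambda>s. r i s) has_real_derivative deriv (r i) t) (at t)" if "i \<in> {1..m}" for i
      using r[OF that] t time by (simp add: differentiable_on_eq_differentiable_at DERIV_deriv_iff_real_differentiable)
    then have "((\<lambda>s. \<Sum>i=1..m. r i s * \<phi> i x) has_real_derivative \<rho>h' x) (at t)"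
      unfolding \<rho>h'_def by (intro DERIV_sum DERIV_cmult_right) auto
    then show ?thesis by (subst DERIV_cong_ev[OF refl ev refl])
  qed
  have \<rho>h'_eq: "time_deriv \<rho>h t x = \<rho>h' x" if "x \<in> closure \<Omega>" for x
    using \<rho>h_deriv[OF that] by (rule DERIV_imp_deriv)

  have orth: "fr_inner \<Omega> (\<rho>h t) (res t) \<sigma> = 0" if \<sigma>: "\<sigma> \<in> V" for \<sigma>
  proof -
    \<comment> \<open>The Galerkin equation is a sum of two integrals. They may be merged once both
      integrands are known to be integrable, which follows from the finite norms of \<open>V\<close>
      and of \<open>res t\<close>.\<close>
    have "AE x in ?M. \<sigma> x * \<rho>h' x / \<rho>h t x = \<sigma> x * time_deriv \<rho>h t x / \<rho>h t x"
      using \<rho>h'_eq sub by (intro AE_I2) auto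
    note i1 = integral_cong_AE_lebesgue_on(1)[OF S fr_int[OF V_L2[OF \<sigma>] V_L2[OF \<rho>h'V]] this]
    have i2: "integrable ?M (\<lambda>x. \<sigma> x * res t x / \<rho>h t x)"
      by (rule fr_int[OF V_L2[OF \<sigma>] res_L2])
    have "(\<lambda>x. \<sigma> x * divergence (\<lambda>y. \<rho>h t y *\<^sub>R u t y) x / \<rho>h t x)
        = (\<lambda>x. \<sigma> x * res t x / \<rho>h t x - \<sigma> x * time_deriv \<rho>h t x / \<rho>h t x)"
      by (simp add: res_def fun_eq_iff diff_divide_distrib[symmetric] algebra_simps)
    then have "(LINT x|?M. \<sigma> x * res t x / \<rho>h t x) = 0"
      using galerkin_eq[OF \<sigma>] i1 i2 by simp
    then show ?thesis by (simp add: fr_inner_def mult.commute)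
  qed

  define f where "f = (\<lambda>s x. ln (\<rho> s x / \<rho>h s x) * \<rho> s x - \<rho> s x + \<rho>h s x)"
  have f_reg: "time_regular T \<Omega> f" unfolding f_def by (rule KL_regular)
  have f_int: "integrable ?M (f s)" and \<rho>_int: "integrable ?M (\<rho> s)" if "s \<in> T" for s
    using f_reg time_regular that unfolding time_regular_def by blast+
  have KL: "KL_div \<Omega> (\<rho> s) (\<rho>h s) = (LINT x|?M. f s x)" if s: "s \<in> T" for s
  proof -
    \<comment> \<open>On \<open>\<Omega>\<close> the Fisher-Rao square of \<open>\<rho>h s\<close>
      is \<open>\<rho>h s\<close> itself, so the finite norm of its representative in
      \<open>V\<close> is integrability of \<open>\<rho>h s\<close>. Then the three integrals in
      \<open>KL_div\<close> combine into one.\<close>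
    define \<tau> where "\<tau> x = (\<Sum>i=1..m. r i s * \<phi> i x)" for x
    have "\<tau> \<in> V" unfolding V_def \<tau>_def[abs_def] by (rule galerkin_spaceI) (rule refl)
    then have "integrable ?M (\<lambda>x. \<tau> x * \<tau> x / \<rho>h s x)"
      using square_integrable(2)[OF s] unfolding fr_L2_def by blast
    moreover have "AE x in ?M. \<tau> x * \<tau> x / \<rho>h s x = \<rho>h s x"
    proof (rule AE_I2)
      fix x assume "x \<in> space ?M"
      then have "x \<in> \<Omega>" by simp
      then have "\<tau> x = \<rho>h s x" "0 < \<rho>h s x" using \<rho>h_eq[OF s, of x] sub pos_galerkin[OF s] by (auto simp: \<tau>_def)
      then show "\<tau> x * \<tau> x / \<rho>h s x = \<rho>h s x" by simp
    qed
    ultimately have i3: "integrable ?M (\<rho>h s)" by (rule integral_cong_AE_lebesgue_on(1)[OF S])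
    have "integrable ?M (\<lambda>x. f s x + \<rho> s x - \<rho>h s x)"
      by (intro Bochner_Integration.integrable_add Bochner_Integration.integrable_diff f_int \<rho>_int s i3)
    then have i1: "integrable ?M (\<lambda>x. ln (\<rho> s x / \<rho>h s x) * \<rho> s x)" by (simp add: f_def)
    show ?thesis unfolding KL_div_def f_def using i1 \<rho>_int[OF s] i3 by simp
  qed
  note f_deriv = time_regular_has_derivative_integral[OF domain(1) time t f_reg]
  have ev_KL: "\<forall>\<^sub>F s in nhds t. KL_div \<Omega> (\<rho> s) (\<rho>h s) = (LINT x|?M. f s x)"
    using eventually_nhds_in_open[OF time t] KL by (auto elim: eventually_mono)
  have KL_deriv: "((\<lambda>s. KL_div \<Omega> (\<rho> s) (\<rho>h s)) has_real_derivative (LINT x|?M. time_deriv f t x)) (at t)"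
    using f_deriv(2) by (subst DERIV_cong_ev[OF refl ev_KL refl])

  \<comment> \<open>The factor of the time derivative of \<open>\<rho>\<close> is
    \<open>ln (\<rho> / \<rho>h) + 1 - 1\<close>: the term from differentiating the logarithm
    cancels against the summand \<open>- \<rho>\<close>.\<close>
  have f'_eq: "AE x in ?M. time_deriv f t x =
      time_deriv \<rho> t x * ln (\<rho> t x / \<rho>h t x) - \<rho> t x / \<rho>h t x * time_deriv \<rho>h t x + time_deriv \<rho>h t x"
  proof -
    have "AE x in ?M. (\<lambda>s. \<rho> s x) differentiable at t" using time_regular t unfolding time_regular_def by blast
    moreover have "AE x in ?M. x \<in> \<Omega>" by (rule AE_I2) simp
    ultimately show ?thesis
    proof eventually_elim
      case (elim x)
      define a where "a = time_deriv \<rho> t x"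
      have d1: "((\<lambda>s. \<rho> s x) has_real_derivative a) (at t)"
        using elim(1) DERIV_deriv_iff_real_differentiable unfolding a_def by blast
      have d2: "((\<lambda>s. \<rho>h s x) has_real_derivative \<rho>h' x) (at t)" using \<rho>h_deriv elim(2) sub by blast
      have p: "\<rho> t x > 0" "\<rho>h t x > 0" using pos[OF t elim(2)] pos_galerkin[OF t elim(2)] by auto
      have "((\<lambda>s. f s x) has_real_derivative a * ln (\<rho> t x / \<rho>h t x) - \<rho> t x / \<rho>h t x * \<rho>h' x + \<rho>h' x) (at t)"
        unfolding f_def using p
        by (auto intro!: derivative_eq_intros d1 d2 simp: field_simps)
      then have "time_deriv f t x = a * ln (\<rho> t x / \<rho>h t x) - \<rho> t x / \<rho>h t x * \<rho>h' x + \<rho>h' x"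
        by (rule DERIV_imp_deriv)
      then show ?case using \<rho>h'_eq elim(2) sub by (auto simp: a_def)
    qed
  qed

  have f_lip: "locally_lipschitz \<Omega> (f t)"
  proof -
    have "locally_lipschitz \<Omega> (\<lambda>x. (ln (\<rho> t x) - ln (\<rho>h t x)) * \<rho> t x - \<rho> t x + \<rho>h t x)"
      using pos[OF t] pos_galerkin[OF t]
      by (intro locally_lipschitz_add locally_lipschitz_diff locally_lipschitz_mult locally_lipschitz_ln
          \<rho>_lip \<rho>h_lip domain(1))
    then show ?thesis
    proof (rule locally_lipschitz_cong)
      fix x assume "x \<in> \<Omega>"
      then have "0 < \<rho> t x" "0 < \<rho>h t x" using pos[OF t] pos_galerkin[OF t] by auto
      then show "(ln (\<rho> t x) - ln (\<rho>h t x)) * \<rho> t x - \<rho> t x + \<rho>h t x = f t x"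
        by (simp add: f_def ln_div)
    qed
  qed

  \<comment> \<open>The value that the transport equation forces on the divergence of
    \<open>f u\<close>. Its summands are integrable by \<open>f_deriv\<close> and the finite norms,
    which gives integrability of the divergence.\<close>
  define W where "W x = res t x - \<rho> t x * res t x / \<rho>h t x - time_deriv f t x" for x
  have div_f: "AE x in ?M. divergence (\<lambda>y. f t y *\<^sub>R u t y) x = W x"
  proof -
    have "AE x in lebesgue. \<forall>c\<in>Basis. x \<in> \<Omega> \<longrightarrow> (\<forall>b\<in>Basis. line_differentiable (\<lambda>y. u t y \<bullet> c) b x)"
      by (subst AE_ball_countable) (auto intro: countable_finite AE_line_differentiable u_lip)
    moreover have "AE x in lebesgue. x \<in> \<Omega> \<longrightarrow> time_deriv \<rho> t x + divergence (\<lambda>y. \<rho> t y *\<^sub>R u t y) x = 0"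
      by (rule weak_transport_AE[OF domain(1) time t \<rho>_lip time_regular u_lip transport])
    moreover note AE_line_differentiable[OF \<rho>_lip] AE_line_differentiable[OF \<rho>h_lip]
      f'_eq[unfolded AE_lebesgue_on_iff[OF S]]
    ultimately show ?thesis unfolding AE_lebesgue_on_iff[OF S]
    proof eventually_elim
      case (elim x)
      show ?case
      proof
        assume x: "x \<in> \<Omega>"
        have p: "\<rho> t x > 0" "\<rho>h t x > 0" using pos[OF t x] pos_galerkin[OF t x] by auto
        \<comment> \<open>The coefficients of the chain rule for \<open>f\<close> also serve for the
          products with \<open>u\<close>. By homogeneity, Euler's identity \<open>f = \<rho> * ln
          (\<rho> / \<rho>h) + \<rho>h * (1 - \<rho> / \<rho>h)\<close> matches the terms that
          contain derivatives of \<open>u\<close>.\<close>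
        have "line_deriv (\<lambda>y. f t y * (u t y \<bullet> b)) b x =
            ln (\<rho> t x / \<rho>h t x) * line_deriv (\<lambda>y. \<rho> t y * (u t y \<bullet> b)) b x
            - \<rho> t x / \<rho>h t x * line_deriv (\<lambda>y. \<rho>h t y * (u t y \<bullet> b)) b x
            + line_deriv (\<lambda>y. \<rho>h t y * (u t y \<bullet> b)) b x" if b: "b \<in> Basis" for b
        proof -
          have ld: "line_differentiable (\<rho> t) b x" "line_differentiable (\<rho>h t) b x"
            "line_differentiable (\<lambda>y. u t y \<bullet> b) b x" using elim x b by auto
          have df: "((\<lambda>s. f t (x + s *\<^sub>R b)) has_real_derivative
              ln (\<rho> t x / \<rho>h t x) * line_deriv (\<rho> t) b x - \<rho> t x / \<rho>h t x * line_deriv (\<rho>h t) b x + line_deriv (\<rho>h t) b x) (at 0)"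
            unfolding f_def using p
            by (auto intro!: derivative_eq_intros line_differentiable_has_deriv ld simp: field_simps)
          have ldf: "line_differentiable (f t) b x"
            unfolding line_differentiable_def real_differentiable_def using df by blast
          show ?thesis
            unfolding line_deriv_mult[OF ldf ld(3)] line_deriv_mult[OF ld(1,3)] line_deriv_mult[OF ld(2,3)] line_derivI[OF df]
            using p by (simp add: f_def field_simps)
        qed
        then have "divergence (\<lambda>y. f t y *\<^sub>R u t y) x =
            ln (\<rho> t x / \<rho>h t x) * divergence (\<lambda>y. \<rho> t y *\<^sub>R u t y) x
            - \<rho> t x / \<rho>h t x * divergence (\<lambda>y. \<rho>h t y *\<^sub>R u t y) x
            + divergence (\<lambda>y. \<rho>h t y *\<^sub>R u t y) x"
          by (simp add: divergence_scaleR sum.distrib sum_subtractf sum_distrib_left)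
        also have "divergence (\<lambda>y. \<rho> t y *\<^sub>R u t y) x = - time_deriv \<rho> t x" using elim x by auto
        also have "divergence (\<lambda>y. \<rho>h t y *\<^sub>R u t y) x = res t x - time_deriv \<rho>h t x" by (simp add: res_def)
        also have "ln (\<rho> t x / \<rho>h t x) * - time_deriv \<rho> t x - \<rho> t x / \<rho>h t x * (res t x - time_deriv \<rho>h t x)
            + (res t x - time_deriv \<rho>h t x) = W x"
          using elim x by (simp add: W_def algebra_simps)
        finally show "divergence (\<lambda>y. f t y *\<^sub>R u t y) x = W x" .
      qed
    qed
  qed
  have res_int: "integrable ?M (res t)" and res_0: "(LINT x|?M. res t x) = 0"
  proof -
    have "AE x in ?M. res t x * \<sigma>h x / \<rho>h t x = res t x"
    proof (rule AE_I2)
      fix x assume "x \<in> space ?M"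
      then have "\<rho>h t x = \<sigma>h x" "0 < \<rho>h t x" using \<sigma>h pos_galerkin[OF t] by auto
      then show "res t x * \<sigma>h x / \<rho>h t x = res t x" by simp
    qed
    note cong = integral_cong_AE_lebesgue_on[OF S fr_int[OF res_L2 V_L2[OF \<sigma>hV]] this]
    show "integrable ?M (res t)" by (rule cong(1))
    show "(LINT x|?M. res t x) = 0" using cong(2) orth[OF \<sigma>hV] by (simp add: fr_inner_def)
  qed
  have res_\<rho>: "integrable ?M (\<lambda>x. \<rho> t x * res t x / \<rho>h t x)" by (rule fr_int[OF \<rho>_L2 res_L2])
  have W_int: "integrable ?M W"
    unfolding W_def[abs_def] by (intro Bochner_Integration.integrable_diff res_int res_\<rho> f_deriv(1))
  have "(LINT x|?M. W x) = 0"
    by (rule integral_divergence_eq_0[OF domain(1) f_lip f_int[OF t] L velocity_boundary[OF t] W_int div_f])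
  then have "(LINT x|?M. time_deriv f t x) = (LINT x|?M. res t x) - (LINT x|?M. \<rho> t x * res t x / \<rho>h t x)"
    unfolding W_def[abs_def] using res_int res_\<rho> f_deriv(1) by simp
  also have "\<dots> = - fr_inner \<Omega> (\<rho>h t) (res t) (\<rho> t)"
    unfolding res_0 fr_inner_def by (simp add: mult.commute)
  finally have KL_deriv': "((\<lambda>s. KL_div \<Omega> (\<rho> s) (\<rho>h s)) has_real_derivative - fr_inner \<Omega> (\<rho>h t) (res t) (\<rho> t)) (at t)"
    using KL_deriv by simp

  have const: "- fr_inner \<Omega> (\<rho>h t) (res t) (\<lambda>x. \<rho> t x - \<sigma> x) = - fr_inner \<Omega> (\<rho>h t) (res t) (\<rho> t)" if "\<sigma> \<in> V" for \<sigma>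
    using diff_right[OF \<rho>_L2 V_L2[OF that] res_L2] orth[OF that] by simp
  have image: "(\<lambda>\<sigma>. - fr_inner \<Omega> (\<rho>h t) (res t) (\<lambda>x. \<rho> t x - \<sigma> x)) ` V = {- fr_inner \<Omega> (\<rho>h t) (res t) (\<rho> t)}"
    using const \<sigma>hV by auto
  define q where "q = fr_projection \<Omega> (\<rho>h t) V (\<rho> t)"
  have qV: "q \<in> V"
    using fr_projection(1)[OF domain(1) basis fr square_integrable(2)[OF t, unfolded V_def] \<rho>_L2]
    by (simp add: q_def V_def)
  have "- fr_inner \<Omega> (\<rho>h t) (res t) (\<rho> t) = - fr_inner \<Omega> (\<rho>h t) (res t) (\<lambda>x. \<rho> t x - q x)"
    using const[OF qV] by simp
  also have "\<dots> \<le> fr_norm \<Omega> (\<rho>h t) (res t) * fr_norm \<Omega> (\<rho>h t) (\<lambda>x. \<rho> t x - q x)"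
    unfolding fr_norm_def using Cauchy_Schwarz[OF res_L2 diff_closed[OF \<rho>_L2 V_L2[OF qV]]] by linarith
  finally show ?thesis unfolding image using KL_deriv' by (simp add: q_def)
qed

end
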